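(* Let $k\in\mathbb{N}$, let $p,q\in(0,1)^k$ be probability vectors, let $\|\cdot\|$ be a norm on $\mathbb{R}^k$, let $\epsilon>0$, $\alpha\in(0,1)$, and let $X\sim\mathrm{Multi}(n_1,p)$, $Y\sim\mathrm{Multi}(n_2,q)$ be independent. Let $\hat d=\|\hat p-\hat q\|$ be the test statistic, let $\hat q_\alpha^*$ be the $\alpha$-quantile of the (conditional on the data) distribution of the constrained parametric bootstrap statistic $\hat d^*$, and let $T=d'_{p-q}(Z)$, all as defined in the context. Assume that (i) $n_1,n_2\to\infty$ such that $n_2/n_1$ converges to a limit in $(0,\infty)$; (ii) $\|\cdot\|:\mathbb{R}^k\to\mathbb{R}$ is directionally Hadamard differentiable at $p-q$ with a sublinear derivative $d'_{p-q}$; (iii) the distribution of the random variable $T$ is continuous (i.e. its distribution function is continuous); (iv) $\alpha$ is sufficiently small that the $\alpha$-quantile of $T$ is negative. Then the following hold. (a) If $\|p-q\|\ge\epsilon$ (the null hypothesis), then $$\limsup_{n_1,n_2\to\infty}\mathbb{P}(\hat d<\hat q_\alpha^* )\ \begin{cases}=0, & \text{if } \|p-q\|>\epsilon,\\ \le\alpha, & \text{if } \|p-q\|=\epsilon.\end{cases}$$ (b) If $\|p-q\|<\epsilon$ (the alternative), then $\lim_{n_1,n_2\to\infty}\mathbb{P}(\hat d<\hat q_\alpha^* )=1$. (c) If moreover $\|\cdot\|$ is Hadamard differentiable at $p-q$, then under the null hypothesis $\|p-q\|\ge\epsilon$ the display in (a) holds and, additionally, if $\|p-q\|=\epsilon$,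 then $\lim_{n_1,n_2\to\infty}\mathbb{P}(\hat d<\hat q_\alpha^* )=\alpha$.
   Context: Multinomial model. $\mathrm{Multi}(m,r)$ denotes the $k$-dimensional multinomial distribution with $m$ trials and class probabilities $r=(r_1,\dots,r_k)^\top$, $\sum_i r_i=1$. The likelihood of $(X^\top,Y^\top)^\top$ at $(x^\top,y^\top)^\top$ is $$L(p,q)=\binom{n_1}{x_1,\dots,x_k}\binom{n_2}{y_1,\dots,y_k}\prod_{i=1}^k p_i^{x_i}q_i^{y_i},$$ and $(\hat p,\hat q)=(X/n_1,Y/n_2)$ is the (unconstrained) maximum likelihood estimator (MLE). Put $n=n_1+n_2$. Directional Hadamard differentiability. The function $\|\cdot\|:\mathbb{R}^k\to\mathbb{R}$ is directionally Hadamard differentiable at $\theta\in\mathbb{R}^k$ if there is a continuous map $d'_\theta:\mathbb{R}^k\to\mathbb{R}$ such that $$\lim_{n\to\infty}\Big|\tfrac{1}{t_n}\big(\|\theta+t_nh_n\|-\|\theta\|\big)-d'_\theta(h)\Big|=0$$ for all sequences $(h_n)\subset\mathbb{R}^k$ with $h_n\to h\in\mathbb{R}^k$ and all sequences $(t_n)\subset\mathbb{R}^+$ with $t_n\downarrow0$. If $d'_\theta$ is linear, $\|\cdot\|$ is called Hadamard differentiable at $\theta$. Sublinear means subadditive and positively homogeneous. Limit variables. Under the assumption on $n_2/n_1$, $\sqrt n\big((\hat p-\hat q)-(p-q)\big)$ converges in distribution to a centered $k$-dimensional normal random vector $Z$ with (degenerate) covariance matrix $\Sigma$; explicitly, if $n_2/n_1\to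 c$, then $\Sigma=(1+c)(\mathrm{diag}(p)-pp^\top)+(1+c^{-1})(\mathrm{diag}(q)-qq^\top)$. Define $T:=d'_{p-q}(Z)$, which is the limit in distribution of $\sqrt n(\|\hat p-\hat q\|-\|p-q\|)$. Constrained parametric bootstrap. Let $\hat d=\|\hat p-\hat q\|$. Let $(\tilde p,\tilde q)$ be the constrained MLE, i.e. a maximizer of $L$ (evaluated at the observed data) over all pairs of probability vectors $(p',q')$ on $\{1,\dots,k\}$ with $\|p'-q'\|=\epsilon$; it is understood that such pairs exist. Put $$(\hat{\hat p},\hat{\hat q})=\begin{cases}(\hat p,\hat q) & \text{if }\hat d\ge\epsilon,\\ (\tilde p,\tilde q) & \text{if }\hat d<\epsilon.\end{cases}$$ Conditionally on the data $(X,Y)$, generate independent $X^*\sim\mathrm{Multi}(n_1,\hat{\hat p})$ and $Y^*\sim\mathrm{Multi}(n_2,\hat{\hat q})$, with corresponding MLEs $\hat p^*=X^*/n_1$, $\hat q^*=Y^*/n_2$, and set $\hat d^*=\|\hat p^*-\hat q^*\|$. Then $\hat q_\alpha^*$ is the $\alpha$-quantile of the conditional distribution of $\hat d^*$ given the data. The test of $H_0:\|p-q\|\ge\epsilon$ versus $H_1:\|p-q\|<\epsilon$ rejects $H_0$ when $\hat d<\hat q_\alpha^*$. *)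

theory Defs
  imports "HOL-Probability.Probability"
begin

definition is_norm :: "('a::real_vector \<Rightarrow> real) \<Rightarrow> bool" where
  "is_norm N \<longleftrightarrow>
     (\<forall>x. 0 \<le> N x) \<and> (\<forall>x. N x = 0 \<longleftrightarrow> x = 0) \<and>
     (\<forall>c x. N (c *\<^sub>R x) = \<bar>c\<bar> * N x) \<and> (\<forall>x y. N (x + y) \<le> N x + N y)"

definition prob_vec :: "real ^ 'k \<Rightarrow> bool" where
  "prob_vec r \<longleftrightarrow> (\<forall>i. 0 \<le> r $ i) \<and> (\<Sum>i\<in>UNIV. r $ i) = 1"

definition multinomial_coeff :: "nat ^ 'k \<Rightarrow> real" where
  "multinomial_coeff x = fact (\<Sum>i\<in>UNIV. x $ i) / (\<Prod>i\<in>UNIV. fact (x $ i))"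

(* Meaningful for probability vectors r only; see pmf_multinomial below. *)
definition multinomial_pmf :: "nat \<Rightarrow> real ^ 'k \<Rightarrow> (nat ^ 'k) pmf" where
  "multinomial_pmf m r = embed_pmf (\<lambda>x.
     if (\<Sum>i\<in>UNIV. x $ i) = m
     then multinomial_coeff x * (\<Prod>i\<in>UNIV. (r $ i) ^ (x $ i)) else 0)"

definition likelihood ::
  "nat ^ 'k \<Rightarrow> nat ^ 'k \<Rightarrow> real ^ 'k \<Rightarrow> real ^ 'k \<Rightarrow> real" where
  "likelihood x y p q = multinomial_coeff x * multinomial_coeff y *
     (\<Prod>i\<in>UNIV. (p $ i) ^ (x $ i) * (q $ i) ^ (y $ i))"

definition mle :: "nat \<Rightarrow> nat ^ 'k \<Rightarrow> real ^ 'k" where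
  "mle n x = (\<chi> i. real (x $ i) / real n)"

definition is_constrained_mle ::
  "(real ^ 'k \<Rightarrow> real) \<Rightarrow> real \<Rightarrow> nat ^ 'k \<Rightarrow> nat ^ 'k \<Rightarrow> (real ^ 'k) \<times> (real ^ 'k) \<Rightarrow> bool" where
  "is_constrained_mle N \<epsilon> x y t \<longleftrightarrow>
     is_arg_max (\<lambda>(p', q'). likelihood x y p' q')
       (\<lambda>(p', q'). prob_vec p' \<and> prob_vec q' \<and> N (p' - q') = \<epsilon>) t"

definition quantile :: "real measure \<Rightarrow> real \<Rightarrow> real" where
  "quantile D \<alpha> = Inf {x. \<alpha> \<le> cdf D x}"

definition test_stat ::
  "(real ^ 'k \<Rightarrow> real) \<Rightarrow> nat \<Rightarrow> nat \<Rightarrow> nat ^ 'k \<Rightarrow> nat ^ 'k \<Rightarrow> real" where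
  "test_stat N n1 n2 x y = N (mle n1 x - mle n2 y)"

(* In the following definitions t is the constrained MLE for the data x, y. *)
definition bootstrap_params ::
  "(real ^ 'k \<Rightarrow> real) \<Rightarrow> real \<Rightarrow> nat \<Rightarrow> nat \<Rightarrow> (real ^ 'k) \<times> (real ^ 'k) \<Rightarrow>
   nat ^ 'k \<Rightarrow> nat ^ 'k \<Rightarrow> (real ^ 'k) \<times> (real ^ 'k)" where
  "bootstrap_params N \<epsilon> n1 n2 t x y =
     (if test_stat N n1 n2 x y \<ge> \<epsilon> then (mle n1 x, mle n2 y) else t)"

(* Conditional law of the bootstrap statistic given the data x, y. *)
definition bootstrap_law ::
  "(real ^ 'k \<Rightarrow> real) \<Rightarrow> real \<Rightarrow> nat \<Rightarrow> nat \<Rightarrow> (real ^ 'k) \<times> (real ^ 'k) \<Rightarrow>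
   nat ^ 'k \<Rightarrow> nat ^ 'k \<Rightarrow> real pmf" where
  "bootstrap_law N \<epsilon> n1 n2 t x y =
     (case bootstrap_params N \<epsilon> n1 n2 t x y of (p', q') \<Rightarrow>
        map_pmf (\<lambda>(x', y'). test_stat N n1 n2 x' y')
          (pair_pmf (multinomial_pmf n1 p') (multinomial_pmf n2 q')))"

definition bootstrap_quantile ::
  "(real ^ 'k \<Rightarrow> real) \<Rightarrow> real \<Rightarrow> real \<Rightarrow> nat \<Rightarrow> nat \<Rightarrow> (real ^ 'k) \<times> (real ^ 'k) \<Rightarrow>
   nat ^ 'k \<Rightarrow> nat ^ 'k \<Rightarrow> real" where
  "bootstrap_quantile N \<epsilon> \<alpha> n1 n2 t x y =
     quantile (measure_pmf (bootstrap_law N \<epsilon> n1 n2 t x y)) \<alpha>"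

definition has_dir_hadamard_derivative ::
  "('a::real_normed_vector \<Rightarrow> real) \<Rightarrow> ('a \<Rightarrow> real) \<Rightarrow> 'a \<Rightarrow> bool" where
  "has_dir_hadamard_derivative f d \<theta> \<longleftrightarrow>
     continuous_on UNIV d \<and>
     (\<forall>h hs ts. hs \<longlonglongrightarrow> h \<longrightarrow> (\<forall>n. 0 < ts n) \<longrightarrow> decseq ts \<longrightarrow> ts \<longlonglongrightarrow> 0 \<longrightarrow>
        (\<lambda>n. \<bar>(1 / ts n) * (f (\<theta> + ts n *\<^sub>R hs n) - f \<theta>) - d h\<bar>) \<longlonglongrightarrow> (0::real))"

definition hadamard_differentiable :: "('a::real_normed_vector \<Rightarrow> real) \<Rightarrow> 'a \<Rightarrow> bool" where
  "hadamard_differentiable f \<theta> \<longleftrightarrow> (\<exists>d. has_dir_hadamard_derivative f d \<theta> \<and> linear d)"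

definition sublinear :: "('a::real_vector \<Rightarrow> real) \<Rightarrow> bool" where
  "sublinear d \<longleftrightarrow> (\<forall>x y. d (x + y) \<le> d x + d y) \<and> (\<forall>s>0. \<forall>x. d (s *\<^sub>R x) = s * d x)"

definition multinomial_cov :: "real ^ 'k \<Rightarrow> real ^ 'k ^ 'k" where
  "multinomial_cov p = (\<chi> i j. (if i = j then p $ i else 0) - p $ i * p $ j)"

definition limit_cov :: "real \<Rightarrow> real ^ 'k \<Rightarrow> real ^ 'k \<Rightarrow> real ^ 'k ^ 'k" where
  "limit_cov c p q = (1 + c) *\<^sub>R multinomial_cov p + (1 + inverse c) *\<^sub>R multinomial_cov q"

(* Every linear functional of Z is univariate normal, with a point mass at 0 when its
   variance vanishes, so degenerate covariance matrices S are allowed. *)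
definition centered_normal_rv ::
  "'b measure \<Rightarrow> ('b \<Rightarrow> real ^ 'k) \<Rightarrow> real ^ 'k ^ 'k \<Rightarrow> bool" where
  "centered_normal_rv M Z S \<longleftrightarrow>
     prob_space M \<and> Z \<in> borel_measurable M \<and> transpose S = S \<and>
     (\<forall>a. 0 \<le> a \<bullet> (S *v a) \<and>
        distr M borel (\<lambda>\<omega>. a \<bullet> Z \<omega>) =
          (if a \<bullet> (S *v a) = 0 then return borel 0
           else density lborel (normal_density 0 (sqrt (a \<bullet> (S *v a))))))"

lemma multinomial_sum_aux:
  fixes r :: "'k \<Rightarrow> real"
  assumes "finite S"
  shows "finite {x::'k \<Rightarrow> nat. (\<forall>i. i \<notin> S \<longrightarrow> x i = 0) \<and> sum x S = m} \<and>
    (\<Sum>x\<in>{x. (\<forall>i. i \<notin> S \<longrightarrow> x i = 0) \<and> sum x S = m}. \<Prod>i\<in>S. r i ^ x i / fact (x i))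
      = (\<Sum>i\<in>S. r i) ^ m / fact m"
  using assms
proof (induction S arbitrary: m rule: finite_induct)
  case empty
  have "{x::'k \<Rightarrow> nat. (\<forall>i. i \<notin> {} \<longrightarrow> x i = 0) \<and> sum x {} = m} = (if m = 0 then {\<lambda>_. 0} else {})"
    by auto
  then show ?case by simp
next
  case (insert a S)
  define A where "A S m = {x::'k \<Rightarrow> nat. (\<forall>i. i \<notin> S \<longrightarrow> x i = 0) \<and> sum x S = m}" for S m
  have IH: "finite (A S m)" "(\<Sum>x\<in>A S m. \<Prod>i\<in>S. r i ^ x i / fact (x i)) = sum r S ^ m / fact m" for m
    using insert.IH[of m] by (auto simp: A_def)
  define g where "g = (\<lambda>(j::nat, x::'k \<Rightarrow> nat). x(a := j))"
  have sumupd: "sum (x(a := j)) S = sum x S" for x :: "'k \<Rightarrow> nat" and j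
    using insert.hyps by (intro sum.cong) auto
  have sumupd': "(\<Sum>i\<in>S. if i = a then j else x i) = sum x S" for x :: "'k \<Rightarrow> nat" and j
    using insert.hyps by (intro sum.cong) auto
  have bij: "bij_betw g (SIGMA j:{..m}. A S (m - j)) (A (insert a S) m)"
  proof (rule bij_betwI[where g = "\<lambda>x. (x a, x(a := 0))"])
    show "g \<in> (SIGMA j:{..m}. A S (m - j)) \<rightarrow> A (insert a S) m"
      using insert.hyps by (auto simp: g_def A_def sumupd sumupd')
    show "(\<lambda>x. (x a, x(a := 0))) \<in> A (insert a S) m \<rightarrow> (SIGMA j:{..m}. A S (m - j))"
      using insert.hyps by (auto simp: A_def sumupd sumupd')
    show "(\<lambda>x. (x a, x(a := 0))) (g z) = z" if "z \<in> (SIGMA j:{..m}. A S (m - j))" for z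
    proof -
      obtain j x where z: "z = (j, x)" by force
      then have "x a = 0" using that insert.hyps by (auto simp: A_def)
      then show ?thesis by (auto simp: z g_def fun_eq_iff)
    qed
    show "g (x a, x(a := 0)) = x" for x
      by (auto simp: g_def)
  qed
  have fin: "finite (SIGMA j:{..m}. A S (m - j))" using IH(1) by auto
  then have fin': "finite (A (insert a S) m)" using bij bij_betw_finite by blast
  have "(\<Sum>x\<in>A (insert a S) m. \<Prod>i\<in>insert a S. r i ^ x i / fact (x i))
      = (\<Sum>z\<in>(SIGMA j:{..m}. A S (m - j)). \<Prod>i\<in>insert a S. r i ^ g z i / fact (g z i))"
    using bij by (rule sum.reindex_bij_betw[symmetric])
  also have "\<dots> = (\<Sum>(j, x)\<in>(SIGMA j:{..m}. A S (m - j)).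
      r a ^ j / fact j * (\<Prod>i\<in>S. r i ^ x i / fact (x i)))"
  proof (intro sum.cong refl)
    fix z assume "z \<in> (SIGMA j:{..m}. A S (m - j))"
    obtain j x where z: "z = (j, x)" by force
    have "(\<Prod>i\<in>S. r i ^ (x(a := j)) i / fact ((x(a := j)) i)) = (\<Prod>i\<in>S. r i ^ x i / fact (x i))"
      using insert.hyps by (intro prod.cong) auto
    then show "(\<Prod>i\<in>insert a S. r i ^ g z i / fact (g z i)) =
        (case z of (j, x) \<Rightarrow> r a ^ j / fact j * (\<Prod>i\<in>S. r i ^ x i / fact (x i)))"
      using insert.hyps by (simp add: z g_def)
  qed
  also have "\<dots> = (\<Sum>j\<le>m. \<Sum>x\<in>A S (m - j). r a ^ j / fact j * (\<Prod>i\<in>S. r i ^ x i / fact (x i)))"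
    using IH(1) by (intro sum.Sigma[symmetric]) auto
  also have "\<dots> = (\<Sum>j\<le>m. r a ^ j / fact j * (sum r S ^ (m - j) / fact (m - j)))"
    by (simp only: sum_distrib_left[symmetric] IH(2))
  also have "\<dots> = (\<Sum>j\<le>m. (of_nat (m choose j) * r a ^ j * sum r S ^ (m - j)) / fact m)"
    by (intro sum.cong refl) (simp add: binomial_fact)
  also have "\<dots> = (r a + sum r S) ^ m / fact m"
    by (simp only: binomial_ring sum_divide_distrib)
  finally have "(\<Sum>x\<in>A (insert a S) m. \<Prod>i\<in>insert a S. r i ^ x i / fact (x i))
      = (\<Sum>i\<in>insert a S. r i) ^ m / fact m"
    using insert.hyps by simp
  with fin' show ?case unfolding A_def by blast
qed

lemma pmf_multinomial:
  fixes r :: "real ^ 'k"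
  assumes "prob_vec r"
  shows "pmf (multinomial_pmf m r) x =
    (if (\<Sum>i\<in>UNIV. x $ i) = m
     then multinomial_coeff x * (\<Prod>i\<in>UNIV. (r $ i) ^ (x $ i)) else 0)"
proof -
  define f where "f = (\<lambda>x::nat ^ 'k. if (\<Sum>i\<in>UNIV. x $ i) = m
     then multinomial_coeff x * (\<Prod>i\<in>UNIV. (r $ i) ^ (x $ i)) else (0::real))"
  have r0: "0 \<le> r $ i" for i using assms by (simp add: prob_vec_def)
  have nonneg: "0 \<le> f x" for x
    by (auto simp: f_def multinomial_coeff_def intro!: mult_nonneg_nonneg prod_nonneg divide_nonneg_nonneg zero_le_power r0)
  define B where "B = {x::'k \<Rightarrow> nat. sum x UNIV = m}"
  have B: "finite B" "(\<Sum>x\<in>B. \<Prod>i\<in>UNIV. r $ i ^ x i / fact (x i)) = 1 / fact m"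
    using multinomial_sum_aux[of "UNIV :: 'k set" m "\<lambda>i. r $ i"] assms
    by (auto simp: B_def prob_vec_def)
  have bij: "bij_betw vec_lambda B {x::nat ^ 'k. (\<Sum>i\<in>UNIV. x $ i) = m}"
    by (rule bij_betwI[where g = vec_nth]) (auto simp: B_def)
  have fin: "finite {x::nat ^ 'k. (\<Sum>i\<in>UNIV. x $ i) = m}"
    using bij B(1) bij_betw_finite by blast
  have "(\<Sum>x | (\<Sum>i\<in>UNIV. x $ i) = m. f x) = (\<Sum>x\<in>B. f (vec_lambda x))"
    using bij by (rule sum.reindex_bij_betw[symmetric])
  also have "\<dots> = (\<Sum>x\<in>B. fact m * (\<Prod>i\<in>UNIV. r $ i ^ x i / fact (x i)))"
    by (intro sum.cong refl) (simp add: B_def f_def multinomial_coeff_def prod_dividef)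
  also have "\<dots> = 1" by (simp add: sum_distrib_left[symmetric] B(2))
  finally have s: "(\<Sum>x | (\<Sum>i\<in>UNIV. x $ i) = m. f x) = 1" .
  have "(\<integral>\<^sup>+x. ennreal (f x) \<partial>count_space UNIV)
      = (\<Sum>x | (\<Sum>i\<in>UNIV. x $ i) = m. ennreal (f x))"
    by (rule nn_integral_count_space'[OF fin]) (auto simp: f_def)
  also have "\<dots> = 1" using s nonneg by (simp add: sum_ennreal)
  finally have "pmf (embed_pmf f) x = f x"
    using nonneg by (intro pmf_embed_pmf) auto
  then show ?thesis by (simp add: multinomial_pmf_def f_def)
qed

end

theory Submission
  imports Defs
begin

text \<open>Write \<open>\<theta> = p - q\<close>, let \<open>n\<close> be the total sample size, and call parameters near if they differ from \<open>(p, q)\<close> by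
\<open>O(1 / sqrt n)\<close>. The whole proof rests on one statement about multinomial samples with non-random, near
parameters \<open>(p', q')\<close>: the scaled error \<open>W = sqrt n ((mle x - mle y) - (p' - q'))\<close> converges in law to \<open>Z\<close> along every
sequence of near parameters, and so the distribution functions of \<open>d' W\<close> converge uniformly over near
parameters (\<open>clt_uniform\<close>). The bootstrap draws from near parameters with high probability. Hence every
conditional assertion about the bootstrap is a deterministic assertion, uniform over near parameters, that is
evaluated at the estimated parameters.

The uniform central limit theorem is obtained by computing characteristic functions
(\<open>char_multinomial_error\<close>) and passing from them to continuous functions of the vector
(\<open>Levy_continuity_tight\<close>, \<open>real_continuous_distr_tendsto\<close>); uniformity follows by
choosing a sequence of worst parameters (\<open>eventually_all_near\<close>).

The norm enters through convexity. Its directional derivative \<open>d'\<close> is a lower bound of the increments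
without a remainder, and an upper bound up to a remainder that is uniform on bounded sets. With the
subadditivity of \<open>d'\<close> this yields, for near parameters,
\<open>sqrt n (N (mle x - mle y) - N (p' - q')) \<le> d' W + \<delta>\<close> (\<open>stat_upper\<close>), even if \<open>d'\<close> is not linear. Thus the
bootstrap quantile is at most \<open>N (p' - q') + x / sqrt n\<close> for every \<open>x\<close> above the quantile \<open>qT\<close> of \<open>T = d' Z\<close>.
Here it matters that the distribution function of \<open>T\<close> exceeds \<open>\<alpha>\<close> strictly to the right of \<open>qT\<close>, which
holds because the values of a continuous function of a normal vector leave no gap
(\<open>centered_normal_connected_support\<close>).

If the observed distance is at least \<open>\<epsilon>\<close>, the bootstrap uses the unconstrained estimators, and \<open>qT < 0\<close>
makes its quantile smaller than the observed distance: the test does not reject. This settles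
\<open>N \<theta> > \<epsilon>\<close>. If \<open>N \<theta> = \<epsilon>\<close> and the observed distance is below \<open>\<epsilon>\<close>, the constrained estimator is near
(\<open>constrained_mle_close\<close>), so a rejection forces \<open>d' W \<le> x\<close>, an event of asymptotic probability at most the
distribution function of \<open>T\<close> at \<open>x\<close>, which tends to \<open>\<alpha>\<close> as \<open>x\<close> decreases to \<open>qT\<close>. If \<open>d'\<close> is linear, the
estimate of the quantile holds in the other direction as well, and the probability tends to \<open>\<alpha>\<close>. If
\<open>N \<theta> < \<epsilon>\<close>, Chebyshev's inequality alone suffices: the bootstrap distance concentrates at \<open>\<epsilon>\<close> for whatever
constrained estimator, and the observed distance concentrates at \<open>N \<theta>\<close>.\<close>

section \<open>Trigonometric polynomials and the continuity theorem\<close>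

text \<open>Convergence of characteristic functions is convergence of the expectations of these functions. They
form an algebra, so they contain every polynomial in sines of linear forms.\<close>

inductive trig_poly :: "('v::real_inner \<Rightarrow> complex) \<Rightarrow> bool" where
  monomial: "trig_poly (\<lambda>x. k * cis (a \<bullet> x))"
| add: "trig_poly f \<Longrightarrow> trig_poly g \<Longrightarrow> trig_poly (\<lambda>x. f x + g x)"

lemma trig_poly_const: "trig_poly (\<lambda>x. k)"
  using trig_poly.monomial[of k 0] by simp

lemma trig_poly_sum: "finite A \<Longrightarrow> (\<And>i. i \<in> A \<Longrightarrow> trig_poly (f i)) \<Longrightarrow> trig_poly (\<lambda>x. \<Sum>i\<in>A. f i x)"
proof (induction A rule: finite_induct)
  case empty
  then show ?case using trig_poly_const[of 0] by simp
next
  case (insert i A)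
  then show ?case using trig_poly.add[of "f i" "\<lambda>x. \<Sum>i\<in>A. f i x"] by simp
qed

lemma trig_poly_mult:
  assumes "trig_poly f" "trig_poly g"
  shows "trig_poly (\<lambda>x. f x * g x)"
  using assms(1)
proof induction
  case (monomial k a)
  show ?case using assms(2)
  proof induction
    case (monomial l b)
    have "(\<lambda>x. k * cis (a \<bullet> x) * (l * cis (b \<bullet> x))) = (\<lambda>x. (k * l) * cis ((a + b) \<bullet> x))"
      by (auto simp: fun_eq_iff inner_add_left cis_mult[symmetric])
    then show ?case using trig_poly.monomial by metis
  next
    case (add f g)
    then show ?case using trig_poly.add[OF add.IH] by (simp add: distrib_left)
  qed
next
  case (add f1 f2)
  then show ?case using trig_poly.add[OF add.IH] by (simp add: distrib_right)
qed

lemma trig_poly_sin: "trig_poly (\<lambda>x. complex_of_real (sin (a \<bullet> x)))"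
proof -
  have "complex_of_real (sin y) = (- \<i> / 2) * cis y + (\<i> / 2) * cis (- y)" for y
    by (simp add: complex_eq_iff)
  then have "(\<lambda>x. complex_of_real (sin (a \<bullet> x)))
      = (\<lambda>x. (- \<i> / 2) * cis (a \<bullet> x) + (\<i> / 2) * cis ((- a) \<bullet> x))"
    by (simp only: inner_minus_left)
  moreover have "trig_poly (\<lambda>x. (- \<i> / 2) * cis (a \<bullet> x) + (\<i> / 2) * cis ((- a) \<bullet> x))"
    by (rule trig_poly.add[OF trig_poly.monomial trig_poly.monomial])
  ultimately show ?thesis by simp
qed

lemma trig_poly_continuous: "trig_poly f \<Longrightarrow> continuous_on UNIV f"
  by (induction rule: trig_poly.induct) (auto intro!: continuous_intros simp: cis_conv_exp)

lemma trig_poly_bounded: "trig_poly f \<Longrightarrow> \<exists>B. \<forall>x. norm (f x) \<le> B"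
proof (induction rule: trig_poly.induct)
  case (monomial k a)
  then show ?case by (auto simp: norm_mult)
next
  case (add f g)
  then obtain B C where "\<forall>x. norm (f x) \<le> B" "\<forall>x. norm (g x) \<le> C" by auto
  then show ?case by (intro exI[of _ "B + C"]) (meson add_mono norm_triangle_ineq order_trans)
qed

text \<open>Replacing each coordinate \<open>t\<close> by \<open>L sin (t / L)\<close> maps the whole space into one compact set, on which
polynomials approximate uniformly, and a polynomial of the folded point is a trigonometric polynomial. Thus
folded functions are approximated by trigonometric polynomials uniformly on the whole space.\<close>

definition sin_fold :: "real \<Rightarrow> 'v::euclidean_space \<Rightarrow> 'v" where
  "sin_fold L x = (\<Sum>b\<in>Basis. (L * sin (x \<bullet> b / L)) *\<^sub>R b)"

lemma continuous_sin_fold: "L > 0 \<Longrightarrow> continuous_on UNIV (sin_fold L)"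
  unfolding sin_fold_def by (intro continuous_intros) auto

lemma norm_sin_fold_le: "L > 0 \<Longrightarrow> norm (sin_fold L x :: 'v) \<le> L * DIM('v::euclidean_space)"
proof -
  assume L: "L > 0"
  have "norm (sin_fold L x) \<le> (\<Sum>b\<in>(Basis::'v set). norm ((L * sin (x \<bullet> b / L)) *\<^sub>R b))"
    unfolding sin_fold_def by (rule norm_sum)
  also have "\<dots> \<le> (\<Sum>b\<in>(Basis::'v set). L)"
    using L by (intro sum_mono) (auto simp: abs_mult mult_left_le)
  finally show ?thesis by (simp add: mult.commute)
qed

lemma abs_sin_diff_le: "\<bar>sin u - u\<bar> \<le> u\<^sup>2 / (2::real)"
proof -
  have "\<bar>sin u - (\<Sum>m<2. sin_coeff m * u ^ m)\<bar> \<le> inverse (fact 2) * \<bar>u\<bar> ^ 2"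
    by (rule Maclaurin_sin_bound)
  then show ?thesis by (simp add: sin_coeff_def lessThan_nat_numeral numeral_2_eq_2 divide_simps mult.commute)
qed

text \<open>Folding changes a bounded set by an amount that vanishes as \<open>L\<close> grows, since \<open>sin u - u\<close> is of
second order in \<open>u\<close>.\<close>

lemma norm_sin_fold_diff_le:
  fixes x :: "'v::euclidean_space"
  assumes L: "L > 0"
  shows "norm (sin_fold L x - x) \<le> (norm x)\<^sup>2 / (2 * L)"
proof -
  have "sin_fold L x - x = (\<Sum>b\<in>Basis. (L * sin (x \<bullet> b / L) - x \<bullet> b) *\<^sub>R b)"
    by (simp add: sin_fold_def scaleR_diff_left sum_subtractf euclidean_representation)
  then have "norm (sin_fold L x - x) \<le> (\<Sum>b\<in>Basis. norm ((L * sin (x \<bullet> b / L) - x \<bullet> b) *\<^sub>R b))"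
    by (simp only: norm_sum)
  also have "\<dots> \<le> (\<Sum>b\<in>Basis. (x \<bullet> b)\<^sup>2 / (2 * L))"
  proof (intro sum_mono)
    fix b :: 'v assume b: "b \<in> Basis"
    have "L * sin (x \<bullet> b / L) - x \<bullet> b = L * (sin (x \<bullet> b / L) - x \<bullet> b / L)"
      using L by (simp add: right_diff_distrib)
    then have "\<bar>L * sin (x \<bullet> b / L) - x \<bullet> b\<bar> = L * \<bar>sin (x \<bullet> b / L) - x \<bullet> b / L\<bar>"
      using L by (simp add: abs_mult)
    also have "\<dots> \<le> L * ((x \<bullet> b / L)\<^sup>2 / 2)"
      using L by (intro mult_left_mono abs_sin_diff_le) auto
    also have "\<dots> = (x \<bullet> b)\<^sup>2 / (2 * L)" using L by (simp add: power2_eq_square)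
    finally show "norm ((L * sin (x \<bullet> b / L) - x \<bullet> b) *\<^sub>R b) \<le> (x \<bullet> b)\<^sup>2 / (2 * L)" using b by simp
  qed
  also have "\<dots> = (norm x)\<^sup>2 / (2 * L)"
    unfolding power2_norm_eq_inner[of x] euclidean_inner[of x x] by (simp add: sum_divide_distrib power2_eq_square)
  finally show ?thesis .
qed

lemma trig_poly_polynomial_sin_fold:
  fixes g :: "'v::euclidean_space \<Rightarrow> real"
  assumes "real_polynomial_function g"
  shows "trig_poly (\<lambda>x. complex_of_real (g (sin_fold L x)))"
  using assms
proof induction
  case (linear g)
  interpret bounded_linear g by fact
  have "(\<lambda>x. complex_of_real (g (sin_fold L x)))
      = (\<lambda>x. \<Sum>b\<in>Basis. complex_of_real (L * g b) * complex_of_real (sin ((b /\<^sub>R L) \<bullet> x)))"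
    by (rule ext) (simp add: sin_fold_def sum scaleR inner_commute divide_inverse mult_ac)
  moreover have "trig_poly (\<lambda>x::'v. \<Sum>b\<in>Basis. complex_of_real (L * g b) * complex_of_real (sin ((b /\<^sub>R L) \<bullet> x)))"
    by (intro trig_poly_sum trig_poly_mult trig_poly_const trig_poly_sin finite_Basis)
  ultimately show ?case by simp
next
  case (const c)
  then show ?case by (rule trig_poly_const)
next
  case (add f g)
  then show ?case by (simp add: trig_poly.add)
next
  case (mult f g)
  then show ?case by (simp add: trig_poly_mult)
qed

lemma expectation_trig_poly_tendsto:
  fixes W :: "nat \<Rightarrow> 'a \<Rightarrow> 'v::euclidean_space" and Z :: "'b \<Rightarrow> 'v"
  assumes M: "\<And>j. prob_space (M j)" "prob_space MZ"
    and meas: "\<And>j. W j \<in> borel_measurable (M j)" "Z \<in> borel_measurable MZ"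
    and char: "\<And>a. (\<lambda>j. LINT \<omega>|M j. cis (a \<bullet> W j \<omega>)) \<longlonglongrightarrow> (LINT \<omega>|MZ. cis (a \<bullet> Z \<omega>))"
    and f: "trig_poly f"
  shows "(\<lambda>j. LINT \<omega>|M j. f (W j \<omega>)) \<longlonglongrightarrow> (LINT \<omega>|MZ. f (Z \<omega>))"
  using f
proof induction
  case (monomial k a)
  show ?case
    unfolding integral_mult_right_zero by (rule tendsto_mult_left[OF char])
next
  case (add f g)
  have int: "integrable P (\<lambda>\<omega>. h (V \<omega>))"
    if P: "prob_space P" and V: "V \<in> borel_measurable P" and h: "trig_poly h"
    for h and P :: "'c measure" and V :: "'c \<Rightarrow> 'v"
  proof -
    interpret prob_space P by fact
    obtain B where B: "\<forall>x. norm (h x) \<le> B" using trig_poly_bounded[OF h] by blast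
    have "h \<in> borel_measurable borel"
      by (rule borel_measurable_continuous_onI[OF trig_poly_continuous[OF h]])
    then have "(\<lambda>\<omega>. h (V \<omega>)) \<in> borel_measurable P" using V by (rule measurable_compose[rotated])
    then show ?thesis using B by (intro integrable_const_bound[of _ B]) auto
  qed
  have "(LINT \<omega>|M j. f (W j \<omega>) + g (W j \<omega>)) = (LINT \<omega>|M j. f (W j \<omega>)) + (LINT \<omega>|M j. g (W j \<omega>))" for j
    by (intro Bochner_Integration.integral_add int[OF M(1) meas(1)] add.hyps)
  moreover have "(LINT \<omega>|MZ. f (Z \<omega>) + g (Z \<omega>)) = (LINT \<omega>|MZ. f (Z \<omega>)) + (LINT \<omega>|MZ. g (Z \<omega>))"
    by (intro Bochner_Integration.integral_add int[OF M(2) meas(2)] add.hyps)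
  ultimately show ?case using tendsto_add[OF add.IH] by simp
qed

text \<open>For large \<open>L\<close>, folding the argument of \<open>f\<close> changes its expectation little: under the law of \<open>Z\<close> by dominated
convergence, under the laws of \<open>W j\<close> by tightness and the uniform continuity of \<open>f\<close> on bounded sets. The folded
function is uniformly close to a trigonometric polynomial by the Stone-Weierstrass theorem, and
expectations of trigonometric polynomials converge by assumption.\<close>

theorem Levy_continuity_tight:
  fixes W :: "nat \<Rightarrow> 'a \<Rightarrow> 'v::euclidean_space" and Z :: "'b \<Rightarrow> 'v" and f :: "'v \<Rightarrow> real"
  assumes M: "\<And>j. prob_space (M j)" "prob_space MZ"
    and meas: "\<And>j. W j \<in> borel_measurable (M j)" "Z \<in> borel_measurable MZ"
    and char: "\<And>a. (\<lambda>j. LINT \<omega>|M j. cis (a \<bullet> W j \<omega>)) \<longlonglongrightarrow> (LINT \<omega>|MZ. cis (a \<bullet> Z \<omega>))"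
    and tight: "\<And>e. 0 < e \<Longrightarrow> \<exists>K. \<forall>\<^sub>F j in sequentially. measure (M j) {\<omega> \<in> space (M j). K < norm (W j \<omega>)} \<le> e"
    and bdd: "\<And>x. \<bar>f x\<bar> \<le> A"
    and fcont: "continuous_on UNIV f"
  shows "(\<lambda>j. LINT \<omega>|M j. f (W j \<omega>)) \<longlonglongrightarrow> (LINT \<omega>|MZ. f (Z \<omega>))"
proof (rule LIMSEQ_I)
  fix e :: real assume e: "0 < e"
  have fm[measurable]: "f \<in> borel_measurable borel" using fcont by (rule borel_measurable_continuous_onI)
  have foldm[measurable]: "sin_fold L \<in> borel_measurable borel" if "L > 0" for L
    using continuous_sin_fold[OF that] by (rule borel_measurable_continuous_onI)
  interpret MZ: prob_space MZ by fact
  have tend: "(\<lambda>i. LINT \<omega>|MZ. f (sin_fold (Suc i) (Z \<omega>))) \<longlonglongrightarrow> (LINT \<omega>|MZ. f (Z \<omega>))"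
  proof (rule integral_dominated_convergence[where w = "\<lambda>_. A"])
    show "(\<lambda>\<omega>. f (Z \<omega>)) \<in> borel_measurable MZ" using meas(2) by measurable
    show "(\<lambda>\<omega>. f (sin_fold (Suc i) (Z \<omega>))) \<in> borel_measurable MZ" for i
      using meas(2) foldm[of "Suc i"] by measurable
    have "(\<lambda>i. sin_fold (Suc i) x) \<longlonglongrightarrow> x" for x :: 'v
    proof -
      have "(\<lambda>i. norm (sin_fold (Suc i) x - x)) \<longlonglongrightarrow> 0"
      proof (rule tendsto_sandwich[of "\<lambda>_. 0" _ _ "\<lambda>i. (norm x)\<^sup>2 / (2 * real (Suc i))"])
        show "\<forall>\<^sub>F n in sequentially. norm (sin_fold (real (Suc n)) x - x) \<le> (norm x)\<^sup>2 / (2 * real (Suc n))"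
          by (intro always_eventually allI norm_sin_fold_diff_le) simp
        have "(\<lambda>i. (norm x)\<^sup>2 / 2 * inverse (real (Suc i))) \<longlonglongrightarrow> (norm x)\<^sup>2 / 2 * 0"
          by (intro tendsto_mult tendsto_const LIMSEQ_inverse_real_of_nat)
        then show "(\<lambda>i. (norm x)\<^sup>2 / (2 * real (Suc i))) \<longlonglongrightarrow> 0"
          by (simp only: divide_inverse inverse_mult_distrib mult.assoc mult_zero_right)
      qed auto
      then show ?thesis by (simp add: LIM_zero_iff tendsto_norm_zero_iff)
    qed
    then show "AE \<omega> in MZ. (\<lambda>i. f (sin_fold (Suc i) (Z \<omega>))) \<longlonglongrightarrow> f (Z \<omega>)"
      using fcont by (auto simp: continuous_on_eq_continuous_at intro!: isCont_tendsto_compose[of _ f])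
  qed (use bdd in auto)
  obtain i0 where i0: "\<And>i. i \<ge> i0 \<Longrightarrow>
      \<bar>(LINT \<omega>|MZ. f (sin_fold (Suc i) (Z \<omega>))) - (LINT \<omega>|MZ. f (Z \<omega>))\<bar> < e / 5"
    using LIMSEQ_D[OF tend, of "e/5"] e by auto
  have A: "0 \<le> A" using bdd[of 0] by linarith
  obtain K0 where K0: "\<forall>\<^sub>F j in sequentially. measure (M j) {\<omega> \<in> space (M j). K0 < norm (W j \<omega>)} \<le> e / (20 * (A + 1))"
    using tight[of "e / (20 * (A + 1))"] e A by auto
  define K where "K = max K0 1"
  have "uniformly_continuous_on (cball 0 (K + 1)) f"
    by (intro compact_uniformly_continuous continuous_on_subset[OF fcont]) auto
  moreover have "0 < e / 10" using e by simp
  ultimately obtain d where d: "0 < d"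
    and fd: "\<And>x y. x \<in> cball 0 (K + 1) \<Longrightarrow> y \<in> cball 0 (K + 1) \<Longrightarrow> dist y x < d \<Longrightarrow> dist (f y) (f x) < e / 10"
    unfolding uniformly_continuous_on_def by metis
  \<comment> \<open>\<open>L\<close> makes the folding error on the ball of radius \<open>K\<close> smaller than the modulus of continuity \<open>d\<close>, and at most one, so that folded points stay in the ball of radius \<open>K + 1\<close>.\<close>
  obtain i1 :: nat where i1: "K\<^sup>2 / (2 * min d 1) < i1" using reals_Archimedean2 by blast
  define L where "L = real (Suc (max i0 i1))"
  have L: "L > 0" by (simp add: L_def)
  note foldm[OF L, measurable]
  have KL: "K\<^sup>2 / (2 * L) < min d 1"
  proof -
    have "K\<^sup>2 / (2 * min d 1) < L" using i1 by (simp add: L_def)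
    then show ?thesis using d L by (simp add: field_simps del: min_less_iff_conj)
  qed
  have close: "\<bar>f x - f (sin_fold L x)\<bar> \<le> e / 10" if "norm x \<le> K" for x
  proof -
    have "norm (sin_fold L x - x) \<le> (norm x)\<^sup>2 / (2 * L)" by (rule norm_sin_fold_diff_le[OF L])
    also have "\<dots> \<le> K\<^sup>2 / (2 * L)" using that L by (intro divide_right_mono power_mono) auto
    finally have 1: "norm (sin_fold L x - x) < d" "norm (sin_fold L x - x) < 1" using KL by auto
    have "norm (sin_fold L x) \<le> K + 1"
      using norm_triangle_sub[of "sin_fold L x" x] 1(2) that by linarith
    then show ?thesis using fd[of "sin_fold L x" x] 1(1) that
      by (simp add: dist_norm norm_minus_commute less_imp_le)
  qed
  have "compact (cball 0 (L * DIM('v)) :: 'v set)" by simp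
  then obtain g where g: "real_polynomial_function g"
    and gf: "\<And>x. x \<in> cball 0 (L * DIM('v)) \<Longrightarrow> \<bar>f x - g x\<bar> < e / 5"
    using Stone_Weierstrass_real_polynomial_function[OF _ continuous_on_subset[OF fcont subset_UNIV], of "cball 0 (L * DIM('v))" "e/5"] e
    by auto
  define h where "h = (\<lambda>x. g (sin_fold L x))"
  have hf: "\<bar>f (sin_fold L x) - h x\<bar> < e / 5" for x
    unfolding h_def using norm_sin_fold_le[OF L, of x] by (intro gf) auto
  have tp: "trig_poly (\<lambda>x. complex_of_real (h x))"
    unfolding h_def by (rule trig_poly_polynomial_sin_fold[OF g])
  have hm[measurable]: "h \<in> borel_measurable borel"
  proof (rule borel_measurable_continuous_onI)
    show "continuous_on UNIV h"
      using continuous_on_Re[OF trig_poly_continuous[OF tp]] by (simp only: Re_complex_of_real)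
  qed
  have hb: "\<bar>h x\<bar> \<le> A + e" for x using hf[of x] bdd[of "sin_fold L x"] e by linarith
  have diff: "\<bar>(LINT \<omega>|P. f (sin_fold L (V \<omega>))) - (LINT \<omega>|P. h (V \<omega>))\<bar> \<le> e / 5"
    and inth: "integrable P (\<lambda>\<omega>. h (V \<omega>))" and intf: "integrable P (\<lambda>\<omega>. f (V \<omega>))"
    and intff: "integrable P (\<lambda>\<omega>. f (sin_fold L (V \<omega>)))"
    if P: "prob_space P" and [measurable]: "V \<in> borel_measurable P" for P :: "'c measure" and V
  proof -
    interpret P: prob_space P by fact
    show 1: "integrable P (\<lambda>\<omega>. h (V \<omega>))"
      by (rule P.integrable_const_bound[of _ "A + e"]) (use hb in auto)
    show 2: "integrable P (\<lambda>\<omega>. f (sin_fold L (V \<omega>)))"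
      by (rule P.integrable_const_bound[of _ A]) (use bdd in auto)
    show "integrable P (\<lambda>\<omega>. f (V \<omega>))"
      by (rule P.integrable_const_bound[of _ A]) (use bdd in auto)
    have "\<bar>(LINT \<omega>|P. f (sin_fold L (V \<omega>))) - (LINT \<omega>|P. h (V \<omega>))\<bar>
        = \<bar>LINT \<omega>|P. f (sin_fold L (V \<omega>)) - h (V \<omega>)\<bar>" using 1 2 by simp
    also have "\<dots> \<le> (LINT \<omega>|P. \<bar>f (sin_fold L (V \<omega>)) - h (V \<omega>)\<bar>)" by (rule integral_abs_bound)
    also have "\<dots> \<le> (LINT \<omega>|P. e / 5)"
      using 1 2 hf by (intro integral_mono) (auto intro: less_imp_le)
    finally show "\<bar>(LINT \<omega>|P. f (sin_fold L (V \<omega>))) - (LINT \<omega>|P. h (V \<omega>))\<bar> \<le> e / 5"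
      by (simp add: P.prob_space)
  qed
  have "(\<lambda>j. LINT \<omega>|M j. complex_of_real (h (W j \<omega>))) \<longlonglongrightarrow> (LINT \<omega>|MZ. complex_of_real (h (Z \<omega>)))"
    by (rule expectation_trig_poly_tendsto[OF M meas char tp])
  then have hlim: "(\<lambda>j. LINT \<omega>|M j. h (W j \<omega>)) \<longlonglongrightarrow> (LINT \<omega>|MZ. h (Z \<omega>))"
    by (simp add: tendsto_of_real_iff)
  have "0 < e / 5" using e by simp
  then obtain J where J: "\<And>j. j \<ge> J \<Longrightarrow> \<bar>(LINT \<omega>|M j. h (W j \<omega>)) - (LINT \<omega>|MZ. h (Z \<omega>))\<bar> < e / 5"
    using LIMSEQ_D[OF hlim] unfolding real_norm_def by blast
  obtain J1 where J1: "\<And>j. j \<ge> J1 \<Longrightarrow> measure (M j) {\<omega> \<in> space (M j). K0 < norm (W j \<omega>)} \<le> e / (20 * (A + 1))"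
    using K0 unfolding eventually_sequentially by blast
  show "\<exists>J. \<forall>j\<ge>J. norm ((LINT \<omega>|M j. f (W j \<omega>)) - (LINT \<omega>|MZ. f (Z \<omega>))) < e"
  proof (intro exI allI impI)
    fix j assume "max J J1 \<le> j"
    then have j: "J \<le> j" "J1 \<le> j" by auto
    interpret Mj: prob_space "M j" by (rule M)
    have tail: "{\<omega> \<in> space (M j). K0 < norm (W j \<omega>)} \<in> sets (M j)" using meas(1)[of j] by measurable
    have "\<bar>(LINT \<omega>|M j. f (W j \<omega>)) - (LINT \<omega>|M j. f (sin_fold L (W j \<omega>)))\<bar>
        = \<bar>LINT \<omega>|M j. f (W j \<omega>) - f (sin_fold L (W j \<omega>))\<bar>"
      using intf[OF M(1) meas(1)] intff[OF M(1) meas(1)] by simp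
    also have "\<dots> \<le> (LINT \<omega>|M j. \<bar>f (W j \<omega>) - f (sin_fold L (W j \<omega>))\<bar>)" by (rule integral_abs_bound)
    also have "\<dots> \<le> (LINT \<omega>|M j. e / 10 + 2 * A * indicator {\<omega> \<in> space (M j). K0 < norm (W j \<omega>)} \<omega>)"
    proof (rule integral_mono)
      show "integrable (M j) (\<lambda>\<omega>. \<bar>f (W j \<omega>) - f (sin_fold L (W j \<omega>))\<bar>)"
        using intf[OF M(1) meas(1)] intff[OF M(1) meas(1)] by auto
      show "integrable (M j) (\<lambda>\<omega>. e / 10 + 2 * A * indicator {\<omega> \<in> space (M j). K0 < norm (W j \<omega>)} \<omega>)"
        using tail by (intro Bochner_Integration.integrable_add integrable_mult_right) (auto simp: less_top[symmetric])
      show "\<bar>f (W j \<omega>) - f (sin_fold L (W j \<omega>))\<bar> \<le> e / 10 + 2 * A * indicator {\<omega> \<in> space (M j). K0 < norm (W j \<omega>)} \<omega>"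
        if "\<omega> \<in> space (M j)" for \<omega>
      proof (cases "K0 < norm (W j \<omega>)")
        case True
        then show ?thesis
          using bdd[of "W j \<omega>"] bdd[of "sin_fold L (W j \<omega>)"] e that by simp
      next
        case False
        then show ?thesis using close[of "W j \<omega>"] by (simp add: K_def)
      qed
    qed
    also have "\<dots> = e / 10 + 2 * A * measure (M j) {\<omega> \<in> space (M j). K0 < norm (W j \<omega>)}"
      using tail by (subst Bochner_Integration.integral_add) (auto simp: Mj.prob_space less_top[symmetric])
    also have "\<dots> \<le> e / 10 + 2 * A * (e / (20 * (A + 1)))"
      using J1[OF j(2)] A by (intro add_left_mono mult_left_mono) auto
    also have "\<dots> < e / 5" using A e by (simp add: field_simps)
    finally have 1: "\<bar>(LINT \<omega>|M j. f (W j \<omega>)) - (LINT \<omega>|M j. f (sin_fold L (W j \<omega>)))\<bar> < e / 5" .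
    have 2: "\<bar>(LINT \<omega>|MZ. f (sin_fold L (Z \<omega>))) - (LINT \<omega>|MZ. f (Z \<omega>))\<bar> < e / 5"
      unfolding L_def by (rule i0) simp
    show "norm ((LINT \<omega>|M j. f (W j \<omega>)) - (LINT \<omega>|MZ. f (Z \<omega>))) < e"
      using 1 2 J[OF j(1)] diff[OF M(1)[of j] meas(1)[of j]] diff[OF M(2) meas(2)] unfolding real_norm_def by linarith
  qed
qed

section \<open>Moments of the multinomial distribution\<close>

definition class_pmf :: "real ^ 'k \<Rightarrow> 'k pmf" where
  "class_pmf r = embed_pmf (\<lambda>i. r $ i)"

lemma pmf_class_pmf: "prob_vec r \<Longrightarrow> pmf (class_pmf r) i = r $ i"
  unfolding class_pmf_def
  by (rule pmf_embed_pmf)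
     (auto simp: prob_vec_def nn_integral_count_space_finite sum_ennreal)

lemma finite_vec_sum_eq: "finite {x::nat ^ 'k. (\<Sum>i\<in>UNIV. x $ i) = m}"
proof -
  have "finite {x::'k \<Rightarrow> nat. sum x UNIV = m}"
    using multinomial_sum_aux[of "UNIV :: 'k set" m "\<lambda>_. 0"] by auto
  then have "finite (vec_lambda ` {x::'k \<Rightarrow> nat. sum x UNIV = m})" by simp
  moreover have "{x::nat ^ 'k. (\<Sum>i\<in>UNIV. x $ i) = m} \<subseteq> vec_lambda ` {x. sum x UNIV = m}"
    by (auto simp: image_iff intro!: exI[of _ "vec_nth _"])
  ultimately show ?thesis by (rule finite_subset[rotated])
qed

lemma sum_eq_of_set_pmf_multinomial:
  "prob_vec r \<Longrightarrow> x \<in> set_pmf (multinomial_pmf m r) \<Longrightarrow> (\<Sum>i\<in>UNIV. x $ i) = m"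
  by (auto simp: set_pmf_iff pmf_multinomial split: if_splits)

lemma finite_set_pmf_multinomial: "prob_vec r \<Longrightarrow> finite (set_pmf (multinomial_pmf m r))"
  by (rule finite_subset[OF _ finite_vec_sum_eq[of m]]) (auto intro: sum_eq_of_set_pmf_multinomial)

lemma multinomial_pmf_0:
  fixes r :: "real ^ 'k"
  assumes "prob_vec r"
  shows "multinomial_pmf 0 r = return_pmf 0"
proof (rule pmf_eqI)
  fix x :: "nat ^ 'k"
  show "pmf (multinomial_pmf 0 r) x = pmf (return_pmf 0) x"
    using assms by (auto simp: pmf_multinomial multinomial_coeff_def vec_eq_iff)
qed

lemma multinomial_coeff_minus_axis:
  fixes x :: "nat ^ 'k"
  assumes "(\<Sum>i\<in>UNIV. x $ i) = Suc m" "0 < x $ i"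
  shows "(\<Sum>j\<in>UNIV. (x - axis i 1) $ j) = m"
    and "multinomial_coeff (x - axis i 1) = multinomial_coeff x * (x $ i / Suc m)"
    and "r $ i * (\<Prod>j\<in>UNIV. (r $ j) ^ ((x - axis i 1) $ j)) = (\<Prod>j\<in>UNIV. (r $ j) ^ (x $ j) :: real)"
proof -
  have s: "(\<Sum>j\<in>UNIV. x $ j) = x $ i + (\<Sum>j\<in>UNIV-{i}. x $ j)" by (simp add: sum.remove)
  have "(\<Sum>j\<in>UNIV. (x - axis i 1) $ j) = (x $ i - 1) + (\<Sum>j\<in>UNIV-{i}. (x - axis i 1) $ j)"
    by (subst sum.remove[of _ i]) (auto simp: axis_def)
  also have "(\<Sum>j\<in>UNIV-{i}. (x - axis i 1) $ j) = (\<Sum>j\<in>UNIV-{i}. x $ j)"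
    by (intro sum.cong) (auto simp: axis_def)
  finally show 1: "(\<Sum>j\<in>UNIV. (x - axis i 1) $ j) = m" using s assms by simp
  have "(\<Prod>j\<in>UNIV. fact ((x - axis i 1) $ j)) = fact (x $ i - 1) * (\<Prod>j\<in>UNIV-{i}. fact ((x - axis i 1) $ j) :: real)"
    by (subst prod.remove[of _ i]) (auto simp: axis_def)
  also have "(\<Prod>j\<in>UNIV-{i}. fact ((x - axis i 1) $ j)) = (\<Prod>j\<in>UNIV-{i}. fact (x $ j) :: real)"
    by (intro prod.cong) (auto simp: axis_def)
  finally have "(\<Prod>j\<in>UNIV. fact ((x - axis i 1) $ j) :: real) * x $ i
      = (fact (x $ i - 1) * real (x $ i)) * (\<Prod>j\<in>UNIV-{i}. fact (x $ j))"
    by simp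
  also have "fact (x $ i - 1) * real (x $ i) = fact (x $ i)"
    using assms(2) by (subst fact_reduce[of "x $ i"]) auto
  also have "fact (x $ i) * (\<Prod>j\<in>UNIV-{i}. fact (x $ j)) = (\<Prod>j\<in>UNIV. fact (x $ j) :: real)"
    by (simp add: prod.remove[of _ i])
  finally have 2: "(\<Prod>j\<in>UNIV. fact (x $ j) :: real) = (\<Prod>j\<in>UNIV. fact ((x - axis i 1) $ j)) * real (x $ i)" ..
  show "multinomial_coeff (x - axis i 1) = multinomial_coeff x * (x $ i / Suc m)"
  proof -
    define P where "P = (\<Prod>j\<in>UNIV. fact ((x - axis i 1) $ j) :: real)"
    have "P \<noteq> 0" by (simp add: P_def)
    then show ?thesis
      unfolding multinomial_coeff_def 1 2 assms(1) P_def[symmetric] fact_Suc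
      using assms(2) by (simp add: divide_simps del: of_nat_Suc)
  qed
  have "r $ i * (\<Prod>j\<in>UNIV. (r $ j) ^ ((x - axis i 1) $ j))
      = r $ i * r $ i ^ (x $ i - 1) * (\<Prod>j\<in>UNIV-{i}. (r $ j) ^ ((x - axis i 1) $ j))"
    by (subst prod.remove[of _ i]) (auto simp: axis_def)
  also have "(\<Prod>j\<in>UNIV-{i}. (r $ j) ^ ((x - axis i 1) $ j)) = (\<Prod>j\<in>UNIV-{i}. (r $ j) ^ (x $ j))"
    by (intro prod.cong) (auto simp: axis_def)
  also have "r $ i * r $ i ^ (x $ i - 1) = r $ i ^ x $ i"
    using assms(2) by (cases "x $ i") auto
  finally show "r $ i * (\<Prod>j\<in>UNIV. (r $ j) ^ ((x - axis i 1) $ j)) = (\<Prod>j\<in>UNIV. (r $ j) ^ (x $ j))"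
    by (simp add: prod.remove[of _ i])
qed

text \<open>The sample of size \<open>Suc m\<close> arises from one of size \<open>m\<close> by one more trial, because the count vectors with one
observation of class \<open>i\<close> removed carry the fractions \<open>x $ i / Suc m\<close> of the multinomial coefficient of \<open>x\<close>, and
these fractions add up to one. Moments and characteristic functions follow by induction over the trials.\<close>

lemma multinomial_pmf_Suc:
  fixes r :: "real ^ 'k"
  assumes r: "prob_vec r"
  shows "multinomial_pmf (Suc m) r =
    bind_pmf (class_pmf r) (\<lambda>i. map_pmf (\<lambda>x. x + axis i 1) (multinomial_pmf m r))"
proof (rule pmf_eqI)
  fix x :: "nat ^ 'k"
  have inj: "inj (\<lambda>x. x + axis i 1 :: nat ^ 'k)" for i by (auto simp: inj_def vec_eq_iff)
  have shift: "pmf (map_pmf (\<lambda>x. x + axis i 1) (multinomial_pmf m r)) x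
      = (if 0 < x $ i then pmf (multinomial_pmf m r) (x - axis i 1) else 0)" for i
  proof (cases "0 < x $ i")
    case True
    then have eq: "x - axis i 1 + axis i 1 = x" by (auto simp: vec_eq_iff axis_def)
    show ?thesis
      using pmf_map_inj'[OF inj, of i "multinomial_pmf m r" "x - axis i 1"] True eq by simp
  next
    case False
    then show ?thesis by (subst pmf_map_outside) (auto simp: vec_eq_iff axis_def)
  qed
  have "pmf (bind_pmf (class_pmf r) (\<lambda>i. map_pmf (\<lambda>x. x + axis i 1) (multinomial_pmf m r))) x
      = (\<Sum>i\<in>UNIV. r $ i * (if 0 < x $ i then pmf (multinomial_pmf m r) (x - axis i 1) else 0))"
    unfolding pmf_bind
    by (subst integral_measure_pmf[of UNIV]) (auto simp: pmf_class_pmf[OF r] shift simp del: One_nat_def)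
  also have "\<dots> = pmf (multinomial_pmf (Suc m) r) x"
  proof (cases "(\<Sum>i\<in>UNIV. x $ i) = Suc m")
    case True
    have "(\<Sum>i\<in>UNIV. r $ i * (if 0 < x $ i then pmf (multinomial_pmf m r) (x - axis i 1) else 0))
        = (\<Sum>i\<in>UNIV. multinomial_coeff x * (\<Prod>j\<in>UNIV. (r $ j) ^ (x $ j)) * (x $ i / Suc m))"
    proof (rule sum.cong)
      fix i
      show "r $ i * (if 0 < x $ i then pmf (multinomial_pmf m r) (x - axis i 1) else 0) =
         multinomial_coeff x * (\<Prod>j\<in>UNIV. (r $ j) ^ (x $ j)) * (x $ i / Suc m)"
      proof (cases "0 < x $ i")
        case pos: True
        have "r $ i * pmf (multinomial_pmf m r) (x - axis i 1)
            = multinomial_coeff (x - axis i 1) * (r $ i * (\<Prod>j\<in>UNIV. (r $ j) ^ ((x - axis i 1) $ j)))"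
          using multinomial_coeff_minus_axis(1)[OF True pos] by (simp add: pmf_multinomial[OF r])
        then show ?thesis
          unfolding multinomial_coeff_minus_axis(2,3)[OF True pos] using pos by simp
      qed simp
    qed simp
    also have "\<dots> = multinomial_coeff x * (\<Prod>j\<in>UNIV. (r $ j) ^ (x $ j)) * (real (\<Sum>i\<in>UNIV. x $ i) / Suc m)"
      by (simp only: sum_distrib_left sum_divide_distrib of_nat_sum)
    finally show ?thesis using True by (simp add: pmf_multinomial[OF r])
  next
    case False
    have "(\<Sum>j\<in>UNIV. (x - axis i 1) $ j) \<noteq> m" if "0 < x $ i" for i
    proof
      assume "(\<Sum>j\<in>UNIV. (x - axis i 1) $ j) = m"
      moreover have "x = (x - axis i 1) + axis i 1" using that by (auto simp: vec_eq_iff axis_def)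
      then have "(\<Sum>j\<in>UNIV. x $ j) = (\<Sum>j\<in>UNIV. (x - axis i 1) $ j + (axis i 1 :: nat ^ 'k) $ j)"
        by (metis vector_add_component)
      moreover have "(\<Sum>j\<in>UNIV. (axis i 1 :: nat ^ 'k) $ j) = 1" by (simp add: axis_def)
      ultimately show False using False by (simp add: sum.distrib)
    qed
    then show ?thesis using False by (auto simp: pmf_multinomial[OF r] intro!: sum.neutral)
  qed
  finally show "pmf (multinomial_pmf (Suc m) r) x =
    pmf (bind_pmf (class_pmf r) (\<lambda>i. map_pmf (\<lambda>x. x + axis i 1) (multinomial_pmf m r))) x" ..
qed

lemma expectation_multinomial_pmf_Suc:
  fixes f :: "nat ^ 'k \<Rightarrow> 'c::{banach, second_countable_topology}"
  assumes r: "prob_vec r"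
  shows "measure_pmf.expectation (multinomial_pmf (Suc m) r) f =
    (\<Sum>i\<in>UNIV. r $ i *\<^sub>R measure_pmf.expectation (multinomial_pmf m r) (\<lambda>x. f (x + axis i 1)))"
  unfolding multinomial_pmf_Suc[OF r]
  by (subst pmf_expectation_bind[of UNIV])
     (auto simp: pmf_class_pmf[OF r] finite_set_pmf_multinomial[OF r])

definition centered_count :: "nat \<Rightarrow> real ^ 'k \<Rightarrow> nat ^ 'k \<Rightarrow> real ^ 'k" where
  "centered_count m r x = (\<chi> i. real (x $ i)) - real m *\<^sub>R r"

lemma centered_count_Suc: "centered_count (Suc m) r (x + axis i 1) = centered_count m r x + (axis i 1 - r)"
  by (simp add: centered_count_def vec_eq_iff axis_def algebra_simps)

lemma sum_prob_vec_axis: "(\<Sum>i\<in>UNIV. r $ i *\<^sub>R axis i 1) = (r :: real ^ 'k)"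
  by (auto simp: vec_eq_iff axis_def if_distrib sum.If_cases cong: if_cong)

lemma sum_prob_vec_axis_diff: "prob_vec r \<Longrightarrow> (\<Sum>i\<in>UNIV. r $ i *\<^sub>R (axis i 1 - r)) = 0"
  by (simp add: scaleR_diff_right sum_subtractf sum_prob_vec_axis scaleR_left.sum[symmetric] prob_vec_def)

lemma integrable_multinomial_pmf:
  fixes f :: "nat ^ 'k \<Rightarrow> 'c::{banach, second_countable_topology}"
  shows "prob_vec r \<Longrightarrow> integrable (measure_pmf (multinomial_pmf m r)) f"
  by (rule integrable_measure_pmf_finite[OF finite_set_pmf_multinomial])

text \<open>A further trial adds an increment whose mean vanishes, so the mixed term drops out and the second moment
grows by at most one. The bound does not depend on \<open>r\<close>; this gives Chebyshev estimates that are
uniform over all parameters from which the bootstrap may draw.\<close>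

lemma expectation_norm_centered_count:
  fixes r :: "real ^ 'k"
  assumes r: "prob_vec r"
  shows "measure_pmf.expectation (multinomial_pmf m r) (\<lambda>x. (norm (centered_count m r x))\<^sup>2) \<le> m"
proof (induction m)
  case 0
  then show ?case by (simp add: multinomial_pmf_0[OF r] centered_count_def vec_eq_iff zero_vec_def[symmetric])
next
  case (Suc m)
  note int = integrable_multinomial_pmf[OF r]
  let ?E = "measure_pmf.expectation (multinomial_pmf m r)"
  let ?V = "\<lambda>x. centered_count m r x"
  have pt: "(\<Sum>i\<in>UNIV. r $ i * (norm (v + (axis i 1 - r)))\<^sup>2) \<le> (norm v)\<^sup>2 + 1" for v :: "real ^ 'k"
  proof -
    have "(\<Sum>i\<in>UNIV. r $ i * (norm (v + (axis i 1 - r)))\<^sup>2)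
       = (\<Sum>i\<in>UNIV. r $ i * (norm v)\<^sup>2 + 2 * (v \<bullet> (r $ i *\<^sub>R (axis i 1 - r))) + r $ i * (norm (axis i 1 - r))\<^sup>2)"
      by (intro sum.cong) (auto simp: power2_norm_eq_inner algebra_simps inner_commute)
    also have "\<dots> = (\<Sum>i\<in>UNIV. r $ i) * (norm v)\<^sup>2 + 2 * (v \<bullet> (\<Sum>i\<in>UNIV. r $ i *\<^sub>R (axis i 1 - r)))
        + (\<Sum>i\<in>UNIV. r $ i * (norm (axis i 1 - r))\<^sup>2)"
      by (simp only: sum.distrib sum_distrib_left[symmetric] sum_distrib_right[symmetric] inner_sum_right[symmetric])
    also have "\<dots> = (norm v)\<^sup>2 + (\<Sum>i\<in>UNIV. r $ i * (norm (axis i 1 - r))\<^sup>2)"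
      using r by (simp only: sum_prob_vec_axis_diff[OF r]) (simp add: prob_vec_def)
    also have "(\<Sum>i\<in>UNIV. r $ i * (norm (axis i 1 - r))\<^sup>2)
       = (\<Sum>i\<in>UNIV. r $ i * (1 + r \<bullet> r - 2 * r $ i))"
      by (intro sum.cong) (auto simp: power2_norm_eq_inner inner_diff_left inner_diff_right inner_axis inner_axis' )
    also have "\<dots> = (1 + r \<bullet> r) * (\<Sum>i\<in>UNIV. r $ i) - 2 * (\<Sum>i\<in>UNIV. r $ i * r $ i)"
      by (simp add: right_diff_distrib sum_subtractf sum_distrib_left sum_distrib_right mult_ac)
    also have "(\<Sum>i\<in>UNIV. r $ i * r $ i) = r \<bullet> r" by (simp add: inner_vec_def)
    also have "(1 + r \<bullet> r) * (\<Sum>i\<in>UNIV. r $ i) - 2 * (r \<bullet> r) \<le> 1" using r by (simp add: prob_vec_def)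
    finally show ?thesis by simp
  qed
  have "measure_pmf.expectation (multinomial_pmf (Suc m) r) (\<lambda>x. (norm (centered_count (Suc m) r x))\<^sup>2)
      = (\<Sum>i\<in>UNIV. r $ i * ?E (\<lambda>x. (norm (?V x + (axis i 1 - r)))\<^sup>2))"
    by (simp add: expectation_multinomial_pmf_Suc[OF r] centered_count_Suc del: One_nat_def)
  also have "\<dots> = ?E (\<lambda>x. \<Sum>i\<in>UNIV. r $ i * (norm (?V x + (axis i 1 - r)))\<^sup>2)"
    by (subst Bochner_Integration.integral_sum) (auto intro: int)
  also have "\<dots> \<le> ?E (\<lambda>x. (norm (?V x))\<^sup>2 + 1)"
    by (intro integral_mono int pt)
  also have "\<dots> = ?E (\<lambda>x. (norm (?V x))\<^sup>2) + 1"
    by (subst Bochner_Integration.integral_add) (auto intro: int)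
  also have "\<dots> \<le> Suc m" using Suc by simp
  finally show ?case .
qed

lemma expectation_cis_centered_count:
  fixes r :: "real ^ 'k"
  assumes r: "prob_vec r"
  shows "measure_pmf.expectation (multinomial_pmf m r) (\<lambda>x. cis (u \<bullet> centered_count m r x)) =
    (\<Sum>i\<in>UNIV. r $ i *\<^sub>R cis (u \<bullet> (axis i 1 - r))) ^ m"
proof (induction m)
  case 0
  then show ?case by (simp add: multinomial_pmf_0[OF r] centered_count_def vec_eq_iff zero_vec_def[symmetric])
next
  case (Suc m)
  have "measure_pmf.expectation (multinomial_pmf (Suc m) r) (\<lambda>x. cis (u \<bullet> centered_count (Suc m) r x))
      = (\<Sum>i\<in>UNIV. r $ i *\<^sub>R measure_pmf.expectation (multinomial_pmf m r)
          (\<lambda>x. cis (u \<bullet> centered_count m r x) * cis (u \<bullet> (axis i 1 - r))))"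
    by (simp add: expectation_multinomial_pmf_Suc[OF r] centered_count_Suc inner_add_right cis_mult del: One_nat_def)
  also have "\<dots> = (\<Sum>i\<in>UNIV. r $ i *\<^sub>R (measure_pmf.expectation (multinomial_pmf m r)
          (\<lambda>x. cis (u \<bullet> centered_count m r x)) * cis (u \<bullet> (axis i 1 - r))))"
    by simp
  also have "\<dots> = (\<Sum>i\<in>UNIV. r $ i *\<^sub>R cis (u \<bullet> (axis i 1 - r))) ^ Suc m"
    by (simp only: Suc.IH) (simp add: sum_distrib_right mult.commute)
  finally show ?case .
qed

lemma cis_quadratic_approx: "cmod (cis x - (1 + \<i> * x - x\<^sup>2 / 2)) \<le> \<bar>x\<bar> ^ 3 / 6"
  using iexp_approx1[of x 2]
  by (simp add: cis_conv_exp atMost_nat_numeral numeral_2_eq_2 fact_numeral numeral_3_eq_3 power_mult_distrib algebra_simps)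

section \<open>Characteristic functions of scaled multinomial errors\<close>

text \<open>The variance, under the class probabilities \<open>r\<close>, of the linear form \<open>a\<close> of the indicator vector of one trial.\<close>

definition class_var :: "real ^ 'k \<Rightarrow> real ^ 'k \<Rightarrow> real" where
  "class_var r a = (\<Sum>i\<in>UNIV. r $ i * (a \<bullet> (axis i 1 - r))\<^sup>2)"

lemma class_var_nonneg: "prob_vec r \<Longrightarrow> 0 \<le> class_var r a"
  by (auto simp: class_var_def prob_vec_def intro!: sum_nonneg)

lemma tendsto_class_var: "r \<longlonglongrightarrow> r0 \<Longrightarrow> (\<lambda>j. class_var (r j) a) \<longlonglongrightarrow> class_var r0 a"
  unfolding class_var_def by (intro tendsto_intros)

lemma inner_multinomial_cov:
  fixes r a :: "real ^ 'k"
  assumes r: "prob_vec r"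
  shows "a \<bullet> (multinomial_cov r *v a) = class_var r a"
proof -
  have ar: "a \<bullet> r = (\<Sum>j\<in>UNIV. r $ j * a $ j)" by (simp add: inner_vec_def mult.commute)
  have mv: "(multinomial_cov r *v a) $ i = r $ i * a $ i - r $ i * (a \<bullet> r)" for i
  proof -
    have "(multinomial_cov r *v a) $ i = (\<Sum>j\<in>UNIV. (if i = j then r $ i * a $ j else 0) - r $ i * (r $ j * a $ j))"
      unfolding matrix_vector_mult_def multinomial_cov_def
      by (auto intro!: sum.cong simp: algebra_simps)
    then show ?thesis unfolding ar sum_distrib_left by (simp add: sum_subtractf)
  qed
  have "a \<bullet> (multinomial_cov r *v a) = (\<Sum>i\<in>UNIV. r $ i * (a $ i)\<^sup>2 - (a \<bullet> r) * (r $ i * a $ i))"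
    unfolding inner_vec_def[of a "multinomial_cov r *v a"] mv
    by (intro sum.cong) (auto simp: algebra_simps power2_eq_square)
  also have "\<dots> = (\<Sum>i\<in>UNIV. r $ i * (a $ i)\<^sup>2) - (a \<bullet> r)\<^sup>2"
    by (simp add: sum_subtractf sum_distrib_left[symmetric] ar[symmetric] power2_eq_square)
  finally have 1: "a \<bullet> (multinomial_cov r *v a) = (\<Sum>i\<in>UNIV. r $ i * (a $ i)\<^sup>2) - (a \<bullet> r)\<^sup>2" .
  have "class_var r a = (\<Sum>i\<in>UNIV. r $ i * (a $ i)\<^sup>2 - 2 * (a \<bullet> r) * (r $ i * a $ i) + (a \<bullet> r)\<^sup>2 * r $ i)"
    unfolding class_var_def
    by (intro sum.cong) (auto simp: inner_diff_right inner_axis power2_eq_square algebra_simps)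
  also have "\<dots> = (\<Sum>i\<in>UNIV. r $ i * (a $ i)\<^sup>2) - 2 * (a \<bullet> r) * (a \<bullet> r) + (a \<bullet> r)\<^sup>2 * (\<Sum>i\<in>UNIV. r $ i)"
    by (simp only: sum.distrib sum_subtractf sum_distrib_left[symmetric] ar[symmetric])
  finally show ?thesis using 1 r by (simp add: prob_vec_def power2_eq_square)
qed

lemma inner_limit_cov:
  "prob_vec p \<Longrightarrow> prob_vec q \<Longrightarrow>
    a \<bullet> (limit_cov c p q *v a) = (1 + c) * class_var p a + (1 + inverse c) * class_var q a"
  by (simp add: limit_cov_def matrix_vector_mult_add_rdistrib inner_add_right inner_multinomial_cov
      scaleR_matrix_vector_assoc[symmetric])

lemma norm_prob_vec_le_1:
  fixes r :: "real ^ 'k"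
  assumes "prob_vec r" shows "norm r \<le> 1"
proof -
  have "norm r \<le> (\<Sum>i\<in>UNIV. \<bar>r $ i\<bar>)" by (rule norm_le_l1_cart)
  also have "\<dots> = 1" using assms by (simp add: prob_vec_def)
  finally show ?thesis .
qed

lemma abs_exp_minus_linear_le:
  fixes y :: real
  assumes "0 \<le> y" shows "\<bar>exp (- y) - (1 - y)\<bar> \<le> y\<^sup>2"
proof -
  have "1 - y \<le> exp (- y)" using exp_ge_add_one_self[of "-y"] by simp
  moreover have "exp (- y) \<le> 1 / (1 + y)"
    using exp_ge_add_one_self[of y] assms by (simp add: exp_minus divide_inverse[symmetric] inverse_le_imp_le frac_le inverse_eq_divide)
  moreover have "1 / (1 + y) \<le> 1 - y + y\<^sup>2"
  proof -
    have "(1 - y + y\<^sup>2) * (1 + y) = 1 + y ^ 3" by (simp add: algebra_simps power2_eq_square power3_eq_cube)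
    then show ?thesis using assms by (simp add: pos_divide_le_eq)
  qed
  ultimately show ?thesis by linarith
qed

text \<open>The characteristic function of one trial agrees, up to an error of third order in \<open>u\<close>, with that of a centred normal variable of the
same variance, and \<open>m\<close>-th powers of numbers of modulus at most one differ by at most \<open>m\<close> times the
difference of the numbers. The explicit bound is what permits \<open>r\<close> to change along the sequence below.\<close>

lemma char_multinomial_error:
  fixes r a :: "real ^ 'k" and u :: real
  assumes r: "prob_vec r"
  shows "cmod (measure_pmf.expectation (multinomial_pmf m r) (\<lambda>x. cis ((u *\<^sub>R a) \<bullet> centered_count m r x))
      - exp (- (m * u\<^sup>2 * class_var r a / 2)))
    \<le> m * u\<^sup>2 * (\<bar>u\<bar> * (2 * norm a) ^ 3 / 6 + u\<^sup>2 * (class_var r a)\<^sup>2 / 4)"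
proof -
  define z where "z = (\<Sum>i\<in>UNIV. r $ i *\<^sub>R cis ((u *\<^sub>R a) \<bullet> (axis i 1 - r)))"
  define y where "y = u\<^sup>2 * class_var r a / 2"
  define t where "t = (\<lambda>i. u * (a \<bullet> (axis i 1 - r)))"
  have y: "0 \<le> y" using class_var_nonneg[OF r] by (simp add: y_def)
  have r1: "(\<Sum>i\<in>UNIV. r $ i) = 1" and r0: "\<And>i. 0 \<le> r $ i" using r by (auto simp: prob_vec_def)
  have zn: "cmod z \<le> 1"
  proof -
    have "cmod z \<le> (\<Sum>i\<in>UNIV. cmod (r $ i *\<^sub>R cis ((u *\<^sub>R a) \<bullet> (axis i 1 - r))))"
      unfolding z_def by (rule norm_sum)
    also have "\<dots> = 1" using r0 r1 by simp
    finally show ?thesis .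
  qed
  have t: "\<bar>t i\<bar> \<le> \<bar>u\<bar> * (2 * norm a)" for i
  proof -
    have "norm (axis i 1 - r) \<le> norm (axis i (1::real)) + norm r" by (rule norm_triangle_ineq4)
    also have "\<dots> \<le> 2" using norm_prob_vec_le_1[OF r] by (simp add: norm_axis_1)
    finally have "norm a * norm (axis i 1 - r) \<le> norm a * 2" by (intro mult_left_mono) auto
    then have "\<bar>a \<bullet> (axis i 1 - r)\<bar> \<le> 2 * norm a"
      using Cauchy_Schwarz_ineq2[of a "axis i 1 - r"] by linarith
    then show ?thesis by (simp add: t_def abs_mult mult_left_mono)
  qed
  have lin: "(\<Sum>i\<in>UNIV. r $ i * t i) = 0"
  proof -
    have "(\<Sum>i\<in>UNIV. r $ i * t i) = u * (a \<bullet> (\<Sum>i\<in>UNIV. r $ i *\<^sub>R (axis i 1 - r)))"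
      by (simp add: t_def inner_sum_right sum_distrib_left mult_ac)
    then show ?thesis by (simp add: sum_prob_vec_axis_diff[OF r])
  qed
  have quad: "(\<Sum>i\<in>UNIV. r $ i * ((t i)\<^sup>2 / 2)) = y"
    by (simp add: t_def y_def class_var_def sum_distrib_left sum_divide_distrib power_mult_distrib mult_ac)
  have "(\<Sum>i\<in>UNIV. r $ i *\<^sub>R (1 + \<i> * t i - (t i)\<^sup>2 / 2))
      = (\<Sum>i\<in>UNIV. of_real (r $ i) + \<i> * of_real (r $ i * t i) - of_real (r $ i * ((t i)\<^sup>2 / 2)))"
    by (intro sum.cong) (auto simp: scaleR_conv_of_real algebra_simps)
  also have "\<dots> = of_real (\<Sum>i\<in>UNIV. r $ i) + \<i> * of_real (\<Sum>i\<in>UNIV. r $ i * t i)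
      - of_real (\<Sum>i\<in>UNIV. r $ i * ((t i)\<^sup>2 / 2))"
    by (simp only: sum.distrib sum_subtractf sum_distrib_left[symmetric] of_real_sum)
  also have "\<dots> = of_real (1 - y)" by (simp only: lin quad r1) simp
  finally have "z - of_real (1 - y) = (\<Sum>i\<in>UNIV. r $ i *\<^sub>R (cis (t i) - (1 + \<i> * t i - (t i)\<^sup>2 / 2)))"
    by (simp add: z_def t_def scaleR_diff_right sum_subtractf)
  then have "cmod (z - of_real (1 - y)) \<le> (\<Sum>i\<in>UNIV. cmod (r $ i *\<^sub>R (cis (t i) - (1 + \<i> * t i - (t i)\<^sup>2 / 2))))"
    by (simp only: norm_sum)
  also have "\<dots> \<le> (\<Sum>i\<in>UNIV. r $ i * ((\<bar>u\<bar> * (2 * norm a)) ^ 3 / 6))"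
  proof (intro sum_mono)
    fix i
    have "cmod (cis (t i) - (1 + \<i> * t i - (t i)\<^sup>2 / 2)) \<le> \<bar>t i\<bar> ^ 3 / 6" by (rule cis_quadratic_approx)
    also have "\<dots> \<le> (\<bar>u\<bar> * (2 * norm a)) ^ 3 / 6"
      by (intro divide_right_mono power_mono t) auto
    finally have "cmod (cis (t i) - (1 + \<i> * t i - (t i)\<^sup>2 / 2)) \<le> (\<bar>u\<bar> * (2 * norm a)) ^ 3 / 6" .
    from mult_left_mono[OF this r0[of i]]
    show "cmod (r $ i *\<^sub>R (cis (t i) - (1 + \<i> * t i - (t i)\<^sup>2 / 2))) \<le> r $ i * ((\<bar>u\<bar> * (2 * norm a)) ^ 3 / 6)"
      using r0[of i] by (simp only: norm_scaleR abs_of_nonneg)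
  qed
  also have "\<dots> = (\<bar>u\<bar> * (2 * norm a)) ^ 3 / 6" unfolding sum_distrib_right[symmetric] r1 by simp
  finally have zy: "cmod (z - of_real (1 - y)) \<le> (\<bar>u\<bar> * (2 * norm a)) ^ 3 / 6" .
  have "cmod (z - of_real (exp (- y))) \<le> cmod (z - of_real (1 - y)) + cmod (of_real (1 - y) - of_real (exp (- y)))"
    by (rule norm_triangle_sub[of "z - of_real (exp (- y))" "z - of_real (1 - y)", simplified diff_diff_eq2 diff_add_eq, THEN order_trans])
      (simp add: algebra_simps)
  also have "cmod (of_real (1 - y) - of_real (exp (- y))) \<le> y\<^sup>2"
    unfolding of_real_diff[symmetric] norm_of_real using abs_exp_minus_linear_le[OF y] by (simp add: abs_minus_commute)
  finally have d: "cmod (z - of_real (exp (- y))) \<le> (\<bar>u\<bar> * (2 * norm a)) ^ 3 / 6 + y\<^sup>2" using zy by linarith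
  have "cmod (z ^ m - of_real (exp (- y)) ^ m) \<le> m * cmod (z - of_real (exp (- y)))"
    using zn y by (intro norm_power_diff) auto
  also have "\<dots> \<le> m * ((\<bar>u\<bar> * (2 * norm a)) ^ 3 / 6 + y\<^sup>2)" by (intro mult_left_mono d) auto
  also have "\<dots> = m * u\<^sup>2 * (\<bar>u\<bar> * (2 * norm a) ^ 3 / 6 + u\<^sup>2 * (class_var r a)\<^sup>2 / 4)"
  proof -
    have u3: "\<bar>u\<bar> ^ 3 = u\<^sup>2 * \<bar>u\<bar>" by (simp add: power3_eq_cube power2_eq_square)
    show ?thesis by (simp add: y_def power_mult_distrib u3 power2_eq_square algebra_simps)
  qed
  also have "of_real (exp (- y)) ^ m = complex_of_real (exp (- (m * u\<^sup>2 * class_var r a / 2)))"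
    unfolding of_real_power[symmetric] exp_of_nat_mult[symmetric] by (simp add: y_def mult_ac)
  finally show ?thesis unfolding expectation_cis_centered_count[OF r] z_def by simp
qed

lemma char_multinomial_tendsto:
  fixes r :: "nat \<Rightarrow> real ^ 'k" and m :: "nat \<Rightarrow> nat" and u :: "nat \<Rightarrow> real"
  assumes r: "\<And>j. prob_vec (r j)" "r \<longlonglongrightarrow> r0"
    and m: "filterlim m at_top sequentially"
    and u: "(\<lambda>j. m j * (u j)\<^sup>2) \<longlonglongrightarrow> s"
  shows "(\<lambda>j. measure_pmf.expectation (multinomial_pmf (m j) (r j)) (\<lambda>x. cis ((u j *\<^sub>R a) \<bullet> centered_count (m j) (r j) x)))
    \<longlonglongrightarrow> exp (- (s * class_var r0 a / 2))"
proof -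
  have minf: "filterlim (\<lambda>j. real (m j)) at_top sequentially"
    using m by (rule filterlim_compose[OF filterlim_real_sequentially])
  have "(\<lambda>j. inverse (real (m j)) * (m j * (u j)\<^sup>2)) \<longlonglongrightarrow> 0 * s"
    by (intro tendsto_mult u tendsto_inverse_0_at_top minf)
  moreover have "\<forall>\<^sub>F j in sequentially. inverse (real (m j)) * (m j * (u j)\<^sup>2) = (u j)\<^sup>2"
    using m[unfolded filterlim_at_top, rule_format, of 1]
    by eventually_elim auto
  ultimately have u2: "(\<lambda>j. (u j)\<^sup>2) \<longlonglongrightarrow> 0" by (simp add: tendsto_cong)
  then have "(\<lambda>j. sqrt ((u j)\<^sup>2)) \<longlonglongrightarrow> sqrt 0" by (rule tendsto_real_sqrt)
  then have u1: "(\<lambda>j. \<bar>u j\<bar>) \<longlonglongrightarrow> 0" by simp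
  define E where "E = (\<lambda>j. m j * (u j)\<^sup>2 * (\<bar>u j\<bar> * (2 * norm a) ^ 3 / 6 + (u j)\<^sup>2 * (class_var (r j) a)\<^sup>2 / 4))"
  have "E \<longlonglongrightarrow> s * (0 * (2 * norm a) ^ 3 / 6 + 0 * (class_var r0 a)\<^sup>2 / 4)"
    unfolding E_def by (intro tendsto_intros u u1 u2 tendsto_class_var r) auto
  then have E: "E \<longlonglongrightarrow> 0" by simp
  define \<phi> where "\<phi> = (\<lambda>j. measure_pmf.expectation (multinomial_pmf (m j) (r j)) (\<lambda>x. cis ((u j *\<^sub>R a) \<bullet> centered_count (m j) (r j) x)))"
  define \<psi> where "\<psi> = (\<lambda>j. complex_of_real (exp (- (m j * (u j)\<^sup>2 * class_var (r j) a / 2))))"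
  have "(\<lambda>j. \<phi> j - \<psi> j) \<longlonglongrightarrow> 0"
  proof (rule Lim_null_comparison[OF _ E])
    show "\<forall>\<^sub>F j in sequentially. norm (\<phi> j - \<psi> j) \<le> E j"
      unfolding \<phi>_def \<psi>_def E_def by (intro always_eventually allI char_multinomial_error r)
  qed
  moreover have "\<psi> \<longlonglongrightarrow> complex_of_real (exp (- (s * class_var r0 a / 2)))"
    unfolding \<psi>_def by (intro tendsto_intros u tendsto_class_var r) auto
  ultimately have "(\<lambda>j. (\<phi> j - \<psi> j) + \<psi> j) \<longlonglongrightarrow> 0 + complex_of_real (exp (- (s * class_var r0 a / 2)))"
    by (rule tendsto_add)
  then show ?thesis unfolding \<phi>_def by simp
qed

lemma expectation_pair_pmf_mult:
  fixes f :: "'a \<Rightarrow> complex" and g :: "'b \<Rightarrow> complex"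
  assumes "finite (set_pmf A)" "finite (set_pmf B)"
  shows "measure_pmf.expectation (pair_pmf A B) (\<lambda>(x, y). f x * g y) =
    measure_pmf.expectation A f * measure_pmf.expectation B g"
proof -
  have "pair_pmf A B = bind_pmf A (\<lambda>x. map_pmf (Pair x) B)"
    by (simp add: pair_pmf_def map_pmf_def)
  then have "measure_pmf.expectation (pair_pmf A B) (\<lambda>(x, y). f x * g y)
      = (\<Sum>x\<in>set_pmf A. pmf A x *\<^sub>R measure_pmf.expectation (map_pmf (Pair x) B) (\<lambda>(x, y). f x * g y))"
    using assms by (simp add: pmf_expectation_bind[of "set_pmf A"])
  also have "\<dots> = (\<Sum>x\<in>set_pmf A. pmf A x *\<^sub>R f x) * measure_pmf.expectation B g"
    by (simp add: sum_distrib_right)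
  also have "(\<Sum>x\<in>set_pmf A. pmf A x *\<^sub>R f x) = measure_pmf.expectation A f"
    using assms by (subst integral_measure_pmf[of "set_pmf A"]) auto
  finally show ?thesis .
qed

definition two_sample_pmf :: "nat \<Rightarrow> nat \<Rightarrow> real ^ 'k \<Rightarrow> real ^ 'k \<Rightarrow> ((nat ^ 'k) \<times> (nat ^ 'k)) pmf" where
  "two_sample_pmf m1 m2 p q = pair_pmf (multinomial_pmf m1 p) (multinomial_pmf m2 q)"

definition scaled_error :: "nat \<Rightarrow> nat \<Rightarrow> real ^ 'k \<Rightarrow> real ^ 'k \<Rightarrow> (nat ^ 'k) \<times> (nat ^ 'k) \<Rightarrow> real ^ 'k" where
  "scaled_error m1 m2 p q = (\<lambda>(x, y). sqrt (real m1 + real m2) *\<^sub>R ((mle m1 x - mle m2 y) - (p - q)))"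

lemma finite_set_pmf_two_sample:
  "prob_vec p \<Longrightarrow> prob_vec q \<Longrightarrow> finite (set_pmf (two_sample_pmf m1 m2 p q))"
  by (simp add: two_sample_pmf_def finite_set_pmf_multinomial)

lemma mle_error: "0 < m \<Longrightarrow> mle m x - r = (1 / m) *\<^sub>R centered_count m r x"
  by (simp add: mle_def centered_count_def vec_eq_iff diff_divide_distrib)

lemma expectation_mle_error:
  assumes r: "prob_vec r" and m: "0 < m"
  shows "measure_pmf.expectation (multinomial_pmf m r) (\<lambda>x. (norm (mle m x - r))\<^sup>2) \<le> 1 / m"
proof -
  have "measure_pmf.expectation (multinomial_pmf m r) (\<lambda>x. (norm (mle m x - r))\<^sup>2)
      = measure_pmf.expectation (multinomial_pmf m r) (\<lambda>x. (norm (centered_count m r x))\<^sup>2) / m\<^sup>2"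
    using m by (simp add: mle_error power_divide)
  also have "\<dots> \<le> m / m\<^sup>2"
    by (intro divide_right_mono expectation_norm_centered_count r) auto
  also have "\<dots> = 1 / m" using m by (simp add: power2_eq_square)
  finally show ?thesis .
qed

lemma scaled_error_decomp:
  assumes "0 < m1" "0 < m2"
  shows "scaled_error m1 m2 p q (x, y) =
    (sqrt (real m1 + real m2) / m1) *\<^sub>R centered_count m1 p x + (- (sqrt (real m1 + real m2) / m2)) *\<^sub>R centered_count m2 q y"
proof -
  have "(mle m1 x - mle m2 y) - (p - q) = (mle m1 x - p) - (mle m2 y - q)" by simp
  also have "\<dots> = (1 / m1) *\<^sub>R centered_count m1 p x - (1 / m2) *\<^sub>R centered_count m2 q y"
    using assms by (simp only: mle_error)
  finally have eq: "(mle m1 x - mle m2 y) - (p - q)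
      = (1 / m1) *\<^sub>R centered_count m1 p x - (1 / m2) *\<^sub>R centered_count m2 q y" .
  show ?thesis unfolding scaled_error_def prod.case eq by (simp add: scaleR_diff_right)
qed

lemma char_scaled_error:
  fixes p q a :: "real ^ 'k"
  assumes pq: "prob_vec p" "prob_vec q" and m: "0 < m1" "0 < m2"
  shows "measure_pmf.expectation (two_sample_pmf m1 m2 p q) (\<lambda>z. cis (a \<bullet> scaled_error m1 m2 p q z)) =
    measure_pmf.expectation (multinomial_pmf m1 p)
      (\<lambda>x. cis (((sqrt (real m1 + real m2) / m1) *\<^sub>R a) \<bullet> centered_count m1 p x)) *
    measure_pmf.expectation (multinomial_pmf m2 q)
      (\<lambda>y. cis (((- (sqrt (real m1 + real m2) / m2)) *\<^sub>R a) \<bullet> centered_count m2 q y))"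
proof -
  have "(\<lambda>z. cis (a \<bullet> scaled_error m1 m2 p q z)) = (\<lambda>(x, y).
      cis (((sqrt (real m1 + real m2) / m1) *\<^sub>R a) \<bullet> centered_count m1 p x) *
      cis (((- (sqrt (real m1 + real m2) / m2)) *\<^sub>R a) \<bullet> centered_count m2 q y))"
    by (rule ext) (auto simp: scaled_error_decomp[OF m] inner_add_right inner_diff_right cis_mult)
  then show ?thesis unfolding two_sample_pmf_def
    by (simp only: expectation_pair_pmf_mult[OF finite_set_pmf_multinomial[OF pq(1)] finite_set_pmf_multinomial[OF pq(2)]])
qed

lemma borel_measurable_cis[measurable]: "cis \<in> borel_measurable borel"
  by (intro borel_measurable_continuous_onI) (auto simp: cis_conv_exp intro!: continuous_intros)

text \<open>A form \<open>a\<close> of vanishing variance is a point mass at zero, for which the formula holds with the value one.\<close>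

lemma char_centered_normal:
  assumes "centered_normal_rv MZ Z S"
  shows "(LINT \<omega>|MZ. cis (a \<bullet> Z \<omega>)) = exp (- (a \<bullet> (S *v a)) / 2)"
proof -
  interpret prob_space MZ using assms by (simp add: centered_normal_rv_def)
  have Z[measurable]: "Z \<in> borel_measurable MZ" using assms by (simp add: centered_normal_rv_def)
  define v where "v = a \<bullet> (S *v a)"
  have v: "0 \<le> v" "distr MZ borel (\<lambda>\<omega>. a \<bullet> Z \<omega>) =
          (if v = 0 then return borel 0 else density lborel (normal_density 0 (sqrt v)))"
    using assms by (auto simp: centered_normal_rv_def v_def)
  show ?thesis
  proof (cases "v = 0")
    case True
    have "(LINT \<omega>|MZ. cis (a \<bullet> Z \<omega>)) = (LINT x|distr MZ borel (\<lambda>\<omega>. a \<bullet> Z \<omega>). cis x)"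
      by (rule integral_distr[symmetric]) auto
    also have "\<dots> = 1" unfolding v(2) using True by (simp add: integral_return)
    finally show ?thesis using True by (simp add: v_def)
  next
    case False
    then have s: "0 < sqrt v" using v by simp
    have "distributed MZ lborel (\<lambda>\<omega>. a \<bullet> Z \<omega>) (normal_density 0 (sqrt v))"
      unfolding distributed_def using v(2) False by (simp add: distr_cong[OF refl sets_lborel refl])
    then have "distributed MZ lborel (\<lambda>\<omega>. (a \<bullet> Z \<omega> - 0) / sqrt v) std_normal_density"
      by (rule iffD1[OF normal_standard_normal_convert[OF s]])
    then have "distr MZ lborel (\<lambda>\<omega>. (a \<bullet> Z \<omega>) / sqrt v) = std_normal_distribution"
      by (simp add: distributed_def)
    then have d: "distr MZ borel (\<lambda>\<omega>. (a \<bullet> Z \<omega>) / sqrt v) = std_normal_distribution"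
      by (simp add: distr_cong[OF refl sets_lborel refl])
    have "(LINT \<omega>|MZ. cis (a \<bullet> Z \<omega>)) = (LINT \<omega>|MZ. iexp (sqrt v * ((a \<bullet> Z \<omega>) / sqrt v)))"
      using s by (simp add: cis_conv_exp)
    also have "\<dots> = (LINT x|distr MZ borel (\<lambda>\<omega>. (a \<bullet> Z \<omega>) / sqrt v). iexp (sqrt v * x))"
      by (rule integral_distr[symmetric]) auto
    also have "\<dots> = char std_normal_distribution (sqrt v)" unfolding d char_def ..
    also have "\<dots> = exp (- v / 2)" using v by (simp add: char_std_normal_distribution)
    finally show ?thesis by (simp add: v_def)
  qed
qed

section \<open>Directional derivatives of a norm\<close>

lemma is_norm_triangle: "is_norm N \<Longrightarrow> N (x + y) \<le> N x + N y"
  by (simp add: is_norm_def)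

lemma is_norm_scaleR: "is_norm N \<Longrightarrow> N (s *\<^sub>R x) = \<bar>s\<bar> * N x"
  by (simp add: is_norm_def)

lemma is_norm_diff_le:
  assumes N: "is_norm N" shows "\<bar>N x - N y\<bar> \<le> N (x - y)"
proof -
  have "N (y - x) = N (x - y)"
    using is_norm_scaleR[OF N, of "-1" "x - y"] by simp
  then show ?thesis
    using is_norm_triangle[OF N, of "x - y" y] is_norm_triangle[OF N, of "y - x" x] by simp
qed

lemma is_norm_le_norm:
  fixes N :: "real ^ 'k \<Rightarrow> real"
  assumes N: "is_norm N"
  obtains C where "0 < C" "\<And>x. N x \<le> C * norm x"
proof
  define C where "C = 1 + (\<Sum>i\<in>UNIV. N (axis i 1))"
  have N0: "0 \<le> N x" for x using N by (simp add: is_norm_def)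
  show "0 < C" unfolding C_def using N0 by (intro add_pos_nonneg sum_nonneg) auto
  fix x :: "real ^ 'k"
  have sub: "N (sum f A) \<le> (\<Sum>i\<in>A. N (f i))" if "finite A" for f :: "'k \<Rightarrow> real ^ 'k" and A
    using that
  proof induction
    case empty
    then show ?case using is_norm_scaleR[OF N, of 0 0] by simp
  next
    case (insert i A)
    then show ?case using is_norm_triangle[OF N, of "f i" "sum f A"] by simp
  qed
  have "N x = N (\<Sum>i\<in>UNIV. x $ i *\<^sub>R axis i 1)" by (simp only: sum_prob_vec_axis)
  also have "\<dots> \<le> (\<Sum>i\<in>UNIV. N (x $ i *\<^sub>R axis i 1))" by (rule sub) simp
  also have "\<dots> = (\<Sum>i\<in>UNIV. \<bar>x $ i\<bar> * N (axis i 1))" by (simp add: is_norm_scaleR[OF N])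
  also have "\<dots> \<le> (\<Sum>i\<in>UNIV. norm x * N (axis i 1))"
    by (intro sum_mono mult_right_mono component_le_norm_cart N0)
  also have "\<dots> = norm x * (\<Sum>i\<in>UNIV. N (axis i 1))" by (simp add: sum_distrib_left)
  also have "\<dots> \<le> C * norm x" by (simp add: C_def algebra_simps)
  finally show "N x \<le> C * norm x" .
qed

text \<open>Convexity: \<open>\<theta> + s *\<^sub>R h\<close> lies on the segment from \<open>\<theta>\<close> to \<open>\<theta> + t *\<^sub>R h\<close>.\<close>

lemma norm_quotient_mono:
  assumes N: "is_norm N" and st: "0 < s" "s \<le> t"
  shows "(N (\<theta> + s *\<^sub>R h) - N \<theta>) / s \<le> (N (\<theta> + t *\<^sub>R h) - N \<theta>) / t"
proof -
  have t: "0 < t" using st by simp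
  have "\<theta> + s *\<^sub>R h = (1 - s / t) *\<^sub>R \<theta> + (s / t) *\<^sub>R (\<theta> + t *\<^sub>R h)"
    using t by (simp add: algebra_simps)
  then have "N (\<theta> + s *\<^sub>R h) \<le> N ((1 - s / t) *\<^sub>R \<theta>) + N ((s / t) *\<^sub>R (\<theta> + t *\<^sub>R h))"
    using is_norm_triangle[OF N] by metis
  also have "\<dots> = (1 - s / t) * N \<theta> + (s / t) * N (\<theta> + t *\<^sub>R h)"
    using st t by (simp add: is_norm_scaleR[OF N])
  finally have "N (\<theta> + s *\<^sub>R h) - N \<theta> \<le> (s / t) * (N (\<theta> + t *\<^sub>R h) - N \<theta>)"
    by (simp add: algebra_simps)
  then show ?thesis using st t by (simp add: field_simps)
qed

lemma dir_hadamard_tendsto: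
  assumes d: "has_dir_hadamard_derivative f d \<theta>" and h: "hs \<longlonglongrightarrow> h"
    and ts: "\<And>m. 0 < ts m" "decseq ts" "ts \<longlonglongrightarrow> 0"
  shows "(\<lambda>m. (f (\<theta> + ts m *\<^sub>R hs m) - f \<theta>) / ts m) \<longlonglongrightarrow> d h"
proof -
  have "(\<lambda>m. \<bar>(1 / ts m) * (f (\<theta> + ts m *\<^sub>R hs m) - f \<theta>) - d h\<bar>) \<longlonglongrightarrow> 0"
    using d h ts unfolding has_dir_hadamard_derivative_def by blast
  then have "(\<lambda>m. (1 / ts m) * (f (\<theta> + ts m *\<^sub>R hs m) - f \<theta>) - d h) \<longlonglongrightarrow> 0"
    by (simp add: tendsto_rabs_zero_iff)
  then show ?thesis by (simp add: LIM_zero_iff)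
qed

lemma inverse_Suc_seq:
  "0 < inverse (real (Suc m))" "decseq (\<lambda>m. inverse (real (Suc m)))" "(\<lambda>m. inverse (real (Suc m))) \<longlonglongrightarrow> 0"
  by (auto simp: decseq_def intro!: LIMSEQ_inverse_real_of_nat le_imp_inverse_le simp del: of_nat_Suc)

lemma dir_hadamard_quotient_tendsto:
  assumes d: "has_dir_hadamard_derivative f d \<theta>"
  shows "(\<lambda>m. (f (\<theta> + inverse (real (Suc m)) *\<^sub>R h) - f \<theta>) / inverse (real (Suc m))) \<longlonglongrightarrow> d h"
  by (rule dir_hadamard_tendsto[OF d tendsto_const inverse_Suc_seq])

lemma dir_hadamard_unique:
  assumes "has_dir_hadamard_derivative f d \<theta>" "has_dir_hadamard_derivative f d2 \<theta>"
  shows "d = d2"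
  by (rule ext, rule LIMSEQ_unique[OF dir_hadamard_quotient_tendsto dir_hadamard_quotient_tendsto])
     (use assms in auto)

text \<open>The difference quotients of a convex function decrease to the derivative as the step shrinks, so the derivative
bounds all of them from below.\<close>

lemma dir_hadamard_norm_lower:
  assumes d: "has_dir_hadamard_derivative N d \<theta>" and N: "is_norm N" and t: "0 < t"
  shows "N \<theta> + t * d h \<le> N (\<theta> + t *\<^sub>R h)"
proof -
  have ev: "\<forall>\<^sub>F m in sequentially. inverse (real (Suc m)) < t"
    using order_tendstoD(2)[OF inverse_Suc_seq(3) t] .
  have "d h \<le> (N (\<theta> + t *\<^sub>R h) - N \<theta>) / t"
  proof (rule tendsto_upperbound[OF dir_hadamard_quotient_tendsto[OF d]])
    show "\<forall>\<^sub>F m in sequentially. (N (\<theta> + inverse (real (Suc m)) *\<^sub>R h) - N \<theta>) / inverse (real (Suc m))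
        \<le> (N (\<theta> + t *\<^sub>R h) - N \<theta>) / t"
      using ev by eventually_elim (rule norm_quotient_mono[OF N], auto)
  qed simp
  then show ?thesis using t by (simp add: field_simps)
qed

text \<open>If the remainder were not uniform, there would be bounded directions with large quotients at arbitrarily small steps.
As quotients increase with the step, the steps may be taken to be \<open>1 / (m + 1)\<close>, and a convergent subsequence of
the directions contradicts differentiability along sequences.\<close>

lemma dir_hadamard_norm_upper:
  fixes N :: "real ^ 'k \<Rightarrow> real"
  assumes d: "has_dir_hadamard_derivative N d \<theta>" and N: "is_norm N" and \<delta>: "0 < \<delta>"
  shows "\<exists>t0>0. \<forall>t h. 0 < t \<longrightarrow> t \<le> t0 \<longrightarrow> norm h \<le> K \<longrightarrow> N (\<theta> + t *\<^sub>R h) \<le> N \<theta> + t * (d h + \<delta>)"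
proof (rule ccontr)
  let ?t = "\<lambda>m. inverse (real (Suc m))"
  let ?Q = "\<lambda>t h. (N (\<theta> + t *\<^sub>R h) - N \<theta>) / t"
  assume neg: "\<not> ?thesis"
  have "\<exists>h. norm h \<le> K \<and> d h + \<delta> < ?Q (?t m) h" for m
  proof -
    have "0 < ?t m" by simp
    then obtain t h where t: "0 < t" "t \<le> ?t m" "norm h \<le> K" "N \<theta> + t * (d h + \<delta>) < N (\<theta> + t *\<^sub>R h)"
      using neg by (meson not_le)
    then have "d h + \<delta> < ?Q t h" by (simp add: field_simps)
    also have "\<dots> \<le> ?Q (?t m) h" by (rule norm_quotient_mono[OF N t(1,2)])
    finally show ?thesis using t(3) by blast
  qed
  then obtain hs where hs: "\<And>m. norm (hs m) \<le> K" "\<And>m. d (hs m) + \<delta> < ?Q (?t m) (hs m)" by metis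
  have "compact (cball 0 K :: (real ^ 'k) set)" by simp
  then obtain h r where hr: "strict_mono r" "(hs \<circ> r) \<longlonglongrightarrow> h"
    using hs(1) unfolding compact_def by (metis dist_0_norm mem_cball)
  have Q: "(\<lambda>m. ?Q (?t (r m)) (hs (r m))) \<longlonglongrightarrow> d h"
  proof (rule dir_hadamard_tendsto[OF d hr(2)[unfolded o_def]])
    show "decseq (\<lambda>m. ?t (r m))"
      using inverse_Suc_seq(2) hr(1) unfolding decseq_def
      by (meson strict_mono_less_eq)
    show "(\<lambda>m. ?t (r m)) \<longlonglongrightarrow> 0"
      using LIMSEQ_subseq_LIMSEQ[OF inverse_Suc_seq(3) hr(1)] by (simp add: o_def)
  qed simp
  have "isCont d h" using d by (auto simp: has_dir_hadamard_derivative_def continuous_on_eq_continuous_at)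
  then have "(\<lambda>m. d (hs (r m)) + \<delta>) \<longlonglongrightarrow> d h + \<delta>"
    using hr(2) by (intro tendsto_intros isCont_tendsto_compose[of h d]) (auto simp: o_def)
  then have "d h + \<delta> \<le> d h"
    by (rule LIMSEQ_le[OF _ Q]) (use hs(2) in \<open>auto intro: less_imp_le\<close>)
  then show False using \<delta> by simp
qed

section \<open>Continuous functions of a normal vector\<close>

lemma measure_pair_integral_mult:
  fixes f :: "'a \<Rightarrow> complex" and g :: "'b \<Rightarrow> complex"
  assumes "prob_space M" "prob_space P"
    and m[measurable]: "f \<in> borel_measurable M" "g \<in> borel_measurable P"
    and b: "\<And>x. norm (f x) \<le> 1" "\<And>x. norm (g x) \<le> 1"
  shows "(LINT z|(M \<Otimes>\<^sub>M P). f (fst z) * g (snd z)) = (LINT x|M. f x) * (LINT y|P. g y)"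
proof -
  interpret M: prob_space M by fact
  interpret P: prob_space P by fact
  interpret MP: pair_prob_space M P ..
  have "integrable (M \<Otimes>\<^sub>M P) (\<lambda>z. f (fst z) * g (snd z))"
    by (rule MP.P.integrable_const_bound[of _ 1]) (use b in \<open>auto simp: norm_mult mult_le_one\<close>)
  then have "(LINT z|(M \<Otimes>\<^sub>M P). f (fst z) * g (snd z)) = (LINT x|M. LINT y|P. f x * g y)"
    using MP.integral_fst'[of "\<lambda>z. f (fst z) * g (snd z)"] by simp
  then show ?thesis by simp
qed

lemma prob_space_tight:
  fixes Z :: "'b \<Rightarrow> 'v::euclidean_space"
  assumes "prob_space MZ" and Z[measurable]: "Z \<in> borel_measurable MZ" and e: "0 < e"
  shows "\<exists>K. measure MZ {\<omega> \<in> space MZ. K < norm (Z \<omega>)} \<le> e"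
proof -
  interpret prob_space MZ by fact
  have "(\<lambda>i. measure MZ {\<omega> \<in> space MZ. real i < norm (Z \<omega>)}) \<longlonglongrightarrow> measure MZ (\<Inter>i. {\<omega> \<in> space MZ. real i < norm (Z \<omega>)})"
    by (rule finite_Lim_measure_decseq) (auto simp: decseq_def)
  also have "(\<Inter>i. {\<omega> \<in> space MZ. real i < norm (Z \<omega>)}) = {}"
  proof -
    have "\<exists>i. \<not> real i < norm (Z \<omega>)" for \<omega>
      using reals_Archimedean2[of "norm (Z \<omega>)"] by (auto simp: not_less intro: less_imp_le)
    then show ?thesis by blast
  qed
  finally have "\<forall>\<^sub>F i in sequentially. measure MZ {\<omega> \<in> space MZ. real i < norm (Z \<omega>)} < e"
    using e by (intro order_tendstoD(2)[of _ "0::real"]) auto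
  then obtain i :: nat where "measure MZ {\<omega> \<in> space MZ. real i < norm (Z \<omega>)} < e"
    using eventually_happens'[OF sequentially_bot] by blast
  then show ?thesis by (intro exI[of _ "real i"]) simp
qed

text \<open>The characteristic function of \<open>g (W j)\<close> at \<open>t\<close> consists of expectations of \<open>cos (t * g x)\<close> and \<open>sin (t * g x)\<close>,
which are bounded and continuous functions of the vector; the one-dimensional continuity theorem does the rest.\<close>

lemma real_continuous_distr_tendsto:
  fixes W :: "nat \<Rightarrow> 'a \<Rightarrow> 'v::euclidean_space" and Z :: "'b \<Rightarrow> 'v" and g :: "'v \<Rightarrow> real"
  assumes M: "\<And>j. prob_space (M j)" "prob_space MZ"
    and meas: "\<And>j. W j \<in> borel_measurable (M j)" "Z \<in> borel_measurable MZ"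
    and char: "\<And>a. (\<lambda>j. LINT \<omega>|M j. cis (a \<bullet> W j \<omega>)) \<longlonglongrightarrow> (LINT \<omega>|MZ. cis (a \<bullet> Z \<omega>))"
    and tight: "\<And>e. 0 < e \<Longrightarrow> \<exists>K. \<forall>\<^sub>F j in sequentially. measure (M j) {\<omega> \<in> space (M j). K < norm (W j \<omega>)} \<le> e"
    and gcont: "continuous_on UNIV g"
  shows "weak_conv_m (\<lambda>j. distr (M j) borel (\<lambda>\<omega>. g (W j \<omega>))) (distr MZ borel (\<lambda>\<omega>. g (Z \<omega>)))"
proof (rule levy_continuity)
  have [measurable]: "g \<in> borel_measurable borel" using gcont by (rule borel_measurable_continuous_onI)
  note meas[measurable]
  show "real_distribution (distr (M j) borel (\<lambda>\<omega>. g (W j \<omega>)))" for j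
    by (intro prob_space.real_distribution_distr M) measurable
  show "real_distribution (distr MZ borel (\<lambda>\<omega>. g (Z \<omega>)))"
    by (intro prob_space.real_distribution_distr M) measurable
  fix t :: real
  have ch: "char (distr P borel (\<lambda>\<omega>. g (V \<omega>))) t = Complex (LINT \<omega>|P. cos (t * g (V \<omega>))) (LINT \<omega>|P. sin (t * g (V \<omega>)))"
    if P: "prob_space P" and V[measurable]: "V \<in> borel_measurable P" for P :: "'c measure" and V
  proof -
    interpret P: prob_space P by fact
    have "char (distr P borel (\<lambda>\<omega>. g (V \<omega>))) t = (LINT \<omega>|P. iexp (t * g (V \<omega>)))"
      unfolding char_def by (rule integral_distr) auto
    also have "\<dots> = (LINT \<omega>|P. cis (t * g (V \<omega>)))" by (simp add: cis_conv_exp)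
    finally have 1: "char (distr P borel (\<lambda>\<omega>. g (V \<omega>))) t = (LINT \<omega>|P. cis (t * g (V \<omega>)))" .
    have int: "integrable P (\<lambda>\<omega>. cis (t * g (V \<omega>)))"
      by (rule P.integrable_const_bound[of _ 1]) auto
    show ?thesis unfolding 1 complex_eq_iff using integral_Re[OF int] integral_Im[OF int] by simp
  qed
  have "(\<lambda>j. LINT \<omega>|M j. cos (t * g (W j \<omega>))) \<longlonglongrightarrow> (LINT \<omega>|MZ. cos (t * g (Z \<omega>)))"
    by (rule Levy_continuity_tight[OF M meas char tight, where A = 1 and f = "\<lambda>x. cos (t * g x)"])
       (use gcont in \<open>auto intro!: continuous_intros\<close>)
  moreover have "(\<lambda>j. LINT \<omega>|M j. sin (t * g (W j \<omega>))) \<longlonglongrightarrow> (LINT \<omega>|MZ. sin (t * g (Z \<omega>)))"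
    by (rule Levy_continuity_tight[OF M meas char tight, where A = 1 and f = "\<lambda>x. sin (t * g x)"])
       (use gcont in \<open>auto intro!: continuous_intros\<close>)
  ultimately show "(\<lambda>j. char (distr (M j) borel (\<lambda>\<omega>. g (W j \<omega>))) t) \<longlonglongrightarrow> char (distr MZ borel (\<lambda>\<omega>. g (Z \<omega>))) t"
    unfolding ch[OF M(1) meas(1)] ch[OF M(2) meas(2)] by (rule tendsto_Complex)
qed

text \<open>For independent copies \<open>Z1\<close>, \<open>Z2\<close> of a centred normal vector, the rotated vector \<open>cos \<theta> Z1 + sin \<theta> Z2\<close>
has the characteristic function of \<open>Z\<close>, as \<open>(cos \<theta>)\<^sup>2 + (sin \<theta>)\<^sup>2 = 1\<close>.\<close>

lemma centered_normal_rotation: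
  fixes Z :: "'b \<Rightarrow> real ^ 'k" and g :: "real ^ 'k \<Rightarrow> real"
  assumes Z: "centered_normal_rv MZ Z S" and g: "continuous_on UNIV g"
  shows "distr (MZ \<Otimes>\<^sub>M MZ) borel (\<lambda>z. g (cos \<theta> *\<^sub>R Z (fst z) + sin \<theta> *\<^sub>R Z (snd z))) = distr MZ borel (\<lambda>\<omega>. g (Z \<omega>))"
proof -
  have P: "prob_space MZ" and m[measurable]: "Z \<in> borel_measurable MZ" using Z by (auto simp: centered_normal_rv_def)
  interpret prob_space MZ by fact
  interpret pair_prob_space MZ MZ ..
  define V where "V = (\<lambda>z. cos \<theta> *\<^sub>R Z (fst z) + sin \<theta> *\<^sub>R Z (snd z))"
  have V[measurable]: "V \<in> borel_measurable (MZ \<Otimes>\<^sub>M MZ)" unfolding V_def by measurable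
  have gm[measurable]: "g \<in> borel_measurable borel" using g by (rule borel_measurable_continuous_onI)
  have PP: "prob_space (MZ \<Otimes>\<^sub>M MZ)" by (rule prob_space_axioms)
  have char: "(LINT z|(MZ \<Otimes>\<^sub>M MZ). cis (a \<bullet> V z)) = (LINT \<omega>|MZ. cis (a \<bullet> Z \<omega>))" for a
  proof -
    have "(LINT z|(MZ \<Otimes>\<^sub>M MZ). cis (a \<bullet> V z))
        = (LINT z|(MZ \<Otimes>\<^sub>M MZ). cis ((cos \<theta> *\<^sub>R a) \<bullet> Z (fst z)) * cis ((sin \<theta> *\<^sub>R a) \<bullet> Z (snd z)))"
      by (simp add: V_def inner_add_right cis_mult)
    also have "\<dots> = (LINT \<omega>|MZ. cis ((cos \<theta> *\<^sub>R a) \<bullet> Z \<omega>)) * (LINT \<omega>|MZ. cis ((sin \<theta> *\<^sub>R a) \<bullet> Z \<omega>))"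
      by (rule measure_pair_integral_mult[OF P P]) auto
    also have "\<dots> = complex_of_real (exp (- ((cos \<theta>)\<^sup>2 * (a \<bullet> (S *v a))) / 2) * exp (- ((sin \<theta>)\<^sup>2 * (a \<bullet> (S *v a))) / 2))"
      unfolding char_centered_normal[OF Z] by (simp add: matrix_vector_mult_scaleR power2_eq_square mult_ac)
    also have "exp (- ((cos \<theta>)\<^sup>2 * (a \<bullet> (S *v a))) / 2) * exp (- ((sin \<theta>)\<^sup>2 * (a \<bullet> (S *v a))) / 2)
      = exp (- (((cos \<theta>)\<^sup>2 + (sin \<theta>)\<^sup>2) * (a \<bullet> (S *v a))) / 2)"
      unfolding exp_add[symmetric] by (simp only: distrib_right add_divide_distrib minus_add_distrib minus_divide_left)
    also have "\<dots> = exp (- (a \<bullet> (S *v a)) / 2)" by simp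
    finally show ?thesis by (simp add: char_centered_normal[OF Z])
  qed
  have "weak_conv_m (\<lambda>_. distr (MZ \<Otimes>\<^sub>M MZ) borel (\<lambda>z. g (V z))) (distr MZ borel (\<lambda>\<omega>. g (Z \<omega>)))"
    by (rule real_continuous_distr_tendsto[OF PP P V m _ _ g]) (use char prob_space_tight[OF PP V] in auto)
  then have "char (distr (MZ \<Otimes>\<^sub>M MZ) borel (\<lambda>z. g (V z))) t = char (distr MZ borel (\<lambda>\<omega>. g (Z \<omega>))) t" for t
    using levy_continuity1[of "\<lambda>_. distr (MZ \<Otimes>\<^sub>M MZ) borel (\<lambda>z. g (V z))" "distr MZ borel (\<lambda>\<omega>. g (Z \<omega>))" t]
      prob_space.real_distribution_distr[OF PP, of "\<lambda>z. g (V z)"] prob_space.real_distribution_distr[OF P, of "\<lambda>\<omega>. g (Z \<omega>)"]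
    by (simp add: LIMSEQ_const_iff)
  then have "distr (MZ \<Otimes>\<^sub>M MZ) borel (\<lambda>z. g (V z)) = distr MZ borel (\<lambda>\<omega>. g (Z \<omega>))"
    by (intro Levy_uniqueness prob_space.real_distribution_distr[OF PP] prob_space.real_distribution_distr[OF P] ext) auto
  then show ?thesis by (simp add: V_def)
qed

text \<open>Suppose that \<open>g Z\<close> almost surely avoids the interval from \<open>a\<close> to \<open>b\<close>. Then almost surely all rotations of
two independent copies by rational angles avoid it. The rotations form a continuous path from \<open>Z1\<close> to \<open>Z2\<close>, so
\<open>g\<close> cannot be below the gap at \<open>Z1\<close> and above it at \<open>Z2\<close>; yet by independence this happens with positive
probability. The argument also covers degenerate covariance matrices.\<close>

lemma centered_normal_connected_support:
  fixes Z :: "'b \<Rightarrow> real ^ 'k" and g :: "real ^ 'k \<Rightarrow> real"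
  assumes Z: "centered_normal_rv MZ Z S" and g: "continuous_on UNIV g"
    and ab: "a < b" and pos: "0 < measure MZ {\<omega> \<in> space MZ. g (Z \<omega>) \<le> a}" "0 < measure MZ {\<omega> \<in> space MZ. b \<le> g (Z \<omega>)}"
  shows "0 < measure MZ {\<omega> \<in> space MZ. a < g (Z \<omega>) \<and> g (Z \<omega>) < b}"
proof (rule ccontr)
  assume "\<not> ?thesis"
  then have null: "measure MZ {\<omega> \<in> space MZ. a < g (Z \<omega>) \<and> g (Z \<omega>) < b} = 0"
    using measure_nonneg[of MZ] by (simp add: order.order_iff_strict not_less)
  have P: "prob_space MZ" and m[measurable]: "Z \<in> borel_measurable MZ" using Z by (auto simp: centered_normal_rv_def)
  interpret M: prob_space MZ by fact
  interpret pair_prob_space MZ MZ ..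
  have gm[measurable]: "g \<in> borel_measurable borel" using g by (rule borel_measurable_continuous_onI)
  define V where "V = (\<lambda>\<theta> z. cos \<theta> *\<^sub>R Z (fst z) + sin \<theta> *\<^sub>R Z (snd z))"
  have V[measurable]: "V \<theta> \<in> borel_measurable (MZ \<Otimes>\<^sub>M MZ)" for \<theta> unfolding V_def by measurable
  have "AE z in MZ \<Otimes>\<^sub>M MZ. \<not> (a < g (V \<theta> z) \<and> g (V \<theta> z) < b)" for \<theta>
  proof -
    have "emeasure (distr MZ borel (\<lambda>\<omega>. g (Z \<omega>))) {a<..<b} = emeasure MZ {\<omega> \<in> space MZ. a < g (Z \<omega>) \<and> g (Z \<omega>) < b}"
      by (subst emeasure_distr) (auto intro!: arg_cong[where f = "emeasure MZ"])
    also have "\<dots> = 0" using null by (simp add: M.emeasure_eq_measure)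
    finally have "emeasure (distr (MZ \<Otimes>\<^sub>M MZ) borel (\<lambda>z. g (V \<theta> z))) {a<..<b} = 0"
      unfolding V_def centered_normal_rotation[OF Z g] .
    then have "emeasure (MZ \<Otimes>\<^sub>M MZ) ((\<lambda>z. g (V \<theta> z)) -` {a<..<b} \<inter> space (MZ \<Otimes>\<^sub>M MZ)) = 0"
      by (subst (asm) emeasure_distr) auto
    then show ?thesis
      by (intro AE_I[where N = "(\<lambda>z. g (V \<theta> z)) -` {a<..<b} \<inter> space (MZ \<Otimes>\<^sub>M MZ)"]) auto
  qed
  then have avoid: "AE z in MZ \<Otimes>\<^sub>M MZ. \<forall>\<theta>\<in>\<rat>. \<not> (a < g (V \<theta> z) \<and> g (V \<theta> z) < b)"
    by (subst AE_ball_countable) (auto simp: countable_rat)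
  have notboth: "\<not> (g (Z (fst z)) \<le> a \<and> b \<le> g (Z (snd z)))"
    if rat: "\<forall>\<theta>\<in>\<rat>. \<not> (a < g (V \<theta> z) \<and> g (V \<theta> z) < b)" for z
  proof
    assume z: "g (Z (fst z)) \<le> a \<and> b \<le> g (Z (snd z))"
    have cont: "continuous_on UNIV (\<lambda>\<theta>. g (V \<theta> z))"
      unfolding V_def by (intro continuous_on_compose2[OF g] continuous_intros) auto
    have "\<exists>\<theta>. 0 \<le> \<theta> \<and> \<theta> \<le> pi / 2 \<and> g (V \<theta> z) = (a + b) / 2"
      by (rule IVT') (use z ab in \<open>auto simp: V_def intro: continuous_on_subset[OF cont[unfolded V_def]]\<close>)
    then obtain \<theta> where \<theta>: "g (V \<theta> z) = (a + b) / 2" by blast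
    have "open ((\<lambda>\<theta>. g (V \<theta> z)) -` {a<..<b})" using cont by (intro open_vimage) auto
    moreover have "\<theta> \<in> (\<lambda>\<theta>. g (V \<theta> z)) -` {a<..<b}" using \<theta> ab by simp
    ultimately obtain e where e: "0 < e" "\<And>y. dist y \<theta> < e \<Longrightarrow> y \<in> (\<lambda>\<theta>. g (V \<theta> z)) -` {a<..<b}"
      unfolding open_dist by blast
    obtain y where "y \<in> \<rat>" "\<theta> < y" "y < \<theta> + e" using Rats_dense_in_real[of \<theta> "\<theta> + e"] e(1) by auto
    then show False using rat e(2)[of y] by (auto simp: dist_real_def)
  qed
  have AEnot: "AE z in MZ \<Otimes>\<^sub>M MZ. z \<notin> {\<omega> \<in> space MZ. g (Z \<omega>) \<le> a} \<times> {\<omega> \<in> space MZ. b \<le> g (Z \<omega>)}"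
    using avoid
  proof eventually_elim
    case (elim z)
    then show ?case using notboth[of z] by auto
  qed
  have "{z \<in> space (MZ \<Otimes>\<^sub>M MZ). z \<in> {\<omega> \<in> space MZ. g (Z \<omega>) \<le> a} \<times> {\<omega> \<in> space MZ. b \<le> g (Z \<omega>)}}
      = {\<omega> \<in> space MZ. g (Z \<omega>) \<le> a} \<times> {\<omega> \<in> space MZ. b \<le> g (Z \<omega>)}"
    by (auto simp: space_pair_measure)
  then have "emeasure (MZ \<Otimes>\<^sub>M MZ) ({\<omega> \<in> space MZ. g (Z \<omega>) \<le> a} \<times> {\<omega> \<in> space MZ. b \<le> g (Z \<omega>)}) = 0"
    using emeasure_eq_0_AE[OF AEnot] by simp
  then have "emeasure MZ {\<omega> \<in> space MZ. g (Z \<omega>) \<le> a} * emeasure MZ {\<omega> \<in> space MZ. b \<le> g (Z \<omega>)} = 0"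
    by (subst (asm) M.emeasure_pair_measure_Times) auto
  then show False using pos by (auto simp: M.emeasure_eq_measure ennreal_mult[symmetric])
qed

section \<open>Distance of the constrained maximum likelihood estimator\<close>

text \<open>With \<open>entropy_term_upper\<close>, a termwise comparison of relative entropy with the Hellinger distance from
below and with the chi-square distance from above. Both rest on \<open>ln u \<le> u - 1\<close>; the terms \<open>a - b\<close> cancel when summed
over probability vectors. For \<open>a = 0\<close> the default \<open>ln 0 = 0\<close> is multiplied by zero.\<close>

lemma entropy_term_lower:
  fixes a b :: real
  assumes "0 \<le> a" "0 \<le> b" "0 < a \<Longrightarrow> 0 < b"
  shows "a + (sqrt a - sqrt b)\<^sup>2 - b \<le> a * (ln a - ln b)"
proof (cases "a = 0")
  case True
  then show ?thesis using assms by simp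
next
  case False
  then have a: "0 < a" and b: "0 < b" using assms by auto
  have "ln (sqrt (b / a)) \<le> sqrt (b / a) - 1" using a b by (intro ln_le_minus_one) simp
  also have "ln (sqrt (b / a)) = (ln b - ln a) / 2" using a b by (simp add: ln_sqrt ln_div)
  finally have "ln a - ln b \<ge> 2 - 2 * sqrt (b / a)" by simp
  then have "a * (2 - 2 * sqrt (b / a)) \<le> a * (ln a - ln b)" using a by (intro mult_left_mono) auto
  moreover have "a * sqrt (b / a) = sqrt a * sqrt b"
  proof -
    have "a * sqrt (b / a) = (sqrt a * sqrt a) * (sqrt b / sqrt a)" using a by (simp add: real_sqrt_divide)
    also have "\<dots> = sqrt a * sqrt b" using a by (simp del: real_sqrt_mult_self)
    finally show ?thesis .
  qed
  moreover have "(sqrt a - sqrt b)\<^sup>2 = a + b - 2 * (sqrt a * sqrt b)" using a b by (simp add: power2_diff)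
  ultimately show ?thesis by (simp add: algebra_simps)
qed

lemma entropy_term_upper:
  fixes a b :: real
  assumes "0 \<le> a" "0 < b"
  shows "a * (ln a - ln b) \<le> a - b + (a - b)\<^sup>2 / b"
proof (cases "a = 0")
  case True
  then show ?thesis using assms by (simp add: power2_eq_square)
next
  case False
  then have a: "0 < a" using assms by simp
  have "ln (a / b) \<le> a / b - 1" using a assms by (intro ln_le_minus_one) simp
  then have "a * (ln a - ln b) \<le> a * (a / b - 1)" using a assms by (intro mult_left_mono) (auto simp: ln_div)
  also have "\<dots> = a - b + (a - b)\<^sup>2 / b" using assms by (simp add: field_simps power2_eq_square)
  finally show ?thesis .
qed

lemma diff_square_le_sqrt_diff:
  fixes a b :: real
  assumes "0 \<le> a" "a \<le> 1" "0 \<le> b" "b \<le> 1"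
  shows "(a - b)\<^sup>2 \<le> 4 * (sqrt a - sqrt b)\<^sup>2"
proof -
  have "a - b = (sqrt a - sqrt b) * (sqrt a + sqrt b)" using assms by (simp add: algebra_simps)
  then have "(a - b)\<^sup>2 = (sqrt a - sqrt b)\<^sup>2 * (sqrt a + sqrt b)\<^sup>2" by (simp add: power_mult_distrib)
  also have "\<dots> \<le> (sqrt a - sqrt b)\<^sup>2 * 2\<^sup>2"
  proof (intro mult_left_mono power_mono)
    have "sqrt a \<le> 1" "sqrt b \<le> 1" using assms by auto
    then show "sqrt a + sqrt b \<le> 2" by linarith
  qed (use assms in auto)
  finally show ?thesis by simp
qed

lemma prob_vec_le_1: "prob_vec r \<Longrightarrow> r $ i \<le> 1"
  using member_le_sum[of i UNIV "\<lambda>i. r $ i"] by (auto simp: prob_vec_def)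

definition rel_entropy :: "real ^ 'k \<Rightarrow> real ^ 'k \<Rightarrow> real" where
  "rel_entropy a b = (\<Sum>i\<in>UNIV. a $ i * (ln (a $ i) - ln (b $ i)))"

lemma power2_norm_vec: "(norm v)\<^sup>2 = (\<Sum>i\<in>UNIV. (v $ i)\<^sup>2)" for v :: "real ^ 'k"
  unfolding power2_norm_eq_inner inner_vec_def by (simp add: power2_eq_square)

text \<open>If \<open>b $ i = 0 < a $ i\<close> were possible, the relative entropy would be infinite, whereas the finite sum here would use
the default value \<open>ln 0 = 0\<close>; this is why absolute continuity is assumed.\<close>

lemma rel_entropy_lower:
  assumes a: "prob_vec a" and b: "prob_vec b" and ac: "\<And>i. 0 < a $ i \<Longrightarrow> 0 < b $ i"
  shows "(norm (a - b))\<^sup>2 / 4 \<le> rel_entropy a b"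
proof -
  have "(norm (a - b))\<^sup>2 = (\<Sum>i\<in>UNIV. (a $ i - b $ i)\<^sup>2)"
    by (simp add: power2_norm_vec)
  also have "\<dots> \<le> (\<Sum>i\<in>UNIV. 4 * (sqrt (a $ i) - sqrt (b $ i))\<^sup>2)"
    using a b by (intro sum_mono diff_square_le_sqrt_diff prob_vec_le_1) (auto simp: prob_vec_def)
  finally have 1: "(norm (a - b))\<^sup>2 / 4 \<le> (\<Sum>i\<in>UNIV. (sqrt (a $ i) - sqrt (b $ i))\<^sup>2)"
    by (simp add: sum_distrib_left[symmetric])
  have "(\<Sum>i\<in>UNIV. (sqrt (a $ i) - sqrt (b $ i))\<^sup>2) = (\<Sum>i\<in>UNIV. a $ i + (sqrt (a $ i) - sqrt (b $ i))\<^sup>2 - b $ i)"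
    using a b by (simp add: sum.distrib sum_subtractf prob_vec_def)
  also have "\<dots> \<le> rel_entropy a b"
    unfolding rel_entropy_def using a b ac by (intro sum_mono entropy_term_lower) (auto simp: prob_vec_def)
  finally show ?thesis using 1 by linarith
qed

lemma rel_entropy_upper:
  assumes a: "prob_vec a" and b: "prob_vec b" and \<mu>: "0 < \<mu>" "\<And>i. \<mu> \<le> b $ i"
  shows "rel_entropy a b \<le> (norm (a - b))\<^sup>2 / \<mu>"
proof -
  have "rel_entropy a b \<le> (\<Sum>i\<in>UNIV. a $ i - b $ i + (a $ i - b $ i)\<^sup>2 / \<mu>)"
    unfolding rel_entropy_def
  proof (intro sum_mono)
    fix i
    have "0 < b $ i" using \<mu> by (meson less_le_trans)
    then have "a $ i * (ln (a $ i) - ln (b $ i)) \<le> a $ i - b $ i + (a $ i - b $ i)\<^sup>2 / b $ i"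
      using a by (intro entropy_term_upper) (auto simp: prob_vec_def)
    also have "(a $ i - b $ i)\<^sup>2 / b $ i \<le> (a $ i - b $ i)\<^sup>2 / \<mu>"
      using \<mu> by (intro divide_left_mono) (auto intro: mult_pos_pos less_le_trans)
    finally show "a $ i * (ln (a $ i) - ln (b $ i)) \<le> a $ i - b $ i + (a $ i - b $ i)\<^sup>2 / \<mu>" by simp
  qed
  also have "\<dots> = (norm (a - b))\<^sup>2 / \<mu>"
    using a b by (simp add: sum.distrib sum_subtractf prob_vec_def power2_norm_vec sum_divide_distrib)
  finally show ?thesis .
qed

lemma prob_vec_mle:
  assumes "(\<Sum>i\<in>UNIV. x $ i) = m" "0 < m"
  shows "prob_vec (mle m x)"
  using assms by (auto simp: prob_vec_def mle_def sum_divide_distrib[symmetric] of_nat_sum[symmetric] simp del: of_nat_sum)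

lemma prod_power_eq_exp:
  fixes r :: "real ^ 'k" and x :: "nat ^ 'k"
  assumes "\<And>i. 0 < x $ i \<Longrightarrow> 0 < r $ i"
  shows "(\<Prod>i\<in>UNIV. (r $ i) ^ (x $ i)) = exp (\<Sum>i\<in>UNIV. real (x $ i) * ln (r $ i))"
proof -
  have "(r $ i) ^ (x $ i) = exp (real (x $ i) * ln (r $ i))" for i
    using assms[of i] by (cases "x $ i = 0") (auto simp: exp_of_nat_mult)
  then show ?thesis by (simp add: exp_sum)
qed

lemma rel_entropy_mle:
  fixes r :: "real ^ 'k"
  assumes "0 < m"
  shows "real m * rel_entropy (mle m x) r
    = real m * (\<Sum>i\<in>UNIV. mle m x $ i * ln (mle m x $ i)) - (\<Sum>i\<in>UNIV. real (x $ i) * ln (r $ i))"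
proof -
  have "real m * rel_entropy (mle m x) r
      = real m * (\<Sum>i\<in>UNIV. mle m x $ i * ln (mle m x $ i)) - real m * (\<Sum>i\<in>UNIV. mle m x $ i * ln (r $ i))"
    by (simp add: rel_entropy_def right_diff_distrib sum_subtractf)
  also have "real m * (\<Sum>i\<in>UNIV. mle m x $ i * ln (r $ i)) = (\<Sum>i\<in>UNIV. real (x $ i) * ln (r $ i))"
    using assms by (simp add: sum_distrib_left mle_def)
  finally show ?thesis .
qed

text \<open>The true pair satisfies the constraint, so the constrained maximizer has at least its likelihood, that is, at most
its relative entropy from the unconstrained estimators. Relative entropy is squeezed between two multiples of the
squared distance, and therefore the constrained estimator is as close to the unconstrained one as
the truth is, up to a constant.\<close>

lemma constrained_mle_close:
  fixes p q p' q' :: "real ^ 'k"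
  assumes mle: "is_constrained_mle N \<epsilon> x y (p', q')"
    and p: "prob_vec p" "\<And>i. \<mu> \<le> p $ i" and q: "prob_vec q" "\<And>i. \<mu> \<le> q $ i" and \<mu>: "0 < \<mu>"
    and eps: "N (p - q) = \<epsilon>"
    and x: "(\<Sum>i\<in>UNIV. x $ i) = m1" "0 < m1" and y: "(\<Sum>i\<in>UNIV. y $ i) = m2" "0 < m2"
  shows "m1 * (norm (mle m1 x - p'))\<^sup>2 + m2 * (norm (mle m2 y - q'))\<^sup>2
    \<le> 4 / \<mu> * (m1 * (norm (mle m1 x - p))\<^sup>2 + m2 * (norm (mle m2 y - q))\<^sup>2)"
proof -
  have p': "prob_vec p'" and q': "prob_vec q'"
    and max: "likelihood x y p q \<le> likelihood x y p' q'"
    using mle p q eps by (auto simp: is_constrained_mle_def is_arg_max_def not_less)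
  have pos: "0 < p $ i" "0 < q $ i" for i
    using less_le_trans[OF \<mu> p(2)[of i]] less_le_trans[OF \<mu> q(2)[of i]] by auto
  have coeff: "0 < multinomial_coeff z" for z :: "nat ^ 'k"
    by (simp add: multinomial_coeff_def prod_pos)
  have lik: "likelihood x y r s = (multinomial_coeff x * multinomial_coeff y) *
      ((\<Prod>i\<in>UNIV. (r $ i) ^ (x $ i)) * (\<Prod>i\<in>UNIV. (s $ i) ^ (y $ i)))" for r s
    by (simp add: likelihood_def prod.distrib)
  have "0 < likelihood x y p q" unfolding lik using pos coeff by (intro mult_pos_pos prod_pos) auto
  then have "likelihood x y p' q' \<noteq> 0" using max by linarith
  then have "(\<Prod>i\<in>UNIV. (p' $ i) ^ (x $ i)) \<noteq> 0" "(\<Prod>i\<in>UNIV. (q' $ i) ^ (y $ i)) \<noteq> 0"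
    unfolding lik by auto
  then have nz: "p' $ i \<noteq> 0 \<or> x $ i = 0" "q' $ i \<noteq> 0 \<or> y $ i = 0" for i
    by (auto simp: power_0_left)
  have posp: "0 < x $ i \<Longrightarrow> 0 < p' $ i" and posq: "0 < y $ i \<Longrightarrow> 0 < q' $ i" for i
  proof -
    have "0 \<le> p' $ i" "0 \<le> q' $ i" using p' q' by (auto simp: prob_vec_def)
    then show "0 < x $ i \<Longrightarrow> 0 < p' $ i" "0 < y $ i \<Longrightarrow> 0 < q' $ i" using nz[of i] by auto
  qed
  have "(\<Prod>i\<in>UNIV. (p $ i) ^ (x $ i)) * (\<Prod>i\<in>UNIV. (q $ i) ^ (y $ i))
      \<le> (\<Prod>i\<in>UNIV. (p' $ i) ^ (x $ i)) * (\<Prod>i\<in>UNIV. (q' $ i) ^ (y $ i))"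
    using max coeff unfolding lik by (simp add: mult_le_cancel_left_pos)
  then have ll: "(\<Sum>i\<in>UNIV. real (x $ i) * ln (p $ i)) + (\<Sum>i\<in>UNIV. real (y $ i) * ln (q $ i))
      \<le> (\<Sum>i\<in>UNIV. real (x $ i) * ln (p' $ i)) + (\<Sum>i\<in>UNIV. real (y $ i) * ln (q' $ i))"
    by (simp add: prod_power_eq_exp posp posq pos exp_add[symmetric])
  have "m1 * (norm (mle m1 x - p'))\<^sup>2 + m2 * (norm (mle m2 y - q'))\<^sup>2
      = 4 * (m1 * ((norm (mle m1 x - p'))\<^sup>2 / 4) + m2 * ((norm (mle m2 y - q'))\<^sup>2 / 4))" by simp
  also have "\<dots> \<le> 4 * (m1 * rel_entropy (mle m1 x) p' + m2 * rel_entropy (mle m2 y) q')"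
    using posp posq
    by (intro mult_left_mono add_mono rel_entropy_lower prob_vec_mle x y p' q') (auto simp: mle_def zero_less_divide_iff)
  also have "\<dots> \<le> 4 * (m1 * rel_entropy (mle m1 x) p + m2 * rel_entropy (mle m2 y) q)"
    unfolding rel_entropy_mle[OF x(2)] rel_entropy_mle[OF y(2)] using ll by simp
  also have "\<dots> \<le> 4 * (m1 * ((norm (mle m1 x - p))\<^sup>2 / \<mu>) + m2 * ((norm (mle m2 y - q))\<^sup>2 / \<mu>))"
    by (intro mult_left_mono add_mono rel_entropy_upper prob_vec_mle x y p q \<mu>) auto
  also have "\<dots> = 4 / \<mu> * (m1 * (norm (mle m1 x - p))\<^sup>2 + m2 * (norm (mle m2 y - q))\<^sup>2)"
    using \<mu> by (simp add: field_simps)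
  finally show ?thesis .
qed

section \<open>Quantiles of finitely supported laws\<close>

text \<open>The infimum in the definition of the quantile is meaningful only if the set is bounded below,
here by zero.\<close>

lemma quantile_pmf_le:
  assumes "set_pmf P \<subseteq> {0..}" "0 < \<alpha>" "\<alpha> \<le> measure_pmf.prob P {..y}"
  shows "quantile (measure_pmf P) \<alpha> \<le> y"
  unfolding quantile_def
proof (rule cInf_lower)
  show "y \<in> {x. \<alpha> \<le> cdf (measure_pmf P) x}" using assms by (simp add: cdf_def)
  show "bdd_below {x. \<alpha> \<le> cdf (measure_pmf P) x}"
  proof (rule bdd_belowI[of _ 0])
    fix x assume x: "x \<in> {x. \<alpha> \<le> cdf (measure_pmf P) x}"
    show "0 \<le> x"
    proof (rule ccontr)
      assume "\<not> 0 \<le> x"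
      then have "set_pmf P \<inter> {..x} = {}" using assms(1) by auto
      then have "measure_pmf.prob P {..x} = 0" by (simp add: measure_pmf_zero_iff)
      then show False using x assms(2) by (simp add: cdf_def)
    qed
  qed
qed

text \<open>For a finite support the set in the definition of the quantile is nonempty, since it contains the largest value.\<close>

lemma le_quantile_pmf:
  assumes "finite (set_pmf P)" "\<alpha> < 1" "measure_pmf.prob P {..y} < \<alpha>"
  shows "y \<le> quantile (measure_pmf P) \<alpha>"
  unfolding quantile_def
proof (rule cInf_greatest)
  have "set_pmf P \<subseteq> {..Max (set_pmf P)}" using assms(1) by auto
  then have "measure_pmf.prob P {..Max (set_pmf P)} = 1"
    by (subst measure_pmf.prob_eq_1) (auto simp: AE_measure_pmf_iff)
  then have "Max (set_pmf P) \<in> {x. \<alpha> \<le> cdf (measure_pmf P) x}" using assms(2) by (simp add: cdf_def)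
  then show "{x. \<alpha> \<le> cdf (measure_pmf P) x} \<noteq> {}" by blast
  fix x assume "x \<in> {x. \<alpha> \<le> cdf (measure_pmf P) x}"
  then have "measure_pmf.prob P {..y} < measure_pmf.prob P {..x}" using assms(3) by (simp add: cdf_def)
  then show "y \<le> x"
    using measure_pmf.finite_measure_mono[of "{..x}" "{..y}" P] by (cases "y \<le> x") auto
qed

lemma prob_le_add:
  assumes "\<And>z. z \<in> set_pmf P \<Longrightarrow> Q z \<Longrightarrow> R z \<or> S z"
  shows "measure_pmf.prob P {z. Q z} \<le> measure_pmf.prob P {z. R z} + measure_pmf.prob P {z. S z}"
proof -
  have "measure_pmf.prob P {z. Q z} = measure_pmf.prob P ({z. Q z} \<inter> set_pmf P)" by (simp add: measure_Int_set_pmf)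
  also have "\<dots> \<le> measure_pmf.prob P ({z. R z} \<union> {z. S z})"
    using assms by (intro measure_pmf.finite_measure_mono) auto
  also have "\<dots> \<le> measure_pmf.prob P {z. R z} + measure_pmf.prob P {z. S z}"
    by (intro measure_Un_le) auto
  finally show ?thesis .
qed

section \<open>Uniform limit laws near the true parameters\<close>

locale two_sample_setting =
  fixes p q :: "real ^ 'k" and N d' :: "real ^ 'k \<Rightarrow> real" and n1 n2 :: "nat \<Rightarrow> nat" and c :: real
  assumes p: "prob_vec p" and q: "prob_vec q" and N: "is_norm N"
    and deriv: "has_dir_hadamard_derivative N d' (p - q)" and sub: "sublinear d'"
    and n_lim: "filterlim n1 at_top sequentially" "filterlim n2 at_top sequentially"
    and ratio: "(\<lambda>j. real (n2 j) / real (n1 j)) \<longlonglongrightarrow> c" "0 < c"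
begin

text \<open>In the following, \<open>p'\<close> and \<open>q'\<close> are the parameters from which a pair of samples is drawn. They are \<open>p\<close> and \<open>q\<close>
for the data and the estimated parameters for the bootstrap.\<close>

definition rate :: "nat \<Rightarrow> real" where
  "rate j = sqrt (real (n1 j) + real (n2 j))"

definition sample :: "nat \<Rightarrow> real ^ 'k \<Rightarrow> real ^ 'k \<Rightarrow> ((nat ^ 'k) \<times> (nat ^ 'k)) pmf" where
  "sample j = two_sample_pmf (n1 j) (n2 j)"

definition err :: "nat \<Rightarrow> real ^ 'k \<Rightarrow> real ^ 'k \<Rightarrow> (nat ^ 'k) \<times> (nat ^ 'k) \<Rightarrow> real ^ 'k" where
  "err j = scaled_error (n1 j) (n2 j)"

definition near :: "nat \<Rightarrow> real \<Rightarrow> real ^ 'k \<Rightarrow> real ^ 'k \<Rightarrow> bool" where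
  "near j K p' q' \<longleftrightarrow> prob_vec p' \<and> prob_vec q' \<and> rate j * norm (p' - p) \<le> K \<and> rate j * norm (q' - q) \<le> K"

definition mle_errors_le :: "nat \<Rightarrow> real \<Rightarrow> real ^ 'k \<Rightarrow> real ^ 'k \<Rightarrow> (nat ^ 'k) \<times> (nat ^ 'k) \<Rightarrow> bool" where
  "mle_errors_le j K p' q' z \<longleftrightarrow> rate j * norm (mle (n1 j) (fst z) - p') \<le> K \<and> rate j * norm (mle (n2 j) (snd z) - q') \<le> K"

definition stat :: "nat \<Rightarrow> (nat ^ 'k) \<times> (nat ^ 'k) \<Rightarrow> real" where
  "stat j z = N (mle (n1 j) (fst z) - mle (n2 j) (snd z))"

definition stat_law :: "nat \<Rightarrow> real ^ 'k \<Rightarrow> real ^ 'k \<Rightarrow> real pmf" where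
  "stat_law j p' q' = map_pmf (stat j) (sample j p' q')"

lemma eventually_n_pos: "\<forall>\<^sub>F j in sequentially. 0 < n1 j \<and> 0 < n2 j"
proof -
  have "\<forall>\<^sub>F j in sequentially. 1 \<le> n1 j" "\<forall>\<^sub>F j in sequentially. 1 \<le> n2 j"
    using n_lim unfolding filterlim_at_top by blast+
  then show ?thesis by eventually_elim auto
qed

lemma rate_nonneg: "0 \<le> rate j" by (simp add: rate_def)

lemma rate_lim: "filterlim rate at_top sequentially"
  unfolding rate_def
proof (rule filterlim_compose[OF sqrt_at_top])
  have "filterlim (\<lambda>j. real (n1 j)) at_top sequentially" "filterlim (\<lambda>j. real (n2 j)) at_top sequentially"
    using n_lim by (auto intro: filterlim_compose[OF filterlim_real_sequentially])
  then show "filterlim (\<lambda>j. real (n1 j) + real (n2 j)) at_top sequentially"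
    by (rule filterlim_at_top_add_at_top)
qed

lemma eventually_rate_gt: "\<forall>\<^sub>F j in sequentially. a < rate j"
  using rate_lim unfolding filterlim_at_top_dense by blast

lemma inverse_rate_lim: "(\<lambda>j. C / rate j) \<longlonglongrightarrow> 0"
  by (rule tendsto_divide_0[OF tendsto_const filterlim_at_top_imp_at_infinity[OF rate_lim]])

lemma rate_sq_lim:
  "(\<lambda>j. (rate j)\<^sup>2 / n1 j) \<longlonglongrightarrow> 1 + c" "(\<lambda>j. (rate j)\<^sup>2 / n2 j) \<longlonglongrightarrow> 1 + inverse c"
proof -
  have r: "(rate j)\<^sup>2 = real (n1 j) + real (n2 j)" for j by (simp add: rate_def)
  have "(\<lambda>j. 1 + real (n2 j) / real (n1 j)) \<longlonglongrightarrow> 1 + c" by (intro tendsto_intros ratio)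
  moreover have "\<forall>\<^sub>F j in sequentially. 1 + real (n2 j) / real (n1 j) = (rate j)\<^sup>2 / n1 j"
    using eventually_n_pos by eventually_elim (simp add: r add_divide_distrib)
  ultimately show "(\<lambda>j. (rate j)\<^sup>2 / n1 j) \<longlonglongrightarrow> 1 + c" by (rule Lim_transform_eventually)
  have "(\<lambda>j. 1 + inverse (real (n2 j) / real (n1 j))) \<longlonglongrightarrow> 1 + inverse c"
    using ratio by (intro tendsto_intros) auto
  moreover have "\<forall>\<^sub>F j in sequentially. 1 + inverse (real (n2 j) / real (n1 j)) = (rate j)\<^sup>2 / n2 j"
    using eventually_n_pos by eventually_elim (simp add: r add_divide_distrib)
  ultimately show "(\<lambda>j. (rate j)\<^sup>2 / n2 j) \<longlonglongrightarrow> 1 + inverse c" by (rule Lim_transform_eventually)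
qed

lemma rate_sq_bound:
  obtains B :: real where "0 < B"
    "\<forall>\<^sub>F j in sequentially. 0 < n1 j \<and> 0 < n2 j \<and> (rate j)\<^sup>2 \<le> B * n1 j \<and> (rate j)\<^sup>2 \<le> B * n2 j"
proof (rule that[of "2 + c + inverse c"])
  let ?B = "2 + c + inverse c"
  show "0 < ?B" using ratio by (simp add: add_pos_pos)
  have "\<forall>\<^sub>F j in sequentially. (rate j)\<^sup>2 / n1 j < ?B" "\<forall>\<^sub>F j in sequentially. (rate j)\<^sup>2 / n2 j < ?B"
    using ratio by (auto intro!: order_tendstoD(2)[OF rate_sq_lim(1)] order_tendstoD(2)[OF rate_sq_lim(2)] add_pos_pos)
  with eventually_n_pos
  show "\<forall>\<^sub>F j in sequentially. 0 < n1 j \<and> 0 < n2 j \<and> (rate j)\<^sup>2 \<le> ?B * n1 j \<and> (rate j)\<^sup>2 \<le> ?B * n2 j"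
    by eventually_elim (auto simp: pos_divide_less_eq)
qed

lemma mle_tail:
  assumes r: "prob_vec r" and m: "0 < m" and B: "\<rho>\<^sup>2 \<le> B * m" and K: "0 < K" and \<rho>: "0 \<le> \<rho>"
  shows "measure_pmf.prob (multinomial_pmf m r) {x. K < \<rho> * norm (mle m x - r)} \<le> B / K\<^sup>2"
proof -
  let ?P = "measure_pmf (multinomial_pmf m r)"
  have "measure ?P {x. K < \<rho> * norm (mle m x - r)} \<le> measure ?P {x \<in> space ?P. K\<^sup>2 \<le> \<rho>\<^sup>2 * (norm (mle m x - r))\<^sup>2}"
  proof (intro measure_pmf.finite_measure_mono subsetI CollectI conjI)
    fix x assume "x \<in> {x. K < \<rho> * norm (mle m x - r)}"
    then have "K\<^sup>2 \<le> (\<rho> * norm (mle m x - r))\<^sup>2" using K by (intro power_mono) auto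
    then show "K\<^sup>2 \<le> \<rho>\<^sup>2 * (norm (mle m x - r))\<^sup>2" by (simp add: power_mult_distrib)
  qed auto
  also have "\<dots> \<le> (LINT x|?P. \<rho>\<^sup>2 * (norm (mle m x - r))\<^sup>2) / K\<^sup>2"
    using K by (intro integral_Markov_inequality_measure[where A = UNIV] integrable_multinomial_pmf r) auto
  also have "(LINT x|?P. \<rho>\<^sup>2 * (norm (mle m x - r))\<^sup>2) \<le> \<rho>\<^sup>2 * (1 / m)"
    using mult_left_mono[OF expectation_mle_error[OF r m], of "\<rho>\<^sup>2"] by simp
  also have "\<rho>\<^sup>2 * (1 / m) \<le> B" using B m by (simp add: pos_divide_le_eq)
  finally show ?thesis using K by (simp add: divide_right_mono)
qed

text \<open>By Chebyshev's inequality, with one bound for all parameters at once.\<close>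

lemma mle_errors_tail:
  assumes e: "0 < e"
  obtains K where "0 < K"
    "\<forall>\<^sub>F j in sequentially. \<forall>p' q'. prob_vec p' \<longrightarrow> prob_vec q' \<longrightarrow>
        measure_pmf.prob (sample j p' q') {z. \<not> mle_errors_le j K p' q' z} \<le> e"
proof -
  obtain B :: real where B: "0 < B" "\<forall>\<^sub>F j in sequentially. 0 < n1 j \<and> 0 < n2 j \<and> (rate j)\<^sup>2 \<le> B * n1 j \<and> (rate j)\<^sup>2 \<le> B * n2 j"
    by (rule rate_sq_bound)
  \<comment> \<open>Each of the two samples contributes \<open>B / K\<^sup>2 = e / 2\<close>.\<close>
  define K where "K = sqrt (2 * B / e)"
  have K: "0 < K" using B e by (simp add: K_def)
  have K2: "B / K\<^sup>2 = e / 2" using B e by (simp add: K_def)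
  show ?thesis
  proof (rule that[OF K])
    show "\<forall>\<^sub>F j in sequentially. \<forall>p' q'. prob_vec p' \<longrightarrow> prob_vec q' \<longrightarrow>
        measure_pmf.prob (sample j p' q') {z. \<not> mle_errors_le j K p' q' z} \<le> e"
      using B(2)
    proof eventually_elim
      case (elim j)
      show ?case
      proof (intro allI impI)
        fix p' q' :: "real ^ 'k" assume pq: "prob_vec p'" "prob_vec q'"
        let ?A = "multinomial_pmf (n1 j) p'" and ?B = "multinomial_pmf (n2 j) q'"
        have "measure_pmf.prob (sample j p' q') {z. \<not> mle_errors_le j K p' q' z}
            \<le> measure_pmf.prob (sample j p' q') {z. K < rate j * norm (mle (n1 j) (fst z) - p')}
             + measure_pmf.prob (sample j p' q') {z. K < rate j * norm (mle (n2 j) (snd z) - q')}"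
          by (rule prob_le_add) (auto simp: mle_errors_le_def)
        also have "measure_pmf.prob (sample j p' q') {z. K < rate j * norm (mle (n1 j) (fst z) - p')}
            = measure_pmf.prob (map_pmf fst (sample j p' q')) {x. K < rate j * norm (mle (n1 j) x - p')}"
          by (simp add: vimage_def)
        also have "map_pmf fst (sample j p' q') = ?A" by (simp add: sample_def two_sample_pmf_def map_fst_pair_pmf)
        also have "measure_pmf.prob (sample j p' q') {z. K < rate j * norm (mle (n2 j) (snd z) - q')}
            = measure_pmf.prob (map_pmf snd (sample j p' q')) {x. K < rate j * norm (mle (n2 j) x - q')}"
          by (simp add: vimage_def)
        also have "map_pmf snd (sample j p' q') = ?B" by (simp add: sample_def two_sample_pmf_def map_snd_pair_pmf)
        also have "measure_pmf.prob ?A {x. K < rate j * norm (mle (n1 j) x - p')} \<le> B / K\<^sup>2"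
          using elim by (intro mle_tail pq K rate_nonneg) auto
        also have "measure_pmf.prob ?B {x. K < rate j * norm (mle (n2 j) x - q')} \<le> B / K\<^sup>2"
          using elim by (intro mle_tail pq K rate_nonneg) auto
        finally show "measure_pmf.prob (sample j p' q') {z. \<not> mle_errors_le j K p' q' z} \<le> e"
          unfolding K2 by simp
      qed
    qed
  qed
qed

lemma norm_err_le:
  assumes "mle_errors_le j K p' q' z" shows "norm (err j p' q' z) \<le> 2 * K"
proof -
  have "err j p' q' z = rate j *\<^sub>R (mle (n1 j) (fst z) - p') - rate j *\<^sub>R (mle (n2 j) (snd z) - q')"
    by (simp add: err_def scaled_error_def rate_def case_prod_unfold algebra_simps)
  also have "norm \<dots> \<le> norm (rate j *\<^sub>R (mle (n1 j) (fst z) - p')) + norm (rate j *\<^sub>R (mle (n2 j) (snd z) - q'))"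
    by (rule norm_triangle_ineq4)
  also have "\<dots> \<le> K + K"
    using assms rate_nonneg[of j] by (intro add_mono) (auto simp: mle_errors_le_def)
  finally show ?thesis by simp
qed

lemma near_tendsto:
  assumes "\<And>j. near j K (r j) (s j)"
  shows "r \<longlonglongrightarrow> p" "s \<longlonglongrightarrow> q"
proof -
  have "\<forall>\<^sub>F j in sequentially. norm (r j - p) \<le> K / rate j" "\<forall>\<^sub>F j in sequentially. norm (s j - q) \<le> K / rate j"
    using eventually_rate_gt[of 0] assms
    by (auto elim!: eventually_mono simp: near_def pos_le_divide_eq mult.commute)
  then have "(\<lambda>j. r j - p) \<longlonglongrightarrow> 0" "(\<lambda>j. s j - q) \<longlonglongrightarrow> 0"
    by (auto intro: Lim_null_comparison inverse_rate_lim)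
  then show "r \<longlonglongrightarrow> p" "s \<longlonglongrightarrow> q" by (auto simp: LIM_zero_iff)
qed

text \<open>A property that holds eventually along every sequence of near parameters holds eventually for
all of them simultaneously: otherwise choose a violating pair wherever there is one, and the true pair elsewhere.\<close>

lemma eventually_all_near:
  assumes K: "0 \<le> K"
    and seq: "\<And>r s. (\<And>j. near j K (r j) (s j)) \<Longrightarrow> \<forall>\<^sub>F j in sequentially. Q j (r j) (s j)"
  shows "\<forall>\<^sub>F j in sequentially. \<forall>p' q'. near j K p' q' \<longrightarrow> Q j p' q'"
proof -
  \<comment> \<open>A sequence of counterexamples, completed by the true parameters where there is none.\<close>
  define w where "w = (\<lambda>j. if \<exists>p' q'. near j K p' q' \<and> \<not> Q j p' q'
      then SOME w. near j K (fst w) (snd w) \<and> \<not> Q j (fst w) (snd w) else (p, q))"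
  have base: "near j K p q" for j using K p q by (simp add: near_def)
  have bad: "near j K (fst (w j)) (snd (w j)) \<and> \<not> Q j (fst (w j)) (snd (w j))"
    if "\<exists>p' q'. near j K p' q' \<and> \<not> Q j p' q'" for j
  proof -
    have "\<exists>w. near j K (fst w) (snd w) \<and> \<not> Q j (fst w) (snd w)" using that by auto
    from someI_ex[OF this] show ?thesis using that by (simp add: w_def)
  qed
  have "near j K (fst (w j)) (snd (w j))" for j
    using bad[of j] base[of j] by (cases "\<exists>p' q'. near j K p' q' \<and> \<not> Q j p' q'") (auto simp: w_def)
  from seq[OF this] show ?thesis by eventually_elim (use bad in blast)
qed

lemma char_err_tendsto:
  assumes near: "\<And>j. near j K (r j) (s j)" and Z: "centered_normal_rv MZ Z (limit_cov c p q)"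
  shows "(\<lambda>j. LINT z|sample j (r j) (s j). cis (a \<bullet> err j (r j) (s j) z)) \<longlonglongrightarrow> (LINT \<omega>|MZ. cis (a \<bullet> Z \<omega>))"
proof -
  have rs: "prob_vec (r j)" "prob_vec (s j)" for j using near by (auto simp: near_def)
  define u where "u = (\<lambda>j. rate j / n1 j)"
  define v where "v = (\<lambda>j. - (rate j / n2 j))"
  have "\<forall>\<^sub>F j in sequentially. (rate j)\<^sup>2 / n1 j = n1 j * (u j)\<^sup>2"
    using eventually_n_pos by eventually_elim (simp add: u_def power2_eq_square)
  then have u: "(\<lambda>j. n1 j * (u j)\<^sup>2) \<longlonglongrightarrow> 1 + c" by (rule Lim_transform_eventually[OF rate_sq_lim(1)])
  have "\<forall>\<^sub>F j in sequentially. (rate j)\<^sup>2 / n2 j = n2 j * (v j)\<^sup>2"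
    using eventually_n_pos by eventually_elim (simp add: v_def power2_eq_square)
  then have v: "(\<lambda>j. n2 j * (v j)\<^sup>2) \<longlonglongrightarrow> 1 + inverse c" by (rule Lim_transform_eventually[OF rate_sq_lim(2)])
  define F where "F = (\<lambda>j. measure_pmf.expectation (multinomial_pmf (n1 j) (r j)) (\<lambda>x. cis ((u j *\<^sub>R a) \<bullet> centered_count (n1 j) (r j) x)) *
      measure_pmf.expectation (multinomial_pmf (n2 j) (s j)) (\<lambda>x. cis ((v j *\<^sub>R a) \<bullet> centered_count (n2 j) (s j) x)))"
  have "F \<longlonglongrightarrow> complex_of_real (exp (- ((1 + c) * class_var p a / 2))) * complex_of_real (exp (- ((1 + inverse c) * class_var q a / 2)))"
    unfolding F_def
    by (intro tendsto_mult char_multinomial_tendsto rs near_tendsto[OF near] n_lim u v)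
  also have "complex_of_real (exp (- ((1 + c) * class_var p a / 2))) * complex_of_real (exp (- ((1 + inverse c) * class_var q a / 2)))
      = complex_of_real (exp (- (a \<bullet> (limit_cov c p q *v a)) / 2))"
    unfolding inner_limit_cov[OF p q] of_real_mult[symmetric] exp_add[symmetric]
    by (simp only: add_divide_distrib minus_add_distrib minus_divide_left)
  finally have "F \<longlonglongrightarrow> (LINT \<omega>|MZ. cis (a \<bullet> Z \<omega>))" by (simp only: char_centered_normal[OF Z])
  moreover have "\<forall>\<^sub>F j in sequentially. F j = (LINT z|sample j (r j) (s j). cis (a \<bullet> err j (r j) (s j) z))"
    using eventually_n_pos
    by eventually_elim (simp only: F_def sample_def err_def char_scaled_error[OF rs] u_def v_def rate_def)
  ultimately show ?thesis by (rule Lim_transform_eventually)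
qed

lemma deriv_cont: "continuous_on UNIV d'"
  using deriv by (simp add: has_dir_hadamard_derivative_def)

lemma clt_seq:
  assumes near: "\<And>j. near j K (r j) (s j)" and Z: "centered_normal_rv MZ Z (limit_cov c p q)"
  shows "weak_conv_m (\<lambda>j. distr (measure_pmf (sample j (r j) (s j))) borel (\<lambda>z. d' (err j (r j) (s j) z)))
     (distr MZ borel (\<lambda>\<omega>. d' (Z \<omega>)))"
proof (rule real_continuous_distr_tendsto[OF _ _ _ _ char_err_tendsto[OF near Z] _ deriv_cont])
  show "prob_space MZ" "Z \<in> borel_measurable MZ" using Z by (auto simp: centered_normal_rv_def)
  show "\<exists>K. \<forall>\<^sub>F j in sequentially. measure (measure_pmf (sample j (r j) (s j)))
      {z \<in> space (measure_pmf (sample j (r j) (s j))). K < norm (err j (r j) (s j) z)} \<le> e"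
    if e: "0 < e" for e :: real
  proof -
    obtain K where K: "\<forall>\<^sub>F j in sequentially. \<forall>p' q'. prob_vec p' \<longrightarrow> prob_vec q' \<longrightarrow>
        measure_pmf.prob (sample j p' q') {z. \<not> mle_errors_le j K p' q' z} \<le> e" by (rule mle_errors_tail[OF e])
    show ?thesis
    proof (intro exI[of _ "2 * K"])
      show "\<forall>\<^sub>F j in sequentially. measure (measure_pmf (sample j (r j) (s j)))
        {z \<in> space (measure_pmf (sample j (r j) (s j))). 2 * K < norm (err j (r j) (s j) z)} \<le> e"
        using K
      proof eventually_elim
        case (elim j)
        have "measure (measure_pmf (sample j (r j) (s j)))
            {z \<in> space (measure_pmf (sample j (r j) (s j))). 2 * K < norm (err j (r j) (s j) z)}
            \<le> measure_pmf.prob (sample j (r j) (s j)) {z. \<not> mle_errors_le j K (r j) (s j) z}"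
          using norm_err_le by (intro measure_pmf.finite_measure_mono) (auto simp: not_le[symmetric])
        also have "\<dots> \<le> e" using elim near by (simp add: near_def)
        finally show ?case .
      qed
    qed
  qed
qed (auto simp: prob_space_measure_pmf)

lemma clt_uniform:
  assumes Z: "centered_normal_rv MZ Z (limit_cov c p q)" and K: "0 \<le> K" and e: "0 < e"
    and cont: "isCont (cdf (distr MZ borel (\<lambda>\<omega>. d' (Z \<omega>)))) x"
  shows "\<forall>\<^sub>F j in sequentially. \<forall>p' q'. near j K p' q' \<longrightarrow>
    \<bar>measure_pmf.prob (sample j p' q') {z. d' (err j p' q' z) \<le> x} - cdf (distr MZ borel (\<lambda>\<omega>. d' (Z \<omega>))) x\<bar> < e"
proof (rule eventually_all_near[OF K])
  fix r s assume near: "\<And>j. near j K (r j) (s j)"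
  have "(\<lambda>j. cdf (distr (measure_pmf (sample j (r j) (s j))) borel (\<lambda>z. d' (err j (r j) (s j) z))) x)
      \<longlonglongrightarrow> cdf (distr MZ borel (\<lambda>\<omega>. d' (Z \<omega>))) x"
    using clt_seq[OF near Z] cont by (simp add: weak_conv_m_def weak_conv_def)
  moreover have "cdf (distr (measure_pmf (sample j (r j) (s j))) borel (\<lambda>z. d' (err j (r j) (s j) z))) x
      = measure_pmf.prob (sample j (r j) (s j)) {z. d' (err j (r j) (s j) z) \<le> x}" for j
    unfolding cdf_def by (subst measure_distr) (auto simp: vimage_def)
  ultimately have "(\<lambda>j. measure_pmf.prob (sample j (r j) (s j)) {z. d' (err j (r j) (s j) z) \<le> x})
      \<longlonglongrightarrow> cdf (distr MZ borel (\<lambda>\<omega>. d' (Z \<omega>))) x" by simp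
  from tendstoD[OF this e]
  show "\<forall>\<^sub>F j in sequentially. \<bar>measure_pmf.prob (sample j (r j) (s j)) {z. d' (err j (r j) (s j) z) \<le> x}
      - cdf (distr MZ borel (\<lambda>\<omega>. d' (Z \<omega>))) x\<bar> < e" by (simp add: dist_real_def)
qed

lemma stat_eq:
  assumes "0 < rate j"
  shows "stat j z = N ((p - q) + (1 / rate j) *\<^sub>R (err j p' q' z + rate j *\<^sub>R ((p' - q') - (p - q))))"
proof -
  have "(1 / rate j) *\<^sub>R err j p' q' z = (mle (n1 j) (fst z) - mle (n2 j) (snd z)) - (p' - q')"
    using assms by (simp add: err_def scaled_error_def rate_def case_prod_unfold)
  then show ?thesis using assms by (simp add: stat_def scaleR_add_right)
qed

lemma shift_bound:
  assumes "near j K p' q'" shows "norm (rate j *\<^sub>R ((p' - q') - (p - q))) \<le> 2 * K"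
proof -
  have "rate j *\<^sub>R ((p' - q') - (p - q)) = rate j *\<^sub>R (p' - p) - rate j *\<^sub>R (q' - q)"
    by (simp add: algebra_simps)
  also have "norm \<dots> \<le> norm (rate j *\<^sub>R (p' - p)) + norm (rate j *\<^sub>R (q' - q))" by (rule norm_triangle_ineq4)
  also have "\<dots> \<le> K + K" using assms rate_nonneg[of j] by (intro add_mono) (auto simp: near_def)
  finally show ?thesis by simp
qed

lemma N_shift:
  assumes "0 < rate j"
  shows "N (p' - q') = N ((p - q) + (1 / rate j) *\<^sub>R (rate j *\<^sub>R ((p' - q') - (p - q))))"
  using assms by simp

text \<open>Both \<open>mle x - mle y\<close> and \<open>p' - q'\<close> are expanded around \<open>p - q\<close>, with the increments \<open>w + h\<close> and \<open>h\<close> where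
\<open>w\<close> is the scaled error. The derivative bounds the first increment of the norm from above up to \<open>\<delta>\<close> and the second
one from below exactly, and \<open>d' (w + h) - d' h \<le> d' w\<close> by subadditivity. This inequality is the reason why the test
is conservative at points where the norm has a corner.\<close>

lemma stat_upper:
  assumes \<delta>: "0 < \<delta>"
  shows "\<forall>\<^sub>F j in sequentially. \<forall>p' q' z. near j K p' q' \<longrightarrow> mle_errors_le j L p' q' z \<longrightarrow>
    stat j z \<le> N (p' - q') + (d' (err j p' q' z) + \<delta>) / rate j"
proof -
  obtain t0 where t0: "0 < t0" "\<And>t h. 0 < t \<Longrightarrow> t \<le> t0 \<Longrightarrow> norm h \<le> 2 * L + 2 * K \<Longrightarrow>
      N ((p - q) + t *\<^sub>R h) \<le> N (p - q) + t * (d' h + \<delta>)"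
    using dir_hadamard_norm_upper[OF deriv N \<delta>, of "2 * L + 2 * K"] by blast
  have "\<forall>\<^sub>F j in sequentially. 1 / rate j < t0" by (rule order_tendstoD(2)[OF inverse_rate_lim t0(1)])
  then show ?thesis using eventually_rate_gt[of 0]
  proof eventually_elim
    case (elim j)
    show ?case
    proof (intro allI impI)
      fix p' q' z assume near: "near j K p' q'" and good: "mle_errors_le j L p' q' z"
      define h where "h = rate j *\<^sub>R ((p' - q') - (p - q))"
      define w where "w = err j p' q' z"
      define t where "t = 1 / rate j"
      have t: "0 < t" "t \<le> t0" using elim by (auto simp: t_def)
      have "norm (w + h) \<le> 2 * L + 2 * K"
        using norm_triangle_ineq[of w h] norm_err_le[OF good] shift_bound[OF near] by (simp add: w_def h_def)
      then have "stat j z \<le> N (p - q) + t * (d' (w + h) + \<delta>)"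
        unfolding stat_eq[OF elim(2), of z p' q'] w_def[symmetric] h_def[symmetric] t_def[symmetric]
        by (rule t0(2)[OF t])
      also have "\<dots> \<le> N (p - q) + t * (d' w + d' h + \<delta>)"
        using t sub by (intro add_left_mono mult_left_mono add_right_mono) (auto simp: sublinear_def)
      also have "\<dots> = (N (p - q) + t * d' h) + t * (d' w + \<delta>)" by (simp add: algebra_simps)
      also have "N (p - q) + t * d' h \<le> N (p' - q')"
        unfolding N_shift[OF elim(2), of p' q'] h_def[symmetric] t_def[symmetric]
        by (rule dir_hadamard_norm_lower[OF deriv N t(1)])
      finally show "stat j z \<le> N (p' - q') + (d' (err j p' q' z) + \<delta>) / rate j"
        by (simp add: t_def w_def)
    qed
  qed
qed

text \<open>The reverse of \<open>stat_upper\<close>. It needs \<open>d' (w + h) - d' h = d' w\<close>, hence linearity.\<close>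

lemma stat_lower_linear:
  assumes \<delta>: "0 < \<delta>" and lin: "linear d'"
  shows "\<forall>\<^sub>F j in sequentially. \<forall>p' q' z. near j K p' q' \<longrightarrow>
    N (p' - q') + (d' (err j p' q' z) - \<delta>) / rate j \<le> stat j z"
proof -
  obtain t0 where t0: "0 < t0" "\<And>t h. 0 < t \<Longrightarrow> t \<le> t0 \<Longrightarrow> norm h \<le> 2 * K \<Longrightarrow>
      N ((p - q) + t *\<^sub>R h) \<le> N (p - q) + t * (d' h + \<delta>)"
    using dir_hadamard_norm_upper[OF deriv N \<delta>, of "2 * K"] by blast
  have "\<forall>\<^sub>F j in sequentially. 1 / rate j < t0" by (rule order_tendstoD(2)[OF inverse_rate_lim t0(1)])
  then show ?thesis using eventually_rate_gt[of 0]
  proof eventually_elim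
    case (elim j)
    show ?case
    proof (intro allI impI)
      fix p' q' z assume near: "near j K p' q'"
      define h where "h = rate j *\<^sub>R ((p' - q') - (p - q))"
      define w where "w = err j p' q' z"
      define t where "t = 1 / rate j"
      have t: "0 < t" "t \<le> t0" using elim by (auto simp: t_def)
      have "N (p' - q') \<le> N (p - q) + t * (d' h + \<delta>)"
        unfolding N_shift[OF elim(2), of p' q'] h_def[symmetric] t_def[symmetric]
        using shift_bound[OF near] by (intro t0(2)[OF t]) (simp add: h_def)
      then have "N (p' - q') + t * (d' w - \<delta>) \<le> N (p - q) + t * (d' w + d' h)"
        by (simp add: algebra_simps)
      also have "d' w + d' h = d' (w + h)" using lin by (simp add: linear_add)
      also have "N (p - q) + t * d' (w + h) \<le> stat j z"
        unfolding stat_eq[OF elim(2), of z p' q'] w_def[symmetric] h_def[symmetric] t_def[symmetric]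
        by (rule dir_hadamard_norm_lower[OF deriv N t(1)])
      finally show "N (p' - q') + (d' (err j p' q' z) - \<delta>) / rate j \<le> stat j z"
        by (simp add: t_def w_def)
    qed
  qed
qed

lemma stat_lower_centre:
  assumes "0 < rate j"
  shows "N (p - q) + d' (err j p q z) / rate j \<le> stat j z"
  unfolding stat_eq[OF assms, of z p q]
  using dir_hadamard_norm_lower[OF deriv N, of "1 / rate j" "err j p q z"] assms by simp

lemma finite_set_stat_law: "prob_vec p' \<Longrightarrow> prob_vec q' \<Longrightarrow> finite (set_pmf (stat_law j p' q'))"
  by (simp add: stat_law_def sample_def finite_set_pmf_two_sample)

lemma set_stat_law: "set_pmf (stat_law j p' q') \<subseteq> {0..}"
  using N by (auto simp: stat_law_def stat_def is_norm_def)

lemma prob_stat_law: "measure_pmf.prob (stat_law j p' q') {..y} = measure_pmf.prob (sample j p' q') {z. stat j z \<le> y}"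
  by (simp add: stat_law_def vimage_def)

text \<open>By \<open>stat_upper\<close> the statistic is at most \<open>N (p' - q') + x / rate j\<close> whenever \<open>d' W \<le> x0\<close> and the estimation errors
are bounded, and the first event has a limiting probability above \<open>\<alpha>\<close>.\<close>

lemma quantile_stat_upper:
  assumes Z: "centered_normal_rv MZ Z (limit_cov c p q)" and K: "0 \<le> K"
    and cont: "isCont (cdf (distr MZ borel (\<lambda>\<omega>. d' (Z \<omega>)))) x0"
    and \<alpha>: "0 < \<alpha>" "\<alpha> < cdf (distr MZ borel (\<lambda>\<omega>. d' (Z \<omega>))) x0" and x: "x0 < x"
  shows "\<forall>\<^sub>F j in sequentially. \<forall>p' q'. near j K p' q' \<longrightarrow>
    quantile (measure_pmf (stat_law j p' q')) \<alpha> \<le> N (p' - q') + x / rate j"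
proof -
  define e where "e = (cdf (distr MZ borel (\<lambda>\<omega>. d' (Z \<omega>))) x0 - \<alpha>) / 2"
  have e: "0 < e" using \<alpha> by (simp add: e_def)
  have \<delta>: "0 < x - x0" using x by simp
  obtain L where L: "\<forall>\<^sub>F j in sequentially. \<forall>p' q'. prob_vec p' \<longrightarrow> prob_vec q' \<longrightarrow>
        measure_pmf.prob (sample j p' q') {z. \<not> mle_errors_le j L p' q' z} \<le> e" by (rule mle_errors_tail[OF e])
  show ?thesis
    using L clt_uniform[OF Z K e cont] stat_upper[OF \<delta>, of K L] eventually_rate_gt[of 0]
  proof eventually_elim
    case (elim j)
    show ?case
    proof (intro allI impI)
      fix p' q' assume near: "near j K p' q'"
      have pv: "prob_vec p'" "prob_vec q'" using near by (auto simp: near_def)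
      have "measure_pmf.prob (sample j p' q') {z. d' (err j p' q' z) \<le> x0}
          \<le> measure_pmf.prob (sample j p' q') {z. stat j z \<le> N (p' - q') + x / rate j}
           + measure_pmf.prob (sample j p' q') {z. \<not> mle_errors_le j L p' q' z}"
      proof (rule prob_le_add)
        fix z assume z: "d' (err j p' q' z) \<le> x0"
        show "stat j z \<le> N (p' - q') + x / rate j \<or> \<not> mle_errors_le j L p' q' z"
        proof (cases "mle_errors_le j L p' q' z")
          case True
          then have "stat j z \<le> N (p' - q') + (d' (err j p' q' z) + (x - x0)) / rate j"
            using elim(3) near by blast
          also have "\<dots> \<le> N (p' - q') + x / rate j"
            using z elim(4) by (intro add_left_mono divide_right_mono) auto
          finally show ?thesis by simp
        qed simp
      qed
      moreover have "measure_pmf.prob (sample j p' q') {z. \<not> mle_errors_le j L p' q' z} \<le> e"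
        using elim(1) pv by blast
      moreover have "\<bar>measure_pmf.prob (sample j p' q') {z. d' (err j p' q' z) \<le> x0}
          - cdf (distr MZ borel (\<lambda>\<omega>. d' (Z \<omega>))) x0\<bar> < e"
        using elim(2) near by blast
      moreover have "cdf (distr MZ borel (\<lambda>\<omega>. d' (Z \<omega>))) x0 = \<alpha> + 2 * e" by (simp add: e_def field_simps)
      ultimately have "\<alpha> \<le> measure_pmf.prob (stat_law j p' q') {..N (p' - q') + x / rate j}"
        unfolding prob_stat_law by linarith
      then show "quantile (measure_pmf (stat_law j p' q')) \<alpha> \<le> N (p' - q') + x / rate j"
        by (intro quantile_pmf_le set_stat_law \<alpha>)
    qed
  qed
qed

lemma quantile_stat_lower_linear:
  assumes Z: "centered_normal_rv MZ Z (limit_cov c p q)" and K: "0 \<le> K" and lin: "linear d'"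
    and cont: "isCont (cdf (distr MZ borel (\<lambda>\<omega>. d' (Z \<omega>)))) x1"
    and \<alpha>: "\<alpha> < 1" "cdf (distr MZ borel (\<lambda>\<omega>. d' (Z \<omega>))) x1 < \<alpha>" and x: "x < x1"
  shows "\<forall>\<^sub>F j in sequentially. \<forall>p' q'. near j K p' q' \<longrightarrow>
    N (p' - q') + x / rate j < quantile (measure_pmf (stat_law j p' q')) \<alpha>"
proof -
  define e where "e = \<alpha> - cdf (distr MZ borel (\<lambda>\<omega>. d' (Z \<omega>))) x1"
  have e: "0 < e" using \<alpha> by (simp add: e_def)
  define x2 where "x2 = (x + x1) / 2"
  have x2: "x < x2" "0 < x1 - x2" using x by (auto simp: x2_def)
  show ?thesis
    using clt_uniform[OF Z K e cont] stat_lower_linear[OF x2(2) lin, of K] eventually_rate_gt[of 0]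
  proof eventually_elim
    case (elim j)
    show ?case
    proof (intro allI impI)
      fix p' q' assume near: "near j K p' q'"
      have pv: "prob_vec p'" "prob_vec q'" using near by (auto simp: near_def)
      have "measure_pmf.prob (sample j p' q') {z. stat j z \<le> N (p' - q') + x2 / rate j}
          \<le> measure_pmf.prob (sample j p' q') {z. d' (err j p' q' z) \<le> x1}"
      proof (rule measure_pmf.finite_measure_mono, safe)
        fix a b assume "stat j (a, b) \<le> N (p' - q') + x2 / rate j"
        then have "(d' (err j p' q' (a, b)) - (x1 - x2)) / rate j \<le> x2 / rate j"
          using elim(2)[rule_format, OF near, of "(a, b)"] by (simp add: diff_divide_distrib)
        then show "d' (err j p' q' (a, b)) \<le> x1" using elim(3) by (simp add: divide_le_cancel)
      qed simp
      moreover have "\<bar>measure_pmf.prob (sample j p' q') {z. d' (err j p' q' z) \<le> x1}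
          - cdf (distr MZ borel (\<lambda>\<omega>. d' (Z \<omega>))) x1\<bar> < e"
        using elim(1) near by blast
      ultimately have "measure_pmf.prob (stat_law j p' q') {..N (p' - q') + x2 / rate j} < \<alpha>"
        unfolding prob_stat_law e_def by linarith
      then have "N (p' - q') + x2 / rate j \<le> quantile (measure_pmf (stat_law j p' q')) \<alpha>"
        by (intro le_quantile_pmf finite_set_stat_law pv \<alpha>)
      moreover have "x / rate j < x2 / rate j" using x2 elim(3) by (simp add: divide_strict_right_mono)
      ultimately show "N (p' - q') + x / rate j < quantile (measure_pmf (stat_law j p' q')) \<alpha>" by linarith
    qed
  qed
qed

end

section \<open>Asymptotic rejection probability\<close>

locale bootstrap_test = two_sample_setting p q N d' n1 n2 c
  for p q :: "real ^ 'k" and N d' :: "real ^ 'k \<Rightarrow> real" and n1 n2 :: "nat \<Rightarrow> nat" and c :: real +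
  fixes MZ :: "'b measure" and Z :: "'b \<Rightarrow> real ^ 'k" and \<alpha> \<epsilon> :: real
    and cmle :: "nat \<Rightarrow> nat ^ 'k \<Rightarrow> nat ^ 'k \<Rightarrow> (real ^ 'k) \<times> (real ^ 'k)"
  assumes pos: "\<And>i. 0 < p $ i" "\<And>i. 0 < q $ i"
    and alpha: "0 < \<alpha>" "\<alpha> < 1"
    and cmle: "\<And>j x y. (\<Sum>i\<in>UNIV. x $ i) = n1 j \<Longrightarrow> (\<Sum>i\<in>UNIV. y $ i) = n2 j \<Longrightarrow>
                 is_constrained_mle N \<epsilon> x y (cmle j x y)"
    and Z: "centered_normal_rv MZ Z (limit_cov c p q)"
    and T_cont: "continuous_on UNIV (cdf (distr MZ borel (\<lambda>\<omega>. d' (Z \<omega>))))"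
    and T_quantile: "quantile (distr MZ borel (\<lambda>\<omega>. d' (Z \<omega>))) \<alpha> < 0"
begin

definition T_cdf :: "real \<Rightarrow> real" where "T_cdf = cdf (distr MZ borel (\<lambda>\<omega>. d' (Z \<omega>)))"

definition qT :: real where "qT = quantile (distr MZ borel (\<lambda>\<omega>. d' (Z \<omega>))) \<alpha>"

definition rejects :: "nat \<Rightarrow> (nat ^ 'k) \<times> (nat ^ 'k) \<Rightarrow> bool" where
  "rejects j z \<longleftrightarrow> stat j z < bootstrap_quantile N \<epsilon> \<alpha> (n1 j) (n2 j) (cmle j (fst z) (snd z)) (fst z) (snd z)"

definition rej_prob :: "nat \<Rightarrow> real" where
  "rej_prob j = measure_pmf.prob (sample j p q) {z. rejects j z}"

lemma rej_prob_bounds: "0 \<le> rej_prob j" "rej_prob j \<le> 1" by (auto simp: rej_prob_def)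

lemma Z_prob: "prob_space MZ" and Z_meas: "Z \<in> borel_measurable MZ"
  using Z by (auto simp: centered_normal_rv_def)

lemma T_meas: "(\<lambda>\<omega>. d' (Z \<omega>)) \<in> borel_measurable MZ"
  using Z_meas borel_measurable_continuous_onI[OF deriv_cont] by (rule measurable_compose)

lemma T_real_distribution: "real_distribution (distr MZ borel (\<lambda>\<omega>. d' (Z \<omega>)))"
  by (rule prob_space.real_distribution_distr[OF Z_prob T_meas])

lemma T_cdf_isCont: "isCont T_cdf x"
  using T_cont by (simp add: T_cdf_def continuous_on_eq_continuous_at)

lemma T_cdf_mono: "x \<le> y \<Longrightarrow> T_cdf x \<le> T_cdf y"
proof -
  interpret real_distribution "distr MZ borel (\<lambda>\<omega>. d' (Z \<omega>))" by (rule T_real_distribution)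
  show "x \<le> y \<Longrightarrow> T_cdf x \<le> T_cdf y" unfolding T_cdf_def by (rule cdf_nondecreasing)
qed

lemma quantile_set: "{x. \<alpha> \<le> T_cdf x} \<noteq> {}" "bdd_below {x. \<alpha> \<le> T_cdf x}"
proof -
  interpret real_distribution "distr MZ borel (\<lambda>\<omega>. d' (Z \<omega>))" by (rule T_real_distribution)
  have "\<forall>\<^sub>F x in at_top. \<alpha> < T_cdf x"
    using order_tendstoD(1)[OF cdf_lim_at_top_prob alpha(2)] by (simp add: T_cdf_def)
  then obtain x where "\<alpha> < T_cdf x" by (metis eventually_at_top_linorder order_refl)
  then show "{x. \<alpha> \<le> T_cdf x} \<noteq> {}" by (auto intro!: exI[of _ x])
  have "\<forall>\<^sub>F x in at_bot. T_cdf x < \<alpha>"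
    using order_tendstoD(2)[OF cdf_lim_at_bot alpha(1)] by (simp add: T_cdf_def)
  then obtain a where a: "\<And>x. x \<le> a \<Longrightarrow> T_cdf x < \<alpha>" by (auto simp: eventually_at_bot_linorder)
  show "bdd_below {x. \<alpha> \<le> T_cdf x}"
  proof (rule bdd_belowI[of _ a])
    fix x assume "x \<in> {x. \<alpha> \<le> T_cdf x}"
    then show "a \<le> x" using a[of x] by (cases "a \<le> x") auto
  qed
qed

lemma qT_eq: "qT = Inf {x. \<alpha> \<le> T_cdf x}" by (simp add: qT_def quantile_def T_cdf_def)

lemma T_cdf_less: assumes "x < qT" shows "T_cdf x < \<alpha>"
proof (rule ccontr)
  assume "\<not> T_cdf x < \<alpha>"
  then have "qT \<le> x" unfolding qT_eq by (intro cInf_lower quantile_set) auto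
  then show False using assms by simp
qed

lemma T_cdf_ge: assumes "qT < x" shows "\<alpha> \<le> T_cdf x"
proof -
  obtain y where "\<alpha> \<le> T_cdf y" "y < x"
    using cInf_lessD[OF quantile_set(1), of x] assms by (auto simp: qT_eq)
  then show ?thesis using T_cdf_mono[of y x] by simp
qed

lemma T_cdf_quantile: "T_cdf qT = \<alpha>"
proof (rule antisym)
  have "(T_cdf \<longlongrightarrow> T_cdf qT) (at_left qT)" "(T_cdf \<longlongrightarrow> T_cdf qT) (at_right qT)"
    using T_cdf_isCont[of qT] by (auto simp: isCont_def filterlim_at_split)
  moreover have "\<forall>\<^sub>F x in at_left qT. T_cdf x \<le> \<alpha>"
    using T_cdf_less by (auto simp: eventually_at_left_field intro!: exI[of _ "qT - 1"] less_imp_le)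
  moreover have "\<forall>\<^sub>F x in at_right qT. \<alpha> \<le> T_cdf x"
    using T_cdf_ge by (auto simp: eventually_at_right_field intro!: exI[of _ "qT + 1"])
  ultimately show "T_cdf qT \<le> \<alpha>" "\<alpha> \<le> T_cdf qT"
    by (auto intro: tendsto_upperbound tendsto_lowerbound)
qed

text \<open>Otherwise \<open>T\<close> would have a gap immediately to the right of its quantile.\<close>

lemma T_cdf_greater: assumes x: "qT < x" shows "\<alpha> < T_cdf x"
proof -
  interpret prob_space MZ by (rule Z_prob)
  have [measurable]: "(\<lambda>\<omega>. d' (Z \<omega>)) \<in> borel_measurable MZ" by (rule T_meas)
  have T_cdf_eq: "T_cdf y = measure MZ {\<omega> \<in> space MZ. d' (Z \<omega>) \<le> y}" for y
    unfolding T_cdf_def cdf_def by (subst measure_distr) (auto intro!: arg_cong[where f = "measure MZ"])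
  show ?thesis
  proof (cases "T_cdf x = 1")
    case True
    then show ?thesis using alpha by simp
  next
    case False
    \<comment> \<open>The gap is taken to end at \<open>m < x\<close>, so that the event \<open>m \<le> T\<close> contains the complement of \<open>T \<le> x\<close> and the event inside of the gap lies in \<open>T \<le> x\<close>.\<close>
    define m where "m = (qT + x) / 2"
    have m: "qT < m" "m < x" using x by (auto simp: m_def)
    have "measure MZ {\<omega> \<in> space MZ. m \<le> d' (Z \<omega>)} = 1 - measure MZ {\<omega> \<in> space MZ. \<not> m \<le> d' (Z \<omega>)}"
      by (subst prob_neg) auto
    moreover have "measure MZ {\<omega> \<in> space MZ. \<not> m \<le> d' (Z \<omega>)} \<le> T_cdf x"
      unfolding T_cdf_eq using m by (intro finite_measure_mono) auto
    moreover have "T_cdf x \<le> 1" unfolding T_cdf_eq by simp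
    ultimately have "0 < measure MZ {\<omega> \<in> space MZ. m \<le> d' (Z \<omega>)}" using False by linarith
    moreover have "0 < measure MZ {\<omega> \<in> space MZ. d' (Z \<omega>) \<le> qT}"
      using T_cdf_quantile alpha by (simp add: T_cdf_eq[symmetric])
    ultimately have "0 < measure MZ {\<omega> \<in> space MZ. qT < d' (Z \<omega>) \<and> d' (Z \<omega>) < m}"
      by (intro centered_normal_connected_support[OF Z deriv_cont m(1)])
    also have "\<dots> \<le> measure MZ ({\<omega> \<in> space MZ. d' (Z \<omega>) \<le> x} - {\<omega> \<in> space MZ. d' (Z \<omega>) \<le> qT})"
      using m by (intro finite_measure_mono) auto
    also have "\<dots> = T_cdf x - T_cdf qT"
      unfolding T_cdf_eq using x by (intro finite_measure_Diff) auto
    finally show ?thesis by (simp add: T_cdf_quantile)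
  qed
qed

lemma qT_neg: "qT < 0" using T_quantile by (simp add: qT_def)

lemma sample_counts:
  assumes "z \<in> set_pmf (sample j p q)"
  shows "(\<Sum>i\<in>UNIV. fst z $ i) = n1 j" "(\<Sum>i\<in>UNIV. snd z $ i) = n2 j"
  using assms sum_eq_of_set_pmf_multinomial[OF p, of "fst z" "n1 j"]
    sum_eq_of_set_pmf_multinomial[OF q, of "snd z" "n2 j"]
  by (auto simp: sample_def two_sample_pmf_def set_pair_pmf)

text \<open>The bootstrap law is the law of the statistic under the estimated parameters, so the results on
\<open>stat_law\<close> apply to it.\<close>

lemma bootstrap_law_eq:
  "bootstrap_law N \<epsilon> (n1 j) (n2 j) t (fst z) (snd z) =
    (if \<epsilon> \<le> stat j z then stat_law j (mle (n1 j) (fst z)) (mle (n2 j) (snd z)) else stat_law j (fst t) (snd t))"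
proof -
  have "stat j = (\<lambda>(x', y'). test_stat N (n1 j) (n2 j) x' y')"
    by (auto simp: stat_def test_stat_def)
  moreover have "test_stat N (n1 j) (n2 j) (fst z) (snd z) = stat j z" by (simp add: stat_def test_stat_def)
  ultimately show ?thesis
    by (simp add: bootstrap_law_def bootstrap_params_def stat_law_def sample_def two_sample_pmf_def case_prod_unfold)
qed

lemma rejects_iff:
  "rejects j z \<longleftrightarrow> stat j z < quantile (measure_pmf
    (if \<epsilon> \<le> stat j z then stat_law j (mle (n1 j) (fst z)) (mle (n2 j) (snd z))
     else stat_law j (fst (cmle j (fst z) (snd z))) (snd (cmle j (fst z) (snd z))))) \<alpha>"
  by (simp only: rejects_def bootstrap_quantile_def bootstrap_law_eq)

lemma near_mle:
  assumes "z \<in> set_pmf (sample j p q)" "mle_errors_le j K p q z" "0 < n1 j" "0 < n2 j"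
  shows "near j K (mle (n1 j) (fst z)) (mle (n2 j) (snd z))"
  using assms sample_counts[OF assms(1)] by (simp add: near_def mle_errors_le_def prob_vec_mle)

lemma near_center: "0 \<le> K \<Longrightarrow> near j K p q"
  using p q by (simp add: near_def)

text \<open>On this event the bootstrap is centred at the observed distance, and as \<open>qT\<close> is negative, its quantile
stays below that distance.\<close>

lemma no_rejection_above:
  assumes K: "0 \<le> K"
  shows "\<forall>\<^sub>F j in sequentially. \<forall>z \<in> set_pmf (sample j p q). mle_errors_le j K p q z \<longrightarrow> \<epsilon> \<le> stat j z \<longrightarrow> \<not> rejects j z"
proof -
  \<comment> \<open>Any two levels between \<open>qT\<close> and zero would do.\<close>
  have x: "qT / 2 < qT / 4" "qT < qT / 2" using qT_neg by auto
  have "\<forall>\<^sub>F j in sequentially. \<forall>p' q'. near j K p' q' \<longrightarrow>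
    quantile (measure_pmf (stat_law j p' q')) \<alpha> \<le> N (p' - q') + (qT / 4) / rate j"
    by (rule quantile_stat_upper[OF Z K T_cdf_isCont[unfolded T_cdf_def] alpha(1) T_cdf_greater[OF x(2), unfolded T_cdf_def] x(1)])
  then show ?thesis using eventually_rate_gt[of 0] eventually_n_pos
  proof eventually_elim
    case (elim j)
    show ?case
    proof (intro ballI impI)
      fix z assume z: "z \<in> set_pmf (sample j p q)" "mle_errors_le j K p q z" "\<epsilon> \<le> stat j z"
      have "quantile (measure_pmf (stat_law j (mle (n1 j) (fst z)) (mle (n2 j) (snd z)))) \<alpha>
          \<le> N (mle (n1 j) (fst z) - mle (n2 j) (snd z)) + (qT / 4) / rate j"
        using elim(1)[rule_format, OF near_mle[OF z(1,2)]] elim(3) by simp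
      also have "\<dots> \<le> stat j z" using qT_neg elim(2) by (simp add: stat_def divide_nonpos_pos)
      finally show "\<not> rejects j z" using z(3) by (simp add: rejects_iff)
    qed
  qed
qed

lemma stat_consistent:
  assumes e: "0 < e"
  shows "\<forall>\<^sub>F j in sequentially. \<forall>p' q' z. mle_errors_le j K p' q' z \<longrightarrow> \<bar>stat j z - N (p' - q')\<bar> < e"
proof -
  obtain C :: real where C: "0 < C" "\<And>x. N x \<le> C * norm x" using is_norm_le_norm[OF N] by blast
  have "\<forall>\<^sub>F j in sequentially. (C * (2 * K)) / rate j < e" by (rule order_tendstoD(2)[OF inverse_rate_lim e])
  then show ?thesis using eventually_rate_gt[of 0]
  proof eventually_elim
    case (elim j)
    show ?case
    proof (intro allI impI)
      fix p' q' z assume good: "mle_errors_le j K p' q' z"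
      have "\<bar>stat j z - N (p' - q')\<bar> \<le> N ((mle (n1 j) (fst z) - mle (n2 j) (snd z)) - (p' - q'))"
        unfolding stat_def by (rule is_norm_diff_le[OF N])
      also have "(mle (n1 j) (fst z) - mle (n2 j) (snd z)) - (p' - q') = (1 / rate j) *\<^sub>R err j p' q' z"
        using elim by (simp add: err_def scaled_error_def rate_def case_prod_unfold)
      also have "N \<dots> \<le> C * norm ((1 / rate j) *\<^sub>R err j p' q' z)" by (rule C)
      also have "\<dots> = C * norm (err j p' q' z) / rate j" using elim by simp
      also have "\<dots> \<le> (C * (2 * K)) / rate j"
        using elim C norm_err_le[OF good] by (intro divide_right_mono mult_left_mono) auto
      also have "\<dots> < e" by (rule elim(1))
      finally show "\<bar>stat j z - N (p' - q')\<bar> < e" .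
    qed
  qed
qed

lemma rejection_far:
  assumes far: "\<epsilon> < N (p - q)"
  shows "rej_prob \<longlonglongrightarrow> 0"
proof (rule LIMSEQ_I)
  fix e :: real assume e: "0 < e"
  then have e2: "0 < e / 2" by simp
  obtain K where K: "0 < K" "\<forall>\<^sub>F j in sequentially. \<forall>p' q'. prob_vec p' \<longrightarrow> prob_vec q' \<longrightarrow>
        measure_pmf.prob (sample j p' q') {z. \<not> mle_errors_le j K p' q' z} \<le> e / 2" by (rule mle_errors_tail[OF e2])
  have "0 < N (p - q) - \<epsilon>" using far by simp
  from stat_consistent[OF this, of K] no_rejection_above[OF less_imp_le[OF K(1)]] K(2)
  have "\<forall>\<^sub>F j in sequentially. norm (rej_prob j - 0) < e"
  proof eventually_elim
    case (elim j)
    have "rej_prob j \<le> measure_pmf.prob (sample j p q) {z. \<not> mle_errors_le j K p q z} + measure_pmf.prob (sample j p q) {z. False}"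
      unfolding rej_prob_def
    proof (rule prob_le_add)
      fix z assume z: "z \<in> set_pmf (sample j p q)" "rejects j z"
      show "\<not> mle_errors_le j K p q z \<or> False"
      proof (cases "mle_errors_le j K p q z")
        case True
        then have "\<bar>stat j z - N (p - q)\<bar> < N (p - q) - \<epsilon>" using elim(1) by blast
        then have "\<epsilon> \<le> stat j z" by linarith
        then show ?thesis using elim(2) z True by blast
      qed simp
    qed
    moreover have "measure_pmf.prob (sample j p q) {z. \<not> mle_errors_le j K p q z} \<le> e / 2" using elim(3) p q by blast
    ultimately show ?case using e rej_prob_bounds[of j] by simp
  qed
  then show "\<exists>no. \<forall>n\<ge>no. norm (rej_prob n - 0) < e" by (simp add: eventually_sequentially)
qed

lemma cmle_constraint:
  assumes "z \<in> set_pmf (sample j p q)"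
  shows "prob_vec (fst (cmle j (fst z) (snd z)))" "prob_vec (snd (cmle j (fst z) (snd z)))"
    "N (fst (cmle j (fst z) (snd z)) - snd (cmle j (fst z) (snd z))) = \<epsilon>"
  using cmle[OF sample_counts[OF assms]] by (auto simp: is_constrained_mle_def is_arg_max_def case_prod_unfold)

text \<open>\<open>constrained_mle_close\<close> turned into a bound at the scale \<open>1 / rate j\<close>, which requires both sample
sizes to be of the same order.\<close>

lemma near_cmle:
  assumes eps: "N (p - q) = \<epsilon>" and K: "0 \<le> K"
  obtains L where "0 \<le> L" "\<forall>\<^sub>F j in sequentially. \<forall>z \<in> set_pmf (sample j p q). mle_errors_le j K p q z \<longrightarrow>
      near j L (fst (cmle j (fst z) (snd z))) (snd (cmle j (fst z) (snd z)))"
proof -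
  \<comment> \<open>The smallest class probability bounds the chi-square distance from the truth; it is positive because there are finitely many classes.\<close>
  define \<mu> where "\<mu> = Min (range (\<lambda>i. min (p $ i) (q $ i)))"
  have \<mu>: "0 < \<mu>" unfolding \<mu>_def using pos by (subst Min_gr_iff) auto
  have "\<mu> \<le> min (p $ i) (q $ i)" for i unfolding \<mu>_def by (rule Min_le) auto
  then have \<mu>pq: "\<mu> \<le> p $ i" "\<mu> \<le> q $ i" for i by auto
  obtain B :: real where B: "0 < B" "\<forall>\<^sub>F j in sequentially. 0 < n1 j \<and> 0 < n2 j \<and> (rate j)\<^sup>2 \<le> B * n1 j \<and> (rate j)\<^sup>2 \<le> B * n2 j"
    by (rule rate_sq_bound)
  define L where "L = K + sqrt (B * (4 / \<mu> * (2 * K\<^sup>2)))"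
  have L: "0 \<le> L" using K B \<mu> by (simp add: L_def)
  have "\<forall>\<^sub>F j in sequentially. \<forall>z \<in> set_pmf (sample j p q). mle_errors_le j K p q z \<longrightarrow>
      near j L (fst (cmle j (fst z) (snd z))) (snd (cmle j (fst z) (snd z)))"
    using B(2)
  proof eventually_elim
    case (elim j)
    show ?case
    proof (intro ballI impI)
      fix z assume z: "z \<in> set_pmf (sample j p q)" and good: "mle_errors_le j K p q z"
      define p' where "p' = fst (cmle j (fst z) (snd z))"
      define q' where "q' = snd (cmle j (fst z) (snd z))"
      define a where "a = mle (n1 j) (fst z)"
      define b where "b = mle (n2 j) (snd z)"
      note cnt = sample_counts[OF z]
      have mle: "is_constrained_mle N \<epsilon> (fst z) (snd z) (p', q')" using cmle[OF cnt] by (simp add: p'_def q'_def)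
      have npos: "0 < n1 j" "0 < n2 j" using elim by auto
      have close: "n1 j * (norm (a - p'))\<^sup>2 + n2 j * (norm (b - q'))\<^sup>2
          \<le> 4 / \<mu> * (n1 j * (norm (a - p))\<^sup>2 + n2 j * (norm (b - q))\<^sup>2)"
        unfolding a_def b_def
        by (rule constrained_mle_close[OF mle p \<mu>pq(1) q \<mu>pq(2) \<mu> eps cnt(1) npos(1) cnt(2) npos(2)])
      have R: "(rate j)\<^sup>2 = real (n1 j) + real (n2 j)" by (simp add: rate_def)
      have g: "(rate j)\<^sup>2 * (norm (a - p))\<^sup>2 \<le> K\<^sup>2" "(rate j)\<^sup>2 * (norm (b - q))\<^sup>2 \<le> K\<^sup>2"
        using good rate_nonneg[of j] unfolding mle_errors_le_def a_def b_def power_mult_distrib[symmetric]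
        by (auto intro!: power_mono)
      have "n1 j * (norm (a - p))\<^sup>2 \<le> K\<^sup>2" "n2 j * (norm (b - q))\<^sup>2 \<le> K\<^sup>2"
      proof -
        have "0 \<le> real (n2 j) * (norm (a - p))\<^sup>2" "0 \<le> real (n1 j) * (norm (b - q))\<^sup>2" by simp_all
        then show "n1 j * (norm (a - p))\<^sup>2 \<le> K\<^sup>2" "n2 j * (norm (b - q))\<^sup>2 \<le> K\<^sup>2"
          using g unfolding R distrib_right by linarith+
      qed
      then have "4 / \<mu> * (n1 j * (norm (a - p))\<^sup>2 + n2 j * (norm (b - q))\<^sup>2) \<le> 4 / \<mu> * (2 * K\<^sup>2)"
        using \<mu> by (intro mult_left_mono) auto
      then have total: "n1 j * (norm (a - p'))\<^sup>2 + n2 j * (norm (b - q'))\<^sup>2 \<le> 4 / \<mu> * (2 * K\<^sup>2)"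
        using close by linarith
      have bound: "rate j * norm v \<le> sqrt (B * (4 / \<mu> * (2 * K\<^sup>2)))"
        if "m * (norm v)\<^sup>2 \<le> 4 / \<mu> * (2 * K\<^sup>2)" "(rate j)\<^sup>2 \<le> B * m" for m :: real and v :: "real ^ 'k"
      proof (rule real_le_rsqrt)
        have "(rate j * norm v)\<^sup>2 = (rate j)\<^sup>2 * (norm v)\<^sup>2" by (rule power_mult_distrib)
        also have "\<dots> \<le> (B * m) * (norm v)\<^sup>2" using that(2) by (intro mult_right_mono) auto
        also have "\<dots> = B * (m * (norm v)\<^sup>2)" by simp
        also have "\<dots> \<le> B * (4 / \<mu> * (2 * K\<^sup>2))" using that(1) B(1) by (intro mult_left_mono) auto
        finally show "(rate j * norm v)\<^sup>2 \<le> B * (4 / \<mu> * (2 * K\<^sup>2))" .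
      qed
      have nn: "0 \<le> real (n1 j) * (norm (a - p'))\<^sup>2" "0 \<le> real (n2 j) * (norm (b - q'))\<^sup>2" by auto
      have far: "rate j * norm (a - p') \<le> L - K" "rate j * norm (b - q') \<le> L - K"
      proof -
        have LK: "L - K = sqrt (B * (4 / \<mu> * (2 * K\<^sup>2)))" by (simp add: L_def)
        have "real (n1 j) * (norm (a - p'))\<^sup>2 \<le> 4 / \<mu> * (2 * K\<^sup>2)" "real (n2 j) * (norm (b - q'))\<^sup>2 \<le> 4 / \<mu> * (2 * K\<^sup>2)"
          using total nn by linarith+
        then show "rate j * norm (a - p') \<le> L - K" "rate j * norm (b - q') \<le> L - K"
          unfolding LK using elim bound by blast+
      qed
      have gd: "rate j * norm (a - p) \<le> K" "rate j * norm (b - q) \<le> K" using good by (auto simp: mle_errors_le_def a_def b_def)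
      have tri: "rate j * norm (v - w) \<le> rate j * norm (u - v) + rate j * norm (u - w)" for u v w :: "real ^ 'k"
      proof -
        have "norm (v - w) \<le> norm (u - v) + norm (u - w)"
          using norm_triangle_ineq4[of "u - w" "u - v"] by simp
        then show ?thesis using rate_nonneg[of j] by (simp add: distrib_left[symmetric] mult_left_mono)
      qed
      have "near j L p' q'"
        unfolding near_def
        using tri[of p' p a] tri[of q' q b] far gd cmle_constraint[OF z] by (auto simp: p'_def q'_def)
      then show "near j L (fst (cmle j (fst z) (snd z))) (snd (cmle j (fst z) (snd z)))"
        by (simp add: p'_def q'_def)
    qed
  qed
  with L show ?thesis by (rule that)
qed

text \<open>Rejection requires that the observed distance be below \<open>\<epsilon>\<close> and below a quantile of at most \<open>\<epsilon> + x / rate j\<close>, and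
then \<open>d' W \<le> x\<close>. Here \<open>x\<close> is slightly above \<open>qT\<close>.\<close>

lemma rejection_boundary_le:
  assumes eps: "N (p - q) = \<epsilon>" and e: "0 < e"
  shows "\<forall>\<^sub>F j in sequentially. rej_prob j \<le> \<alpha> + e"
proof -
  have e3: "0 < e / 3" using e by simp
  obtain K where K: "0 < K" "\<forall>\<^sub>F j in sequentially. \<forall>p' q'. prob_vec p' \<longrightarrow> prob_vec q' \<longrightarrow>
        measure_pmf.prob (sample j p' q') {z. \<not> mle_errors_le j K p' q' z} \<le> e / 3" by (rule mle_errors_tail[OF e3])
  have K0: "0 \<le> K" using K by simp
  obtain L where L: "0 \<le> L" "\<forall>\<^sub>F j in sequentially. \<forall>z \<in> set_pmf (sample j p q). mle_errors_le j K p q z \<longrightarrow>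
      near j L (fst (cmle j (fst z) (snd z))) (snd (cmle j (fst z) (snd z)))"
    by (rule near_cmle[OF eps K0])
  have "(T_cdf \<longlongrightarrow> \<alpha>) (at_right qT)" using T_cdf_isCont[of qT] T_cdf_quantile by (auto simp: isCont_def filterlim_at_split)
  then have "\<forall>\<^sub>F x in at_right qT. T_cdf x < \<alpha> + e / 3" using e3 by (intro order_tendstoD(2)) auto
  then obtain x where x: "qT < x" "T_cdf x < \<alpha> + e / 3"
    by (metis (no_types, lifting) dense eventually_at_right_field)
  have x0: "qT < (qT + x) / 2" "(qT + x) / 2 < x" using x by auto
  have "\<forall>\<^sub>F j in sequentially. \<forall>p' q'. near j L p' q' \<longrightarrow>
    quantile (measure_pmf (stat_law j p' q')) \<alpha> \<le> N (p' - q') + x / rate j"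
    by (rule quantile_stat_upper[OF Z L(1) T_cdf_isCont[unfolded T_cdf_def] alpha(1) T_cdf_greater[OF x0(1), unfolded T_cdf_def] x0(2)])
  with no_rejection_above[OF K0] clt_uniform[OF Z order_refl e3 T_cdf_isCont[unfolded T_cdf_def, of x]] K(2) L(2) eventually_rate_gt[of 0]
  show ?thesis
  proof eventually_elim
    case (elim j)
    have "rej_prob j \<le> measure_pmf.prob (sample j p q) {z. d' (err j p q z) \<le> x}
        + measure_pmf.prob (sample j p q) {z. \<not> mle_errors_le j K p q z}"
      unfolding rej_prob_def
    proof (rule prob_le_add)
      fix z assume z: "z \<in> set_pmf (sample j p q)" "rejects j z"
      show "d' (err j p q z) \<le> x \<or> \<not> mle_errors_le j K p q z"
      proof (cases "mle_errors_le j K p q z")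
        case True
        then have lt: "\<not> \<epsilon> \<le> stat j z" using elim(1) z by blast
        let ?t = "cmle j (fst z) (snd z)"
        have "near j L (fst ?t) (snd ?t)" using elim(4) z True by blast
        then have "quantile (measure_pmf (stat_law j (fst ?t) (snd ?t))) \<alpha> \<le> \<epsilon> + x / rate j"
          using elim(6) cmle_constraint(3)[OF z(1)] by metis
        then have "stat j z < \<epsilon> + x / rate j" using z(2) lt by (simp add: rejects_iff)
        then have "d' (err j p q z) / rate j \<le> x / rate j"
          using stat_lower_centre[OF elim(5), of z] eps by simp
        then show ?thesis using elim(5) by (simp add: divide_le_cancel)
      qed simp
    qed
    moreover have "measure_pmf.prob (sample j p q) {z. \<not> mle_errors_le j K p q z} \<le> e / 3" using elim(3) p q by blast
    moreover have "\<bar>measure_pmf.prob (sample j p q) {z. d' (err j p q z) \<le> x} - T_cdf x\<bar> < e / 3"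
      using elim(2) near_center[of 0 j] by (auto simp: T_cdf_def)
    ultimately show ?case using x(2) by linarith
  qed
qed

text \<open>For \<open>y\<close> slightly below \<open>qT\<close>, the event \<open>d' W \<le> y\<close> puts the observed distance below \<open>\<epsilon>\<close>, because \<open>qT\<close> is
negative, and below the bootstrap quantile, because for a linear derivative the latter is not asymptotically smaller
than \<open>\<epsilon> + qT / rate j\<close>.\<close>

lemma rejection_boundary_ge:
  assumes eps: "N (p - q) = \<epsilon>" and lin: "linear d'" and e: "0 < e"
  shows "\<forall>\<^sub>F j in sequentially. \<alpha> - e \<le> rej_prob j"
proof -
  have e3: "0 < e / 3" using e by simp
  obtain K where K: "0 < K" "\<forall>\<^sub>F j in sequentially. \<forall>p' q'. prob_vec p' \<longrightarrow> prob_vec q' \<longrightarrow>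
        measure_pmf.prob (sample j p' q') {z. \<not> mle_errors_le j K p' q' z} \<le> e / 3" by (rule mle_errors_tail[OF e3])
  have K0: "0 \<le> K" using K by simp
  obtain L where L: "0 \<le> L" "\<forall>\<^sub>F j in sequentially. \<forall>z \<in> set_pmf (sample j p q). mle_errors_le j K p q z \<longrightarrow>
      near j L (fst (cmle j (fst z) (snd z))) (snd (cmle j (fst z) (snd z)))"
    by (rule near_cmle[OF eps K0])
  have "(T_cdf \<longlongrightarrow> \<alpha>) (at_left qT)" using T_cdf_isCont[of qT] T_cdf_quantile by (auto simp: isCont_def filterlim_at_split)
  then have "\<forall>\<^sub>F x in at_left qT. \<alpha> - e / 3 < T_cdf x" using e3 by (intro order_tendstoD(1)) auto
  then obtain y where y: "y < qT" "\<alpha> - e / 3 < T_cdf y"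
    by (metis (no_types, lifting) dense eventually_at_left_field)
  \<comment> \<open>Four levels \<open>y < x < (x + qT) / 2 < qT\<close>: the first gap absorbs the remainder of the derivative, and the probability at the third level is below \<open>\<alpha>\<close>.\<close>
  define x where "x = (y + qT) / 2"
  have x: "y < x" "x < (x + qT) / 2" "(x + qT) / 2 < qT" "0 < x - y" "x < 0"
    using y qT_neg by (auto simp: x_def)
  have "\<forall>\<^sub>F j in sequentially. \<forall>p' q'. near j L p' q' \<longrightarrow>
    N (p' - q') + x / rate j < quantile (measure_pmf (stat_law j p' q')) \<alpha>"
    by (rule quantile_stat_lower_linear[OF Z L(1) lin T_cdf_isCont[unfolded T_cdf_def] alpha(2) T_cdf_less[OF x(3), unfolded T_cdf_def] x(2)])
  with stat_upper[OF x(4), of 0 K] clt_uniform[OF Z order_refl e3 T_cdf_isCont[unfolded T_cdf_def, of y]] K(2) L(2) eventually_rate_gt[of 0]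
  show ?thesis
  proof eventually_elim
    case (elim j)
    have "measure_pmf.prob (sample j p q) {z. d' (err j p q z) \<le> y}
        \<le> rej_prob j + measure_pmf.prob (sample j p q) {z. \<not> mle_errors_le j K p q z}"
      unfolding rej_prob_def
    proof (rule prob_le_add)
      fix z assume z: "z \<in> set_pmf (sample j p q)" "d' (err j p q z) \<le> y"
      show "rejects j z \<or> \<not> mle_errors_le j K p q z"
      proof (cases "mle_errors_le j K p q z")
        case True
        let ?t = "cmle j (fst z) (snd z)"
        have "stat j z \<le> \<epsilon> + (d' (err j p q z) + (x - y)) / rate j"
          using elim(1)[rule_format, OF near_center True] eps by simp
        also have "\<dots> \<le> \<epsilon> + x / rate j"
          using z(2) elim(5) by (intro add_left_mono divide_right_mono) auto
        finally have le: "stat j z \<le> \<epsilon> + x / rate j" .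
        moreover have "x / rate j < 0" using x(5) elim(5) by (rule divide_neg_pos)
        ultimately have "\<not> \<epsilon> \<le> stat j z" by linarith
        moreover have "near j L (fst ?t) (snd ?t)" using elim(4) z True by blast
        then have "\<epsilon> + x / rate j < quantile (measure_pmf (stat_law j (fst ?t) (snd ?t))) \<alpha>"
          using elim(6) cmle_constraint(3)[OF z(1)] by metis
        ultimately show ?thesis using le by (simp add: rejects_iff)
      qed simp
    qed
    moreover have "measure_pmf.prob (sample j p q) {z. \<not> mle_errors_le j K p q z} \<le> e / 3" using elim(3) p q by blast
    moreover have "\<bar>measure_pmf.prob (sample j p q) {z. d' (err j p q z) \<le> y} - T_cdf y\<bar> < e / 3"
      using elim(2) near_center[of 0 j] by (auto simp: T_cdf_def)
    ultimately show ?case using y(2) by linarith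
  qed
qed

text \<open>The constrained estimator has distance exactly \<open>\<epsilon>\<close>, and the bootstrap distance is consistent uniformly in the
parameters, so its quantile is at least \<open>\<epsilon> - \<eta>\<close>, wherever the estimator lies. The observed distance
stays below \<open>\<epsilon> - \<eta>\<close>.\<close>

lemma rejection_inside:
  assumes inside: "N (p - q) < \<epsilon>"
  shows "rej_prob \<longlonglongrightarrow> 1"
proof (rule LIMSEQ_I)
  fix e :: real assume e: "0 < e"
  define e' where "e' = min (e / 2) (\<alpha> / 2)"
  have e': "0 < e'" "e' < \<alpha>" "e' < e" using e alpha by (auto simp: e'_def)
  obtain K where K: "0 < K" "\<forall>\<^sub>F j in sequentially. \<forall>p' q'. prob_vec p' \<longrightarrow> prob_vec q' \<longrightarrow>
        measure_pmf.prob (sample j p' q') {z. \<not> mle_errors_le j K p' q' z} \<le> e'" by (rule mle_errors_tail[OF e'(1)])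
  define \<eta> where "\<eta> = (\<epsilon> - N (p - q)) / 2"
  have \<eta>: "0 < \<eta>" using inside by (simp add: \<eta>_def)
  from stat_consistent[OF \<eta>, of K] K(2)
  have "\<forall>\<^sub>F j in sequentially. norm (rej_prob j - 1) < e"
  proof eventually_elim
    case (elim j)
    have "measure_pmf.prob (sample j p q) {z. True}
        \<le> rej_prob j + measure_pmf.prob (sample j p q) {z. \<not> mle_errors_le j K p q z}"
      unfolding rej_prob_def
    proof (rule prob_le_add)
      fix z assume z: "z \<in> set_pmf (sample j p q)"
      show "rejects j z \<or> \<not> mle_errors_le j K p q z"
      proof (cases "mle_errors_le j K p q z")
        case True
        define p' where "p' = fst (cmle j (fst z) (snd z))"
        define q' where "q' = snd (cmle j (fst z) (snd z))"
        have pq': "prob_vec p'" "prob_vec q'" "N (p' - q') = \<epsilon>"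
          using cmle_constraint[OF z] by (auto simp: p'_def q'_def)
        have "\<bar>stat j z - N (p - q)\<bar> < \<eta>" using elim(1) True by blast
        moreover have "N (p - q) + \<eta> = \<epsilon> - \<eta>" by (simp add: \<eta>_def field_simps)
        ultimately have lt: "stat j z < \<epsilon> - \<eta>" by linarith
        have "measure_pmf.prob (stat_law j p' q') {..\<epsilon> - \<eta>} \<le> measure_pmf.prob (sample j p' q') {z. \<not> mle_errors_le j K p' q' z}"
          unfolding prob_stat_law
        proof (rule measure_pmf.finite_measure_mono, rule subsetI, rule CollectI, rule notI)
          fix w assume "w \<in> {z. stat j z \<le> \<epsilon> - \<eta>}" "mle_errors_le j K p' q' w"
          moreover from this have "\<bar>stat j w - N (p' - q')\<bar> < \<eta>" using elim(1) by blast
          ultimately show False using pq' by auto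
        qed simp
        also have "\<dots> < \<alpha>" using elim(2) pq' e' by (meson le_less_trans)
        finally have "\<epsilon> - \<eta> \<le> quantile (measure_pmf (stat_law j p' q')) \<alpha>"
          by (intro le_quantile_pmf finite_set_stat_law pq' alpha)
        then show ?thesis using lt \<eta> by (simp add: rejects_iff p'_def q'_def)
      qed simp
    qed
    moreover have "measure_pmf.prob (sample j p q) {z. True} = 1" by simp
    moreover have "measure_pmf.prob (sample j p q) {z. \<not> mle_errors_le j K p q z} \<le> e'" using elim(2) p q by blast
    ultimately show ?case using e' rej_prob_bounds[of j] by (simp add: abs_real_def)
  qed
  then show "\<exists>no. \<forall>n\<ge>no. norm (rej_prob n - 1) < e" by (simp add: eventually_sequentially)
qed

end

text \<open>The joint law of the two samples, so that the rejection probability becomes one under \<open>pair_pmf\<close>.\<close>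

lemma (in prob_space) distr_indep_pair_pmf:
  fixes X Y :: "'a \<Rightarrow> 'x::countable"
  assumes indep: "indep_var (count_space UNIV) X (count_space UNIV) Y"
    and X: "distr M (count_space UNIV) X = measure_pmf A" and Y: "distr M (count_space UNIV) Y = measure_pmf B"
  shows "(\<lambda>\<omega>. (X \<omega>, Y \<omega>)) \<in> M \<rightarrow>\<^sub>M count_space UNIV"
    and "distr M (count_space UNIV) (\<lambda>\<omega>. (X \<omega>, Y \<omega>)) = measure_pmf (pair_pmf A B)"
proof -
  have mX: "X \<in> M \<rightarrow>\<^sub>M count_space UNIV" and mY: "Y \<in> M \<rightarrow>\<^sub>M count_space UNIV"
    using indep_var_rv1[OF indep] indep_var_rv2[OF indep] .
  have "(\<lambda>\<omega>. (X \<omega>, Y \<omega>)) \<in> M \<rightarrow>\<^sub>M (count_space UNIV \<Otimes>\<^sub>M count_space UNIV)"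
    using mX mY by (rule measurable_Pair)
  then show XY: "(\<lambda>\<omega>. (X \<omega>, Y \<omega>)) \<in> M \<rightarrow>\<^sub>M count_space UNIV"
    by (simp add: pair_measure_countable)
  show "distr M (count_space UNIV) (\<lambda>\<omega>. (X \<omega>, Y \<omega>)) = measure_pmf (pair_pmf A B)"
  proof (rule measure_eqI_countable[where A = UNIV])
    fix z :: "'x \<times> 'x"
    obtain x y where z: "z = (x, y)" by force
    have "measure (distr M (count_space UNIV) (\<lambda>\<omega>. (X \<omega>, Y \<omega>))) {z}
        = prob ((\<lambda>\<omega>. (X \<omega>, Y \<omega>)) -` ({x} \<times> {y}) \<inter> space M)"
      using XY by (simp add: measure_distr z)
    also have "\<dots> = prob (X -` {x} \<inter> space M) * prob (Y -` {y} \<inter> space M)"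
      by (rule indep_varD[OF indep]) auto
    also have "prob (X -` {x} \<inter> space M) = measure (distr M (count_space UNIV) X) {x}"
      using mX by (simp add: measure_distr)
    also have "prob (Y -` {y} \<inter> space M) = measure (distr M (count_space UNIV) Y) {y}"
      using mY by (simp add: measure_distr)
    finally have "measure (distr M (count_space UNIV) (\<lambda>\<omega>. (X \<omega>, Y \<omega>))) {z} = pmf (pair_pmf A B) z"
      by (simp add: X Y z measure_pmf_single pmf_pair)
    then show "emeasure (distr M (count_space UNIV) (\<lambda>\<omega>. (X \<omega>, Y \<omega>))) {z} = emeasure (pair_pmf A B) {z}"
      using prob_space.finite_measure[OF prob_space_distr[OF XY]]
      by (simp add: emeasure_pmf_single finite_measure.emeasure_eq_measure)
  qed auto
qed

theorem theorem2p1: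
  fixes p q :: "real ^ 'k"
    and N :: "real ^ 'k \<Rightarrow> real"
    and \<epsilon> \<alpha> c :: real
    and n1 n2 :: "nat \<Rightarrow> nat"
    and M :: "nat \<Rightarrow> 'a measure"
    and X Y :: "nat \<Rightarrow> 'a \<Rightarrow> nat ^ 'k"
    and cmle :: "nat \<Rightarrow> nat ^ 'k \<Rightarrow> nat ^ 'k \<Rightarrow> (real ^ 'k) \<times> (real ^ 'k)"
    and d' :: "real ^ 'k \<Rightarrow> real"
    and MZ :: "'b measure" and Z :: "'b \<Rightarrow> real ^ 'k"
    and T :: "'b \<Rightarrow> real"
    and rej :: "nat \<Rightarrow> real"
  assumes p: "prob_vec p" "\<And>i. 0 < p $ i \<and> p $ i < 1"
    and q: "prob_vec q" "\<And>i. 0 < q $ i \<and> q $ i < 1"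
    and N: "is_norm N"
    and eps: "0 < \<epsilon>"
    and alpha: "0 < \<alpha>" "\<alpha> < 1"
    and M: "\<And>j. prob_space (M j)"
    and X: "\<And>j. distr (M j) (count_space UNIV) (X j) = measure_pmf (multinomial_pmf (n1 j) p)"
    and Y: "\<And>j. distr (M j) (count_space UNIV) (Y j) = measure_pmf (multinomial_pmf (n2 j) q)"
    and indep: "\<And>j. prob_space.indep_var (M j) (count_space UNIV) (X j) (count_space UNIV) (Y j)"
    and cmle: "\<And>j x y. (\<Sum>i\<in>UNIV. x $ i) = n1 j \<Longrightarrow> (\<Sum>i\<in>UNIV. y $ i) = n2 j \<Longrightarrow>
                 is_constrained_mle N \<epsilon> x y (cmle j x y)"
    and n_lim: "filterlim n1 at_top sequentially" "filterlim n2 at_top sequentially"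
    and ratio: "(\<lambda>j. real (n2 j) / real (n1 j)) \<longlonglongrightarrow> c" "0 < c"
    and deriv: "has_dir_hadamard_derivative N d' (p - q)" "sublinear d'"
    and Z: "centered_normal_rv MZ Z (limit_cov c p q)"
    and T: "T = (\<lambda>\<omega>. d' (Z \<omega>))"
    and T_cont: "continuous_on UNIV (cdf (distr MZ borel T))"
    and T_quantile: "quantile (distr MZ borel T) \<alpha> < 0"
    and rej: "rej = (\<lambda>j. \<P>(\<omega> in M j. test_stat N (n1 j) (n2 j) (X j \<omega>) (Y j \<omega>)
                < bootstrap_quantile N \<epsilon> \<alpha> (n1 j) (n2 j) (cmle j (X j \<omega>) (Y j \<omega>)) (X j \<omega>) (Y j \<omega>)))"
  shows "(N (p - q) \<ge> \<epsilon> \<longrightarrow>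
            (N (p - q) > \<epsilon> \<longrightarrow> limsup (\<lambda>j. ereal (rej j)) = 0) \<and>
            (N (p - q) = \<epsilon> \<longrightarrow> limsup (\<lambda>j. ereal (rej j)) \<le> ereal \<alpha>))
       \<and> (N (p - q) < \<epsilon> \<longrightarrow> rej \<longlonglongrightarrow> 1)
       \<and> (hadamard_differentiable N (p - q) \<longrightarrow> N (p - q) \<ge> \<epsilon> \<longrightarrow>
            (N (p - q) > \<epsilon> \<longrightarrow> limsup (\<lambda>j. ereal (rej j)) = 0) \<and>
            (N (p - q) = \<epsilon> \<longrightarrow> limsup (\<lambda>j. ereal (rej j)) \<le> ereal \<alpha> \<and> rej \<longlonglongrightarrow> \<alpha>))"
proof -
  interpret bootstrap_test p q N d' n1 n2 c MZ Z \<alpha> \<epsilon> cmle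
    using p q N alpha cmle n_lim ratio deriv Z T_cont T_quantile unfolding T
    by unfold_locales auto
  have rej_eq: "rej = rej_prob"
  proof
    fix j
    interpret Mj: prob_space "M j" by (rule M)
    note XY = Mj.distr_indep_pair_pmf[OF indep X Y]
    have "rej_prob j = measure (distr (M j) (count_space UNIV) (\<lambda>\<omega>. (X j \<omega>, Y j \<omega>))) {z. rejects j z}"
      unfolding rej_prob_def sample_def two_sample_pmf_def XY(2) ..
    also have "\<dots> = measure (M j) ((\<lambda>\<omega>. (X j \<omega>, Y j \<omega>)) -` {z. rejects j z} \<inter> space (M j))"
      using XY(1) by (intro measure_distr) auto
    also have "\<dots> = rej j"
      unfolding rej by (intro arg_cong[where f = "measure (M j)"]) (auto simp: rejects_def stat_def test_stat_def)
    finally show "rej j = rej_prob j" ..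
  qed
  have far: "limsup (\<lambda>j. ereal (rej j)) = 0" if "\<epsilon> < N (p - q)"
  proof -
    have "(\<lambda>j. ereal (rej j)) \<longlonglongrightarrow> ereal 0" using rejection_far[OF that] unfolding rej_eq by simp
    from lim_imp_Limsup[OF sequentially_bot this] show ?thesis by (simp add: zero_ereal_def)
  qed
  have le: "limsup (\<lambda>j. ereal (rej j)) \<le> ereal \<alpha>" if "N (p - q) = \<epsilon>"
  proof (rule ereal_le_epsilon2)
    fix e :: real assume "0 < e"
    then show "limsup (\<lambda>j. ereal (rej j)) \<le> ereal \<alpha> + ereal e"
      using rejection_boundary_le[OF that, of e] by (intro Limsup_bounded) (simp add: rej_eq)
  qed
  have eq: "rej \<longlonglongrightarrow> \<alpha>" if "N (p - q) = \<epsilon>" and H: "hadamard_differentiable N (p - q)"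
  proof (rule tendstoI)
    obtain d2 where "has_dir_hadamard_derivative N d2 (p - q)" "linear d2"
      using H by (auto simp: hadamard_differentiable_def)
    then have lin: "linear d'" using dir_hadamard_unique[OF deriv(1)] by metis
    fix e :: real assume e: "0 < e"
    then have e2: "0 < e / 2" by simp
    from rejection_boundary_le[OF that(1) e2] rejection_boundary_ge[OF that(1) lin e2]
    show "\<forall>\<^sub>F j in sequentially. dist (rej j) \<alpha> < e"
      by eventually_elim (use e in \<open>simp add: rej_eq dist_real_def abs_real_def\<close>)
  qed
  show ?thesis using far le eq rejection_inside by (auto simp: rej_eq)
qed

end
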